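(* Let $U$ be a finite-dimensional real vector space. There exists a surjective Hopf algebra morphism $\widetilde{\mathfrak a}\colon\mathcal H_{\mathrm{CK}}(U)\to\mathrm{QSh}(U)$ (the intrinsic quasi-arborification map), defined recursively by the condition $$\widetilde{\mathfrak a}([f]_\gamma)=\widetilde{\mathfrak a}(f)\otimes\gamma$$ for forests $f$ and $\gamma\in U$. The map $\widetilde{\mathfrak a}$ is natural in $U$ and is left inverse to the natural coalgebra map $\widetilde\iota\colon\mathrm{QSh}(U)\hookrightarrow\mathcal H_{\mathrm{CK}}(U)$ defined on letters by $\gamma_1\odot\cdots\odot\gamma_n\mapsto\pi(\mathscr r(\gamma_1,\ldots,\gamma_n))$ and extended to words by $s_1\otimes\cdots\otimes s_n\mapsto\widetilde\iota(s_1)\top\cdots\top\widetilde\iota(s_n)$ for $s_1,\ldots,s_n\in\bigodot(U)$.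
   Context: $\mathcal H(U)$ is spanned by non-planar rooted forests (including the empty forest $\mathbf 1$) with vertices decorated by elements of $U$, modulo multilinearity; $|f|$ is the number of vertices, $\mathcal H_+$ the span of non-empty forests. $\mathcal H_{\mathrm{CK}}(U)$ (Connes–Kreimer) has the disjoint union product and $\Delta_{\mathrm{CK}}f=\sum_Af|_A\otimes f|_{A^c}$, over vertex subsets $A$ closed under passing to descendants (upper part on the left). A linear map $U\to U'$ acts by relabelling. $\mathcal P(U)\subset\mathcal H_+$ is the space of primitives. $[f]_\gamma$ is the tree obtained by joining the roots of $f$ to a new root decorated by $\gamma$; $\mathscr r(\gamma_1,\ldots,\gamma_n)$ is the forest of $n$ single vertices decorated by $\gamma_1,\ldots,\gamma_n$. Natural growth $\top$ is bilinear with $f\top\mathbf 1=f=\mathbf 1\top f$ and $f\top g=\frac1{|g|}\sum_v(\text{graft all roots of }f\text{ onto }v\in g)$ for non-empty forests, iterated from the left. $p_1\otimes\cdots\otimes p_n\mapsto p_1\top\cdots\top p_n$ is a coalgebra isomorphism $\bigotimes(\mathcal P)\to\mathcal H_{\mathrm{CK}}$ (deconcatenation on the left), and $\pi\colon\mathcal H_{\mathrm{CK}}\to\mathcal P$ is the corresponding projection onto words of length one. $\mathrm{QSh}(U)$ is Hoffman's quasi-shuffle Hopf algebra on $\bigotimes(\bigodot(U))$, where $\bigodot(U)=\bigoplus_{n\ge1}U^{\odot n}$ with the symmetric product $\odot$: the coproduct is deconcatenation and the product $\widetilde{\sqcup\!\sqcup}$ is determined by the empty word being the unit and $(wa)\,\widetilde{\sqcup\!\sqcup}\,(vb)=(w\,\widetilde{\sqcup\!\sqcup}\,vb)a+(wa\,\widetilde{\sqcup\!\sqcup}\,v)b+(w\,\widetilde{\sqcup\!\sqcup}\,v)(a\odot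 b)$ for words $w,v$ and letters $a,b\in\bigodot(U)$. *)

theory Defs
  imports Complex_Main "HOL-Library.Poly_Mapping" "HOL-Library.Multiset"
begin

section \<open>Vector spaces presented by generators and linear relations\<close>

instantiation poly_mapping :: (type, real_vector) real_vector
begin

lift_definition scaleR_poly_mapping :: "real \<Rightarrow> ('a \<Rightarrow>\<^sub>0 'b) \<Rightarrow> 'a \<Rightarrow>\<^sub>0 'b"
  is "\<lambda>c p x. c *\<^sub>R p x"
  by (erule rev_finite_subset) auto

instance
  by standard (transfer; simp add: fun_eq_iff algebra_simps)+

end

lemma lookup_scaleR: "Poly_Mapping.lookup (c *\<^sub>R p) x = c *\<^sub>R Poly_Mapping.lookup p x"
  by transfer simp

text \<open>A type of class \<open>presentation\<close> is a set of generators with a set of formal linear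
  combinations of generators that are to vanish.\<close>

class presentation =
  fixes relators :: "('a \<Rightarrow>\<^sub>0 real) set"

quotient_type (overloaded) 'x presented = "'x::presentation \<Rightarrow>\<^sub>0 real" /
  "\<lambda>p q. p - q \<in> span relators"
proof (rule equivpI)
  show "reflp (\<lambda>p q. p - q \<in> span (relators :: ('x \<Rightarrow>\<^sub>0 real) set))"
    by (simp add: reflp_def span_zero)
  show "symp (\<lambda>p q. p - q \<in> span (relators :: ('x \<Rightarrow>\<^sub>0 real) set))"
    by (metis (no_types, lifting) minus_diff_eq span_neg sympI)
  show "transp (\<lambda>p q. p - q \<in> span (relators :: ('x \<Rightarrow>\<^sub>0 real) set))"
    by (metis (no_types, lifting) diff_add_cancel add_diff_eq span_add transpI)
qed

instantiation presented :: (presentation) real_vector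
begin

lift_definition zero_presented :: "'a presented" is 0 .

lift_definition plus_presented :: "'a presented \<Rightarrow> 'a presented \<Rightarrow> 'a presented" is "(+)"
  by (metis (no_types, lifting) add_diff_add span_add)

lift_definition uminus_presented :: "'a presented \<Rightarrow> 'a presented" is uminus
  by (metis (no_types, lifting) minus_diff_minus span_neg)

lift_definition minus_presented :: "'a presented \<Rightarrow> 'a presented \<Rightarrow> 'a presented" is "(-)"
proof -
  fix p p' q q' :: "'a \<Rightarrow>\<^sub>0 real"
  assume "p - p' \<in> span relators" "q - q' \<in> span relators"
  then have "(p - p') - (q - q') \<in> span relators"
    by (rule span_diff)
  then show "(p - q) - (p' - q') \<in> span relators"
    by (simp add: algebra_simps)
qed

lift_definition scaleR_presented :: "real \<Rightarrow> 'a presented \<Rightarrow> 'a presented" is scaleR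
  by (metis (no_types, lifting) scaleR_diff_right span_scale)

instance
  by standard (transfer; simp add: algebra_simps span_zero)+

end

lift_definition gen :: "'x::presentation \<Rightarrow> 'x presented"
  is "\<lambda>x. Poly_Mapping.single x 1" .

text \<open>Extension of a function on generators to a linear map. Being computed on a chosen
  representative, it is meaningful only for functions that respect the relations; that it
  then has the expected properties is \<open>linear_lin_ext\<close> and \<open>lin_ext_gen\<close> below.\<close>

definition free_ext :: "('x \<Rightarrow> 'v::real_vector) \<Rightarrow> ('x \<Rightarrow>\<^sub>0 real) \<Rightarrow> 'v"
  where "free_ext g p = (\<Sum>x\<in>Poly_Mapping.keys p. Poly_Mapping.lookup p x *\<^sub>R g x)"

definition lin_ext :: "('x::presentation \<Rightarrow> 'v::real_vector) \<Rightarrow> 'x presented \<Rightarrow> 'v"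
  where "lin_ext g q = free_ext g (rep_presented q)"

lemma free_ext_superset:
  assumes "finite A" "Poly_Mapping.keys p \<subseteq> A"
  shows "free_ext g p = (\<Sum>x\<in>A. Poly_Mapping.lookup p x *\<^sub>R g x)"
  unfolding free_ext_def using assms
  by (intro sum.mono_neutral_left) (auto simp: in_keys_iff)

lemma linear_free_ext: "linear (free_ext g)"
proof (rule linearI)
  fix p q :: "'a \<Rightarrow>\<^sub>0 real" and c :: real
  have "Poly_Mapping.keys (p + q) \<subseteq> Poly_Mapping.keys p \<union> Poly_Mapping.keys q"
    by (rule Poly_Mapping.keys_add)
  then show "free_ext g (p + q) = free_ext g p + free_ext g q"
    by (simp add: free_ext_superset[of "Poly_Mapping.keys p \<union> Poly_Mapping.keys q"] lookup_add scaleR_add_left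
        sum.distrib)
  have "Poly_Mapping.keys (c *\<^sub>R p) \<subseteq> Poly_Mapping.keys p"
    by (auto simp: in_keys_iff lookup_scaleR)
  then show "free_ext g (c *\<^sub>R p) = c *\<^sub>R free_ext g p"
    by (simp add: free_ext_superset[of "Poly_Mapping.keys p"] lookup_scaleR scaleR_sum_right)
qed

lemma free_ext_single: "free_ext g (Poly_Mapping.single x c) = c *\<^sub>R g x"
  by (cases "c = 0") (simp_all add: free_ext_def)

context
  fixes g :: "'x::presentation \<Rightarrow> 'v::real_vector"
  assumes respects: "\<And>r. r \<in> relators \<Longrightarrow> free_ext g r = 0"
begin

lemma free_ext_eqI:
  assumes "p - q \<in> span relators"
  shows "free_ext g p = free_ext g q"
proof -
  have "free_ext g (p - q) = 0"
    using linear_eq_0_on_span[OF linear_free_ext[of g] respects assms] .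
  then show ?thesis
    by (simp add: linear_diff[OF linear_free_ext])
qed

lemma lin_ext_abs_presented: "lin_ext g (abs_presented p) = free_ext g p"
proof -
  have "rep_presented (abs_presented p) - p \<in> span relators"
    using Quotient_rep_abs[OF Quotient_presented] span_zero by fastforce
  then show ?thesis
    by (simp add: lin_ext_def free_ext_eqI)
qed

lemma linear_lin_ext: "linear (lin_ext g)"
proof (rule linearI)
  fix a b :: "'x presented" and c :: real
  obtain p q where pq: "a = abs_presented p" "b = abs_presented q"
    by (metis Quotient_abs_rep[OF Quotient_presented])
  show "lin_ext g (a + b) = lin_ext g a + lin_ext g b"
    by (simp add: pq plus_presented.abs_eq lin_ext_abs_presented linear_add[OF linear_free_ext])
  show "lin_ext g (c *\<^sub>R a) = c *\<^sub>R lin_ext g a"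
    by (simp add: pq scaleR_presented.abs_eq lin_ext_abs_presented
        linear_scale[OF linear_free_ext])
qed

lemma lin_ext_gen: "lin_ext g (gen x) = g x"
  by (simp add: gen.abs_eq lin_ext_abs_presented free_ext_single)

end

section \<open>Tensor products, tensor algebras, symmetric powers\<close>

text \<open>\<open>('v \<times> 'w) presented\<close> is the tensor product of \<open>'v\<close> and \<open>'w\<close>.\<close>

instantiation prod :: (real_vector, real_vector) presentation
begin

definition relators_prod :: "(('a \<times> 'b) \<Rightarrow>\<^sub>0 real) set" where
  "relators_prod =
     {Poly_Mapping.single (a *\<^sub>R x + b *\<^sub>R y, z) 1
        - a *\<^sub>R Poly_Mapping.single (x, z) 1 - b *\<^sub>R Poly_Mapping.single (y, z) 1 | a b x y z. True}
   \<union> {Poly_Mapping.single (z, a *\<^sub>R x + b *\<^sub>R y) 1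
        - a *\<^sub>R Poly_Mapping.single (z, x) 1 - b *\<^sub>R Poly_Mapping.single (z, y) 1 | a b x y z. True}"

instance ..

end

abbreviation tensor :: "'v::real_vector \<Rightarrow> 'w::real_vector \<Rightarrow> ('v \<times> 'w) presented"
  (infixr "\<otimes>\<^sub>t" 75)
  where "v \<otimes>\<^sub>t w \<equiv> gen (v, w)"

definition tensor_map ::
  "('v::real_vector \<Rightarrow> 'v'::real_vector) \<Rightarrow> ('w::real_vector \<Rightarrow> 'w'::real_vector)
     \<Rightarrow> ('v \<times> 'w) presented \<Rightarrow> ('v' \<times> 'w') presented"
  where "tensor_map \<phi> \<psi> = lin_ext (\<lambda>(v, w). \<phi> v \<otimes>\<^sub>t \<psi> w)"

text \<open>\<open>'v list presented\<close> is the direct sum of all tensor powers of \<open>'v\<close>; the generator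
  \<open>gen [v\<^sub>1, \<dots>, v\<^sub>n]\<close> is the word \<open>v\<^sub>1 \<otimes> \<dots> \<otimes> v\<^sub>n\<close>.\<close>

instantiation list :: (real_vector) presentation
begin

definition relators_list :: "('a list \<Rightarrow>\<^sub>0 real) set" where
  "relators_list =
     {Poly_Mapping.single (us @ (a *\<^sub>R x + b *\<^sub>R y) # vs) 1
        - a *\<^sub>R Poly_Mapping.single (us @ x # vs) 1
        - b *\<^sub>R Poly_Mapping.single (us @ y # vs) 1 | us vs a b x y. True}"

instance ..

end

type_synonym 'v tensor_algebra = "'v list presented"

definition snoc :: "'v::real_vector tensor_algebra \<Rightarrow> 'v \<Rightarrow> 'v tensor_algebra"
  where "snoc x v = lin_ext (\<lambda>w. gen (w @ [v])) x"

definition deconcatenation ::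
  "'v::real_vector tensor_algebra \<Rightarrow> ('v tensor_algebra \<times> 'v tensor_algebra) presented"
  where "deconcatenation = lin_ext (\<lambda>w. \<Sum>i\<le>length w. gen (take i w) \<otimes>\<^sub>t gen (drop i w))"

definition empty_word_coeff :: "'v::real_vector tensor_algebra \<Rightarrow> real"
  where "empty_word_coeff = lin_ext (\<lambda>w. if w = [] then 1 else 0)"

definition letter_part :: "'v::real_vector tensor_algebra \<Rightarrow> 'v"
  where "letter_part = lin_ext (\<lambda>w. case w of [v] \<Rightarrow> v | _ \<Rightarrow> 0)"

text \<open>\<open>'u symmetric\<close> is the direct sum of the symmetric powers of \<open>'u\<close> of order at least one;
  the generator given by the nonempty list \<open>[\<gamma>\<^sub>1, \<dots>, \<gamma>\<^sub>n]\<close> is \<open>\<gamma>\<^sub>1 \<odot> \<dots> \<odot> \<gamma>\<^sub>n\<close>.\<close>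

typedef 'u nelist = "{xs :: 'u list. xs \<noteq> []}"
  by auto

setup_lifting type_definition_nelist

lift_definition nelist_append :: "'u nelist \<Rightarrow> 'u nelist \<Rightarrow> 'u nelist" is append
  by simp

lift_definition nelist_single :: "'u \<Rightarrow> 'u nelist" is "\<lambda>u. [u]"
  by simp

lift_definition nelist_map :: "('u \<Rightarrow> 'v) \<Rightarrow> 'u nelist \<Rightarrow> 'v nelist" is map
  by simp

instantiation nelist :: (real_vector) presentation
begin

definition relators_nelist :: "('a nelist \<Rightarrow>\<^sub>0 real) set" where
  "relators_nelist =
     {Poly_Mapping.single (Abs_nelist (us @ (a *\<^sub>R x + b *\<^sub>R y) # vs)) 1
        - a *\<^sub>R Poly_Mapping.single (Abs_nelist (us @ x # vs)) 1
        - b *\<^sub>R Poly_Mapping.single (Abs_nelist (us @ y # vs)) 1 | us vs a b x y. True}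
   \<union> {Poly_Mapping.single xs 1 - Poly_Mapping.single ys 1 | xs ys.
        mset (Rep_nelist xs) = mset (Rep_nelist ys)}"

instance ..

end

type_synonym 'u symmetric = "'u nelist presented"

definition odot :: "'u::real_vector symmetric \<Rightarrow> 'u symmetric \<Rightarrow> 'u symmetric"
  (infixl "\<odot>" 70)
  where "s \<odot> t = lin_ext (\<lambda>xs. lin_ext (\<lambda>ys. gen (nelist_append xs ys)) t) s"

definition letter :: "'u::real_vector \<Rightarrow> 'u symmetric"
  where "letter \<gamma> = gen (nelist_single \<gamma>)"

definition symmetric_map ::
  "('u::real_vector \<Rightarrow> 'v::real_vector) \<Rightarrow> 'u symmetric \<Rightarrow> 'v symmetric"
  where "symmetric_map \<phi> = lin_ext (\<lambda>xs. gen (nelist_map \<phi> xs))"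

section \<open>Hopf algebras and their morphisms\<close>

record (overloaded) 'a hopf_struct =
  hopf_mult :: "'a \<Rightarrow> 'a \<Rightarrow> 'a"
  hopf_unit :: 'a
  hopf_comult :: "'a \<Rightarrow> ('a \<times> 'a) presented"
  hopf_counit :: "'a \<Rightarrow> real"

definition algebra_morphism ::
  "'a::real_vector hopf_struct \<Rightarrow> 'b::real_vector hopf_struct \<Rightarrow> ('a \<Rightarrow> 'b) \<Rightarrow> bool"
  where "algebra_morphism A B \<phi> \<longleftrightarrow>
    linear \<phi> \<and> \<phi> (hopf_unit A) = hopf_unit B \<and>
    (\<forall>x y. \<phi> (hopf_mult A x y) = hopf_mult B (\<phi> x) (\<phi> y))"

definition coalgebra_morphism ::
  "'a::real_vector hopf_struct \<Rightarrow> 'b::real_vector hopf_struct \<Rightarrow> ('a \<Rightarrow> 'b) \<Rightarrow> bool"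
  where "coalgebra_morphism A B \<phi> \<longleftrightarrow>
    linear \<phi> \<and> (\<forall>x. hopf_counit B (\<phi> x) = hopf_counit A x) \<and>
    (\<forall>x. hopf_comult B (\<phi> x) = tensor_map \<phi> \<phi> (hopf_comult A x))"

definition antipode :: "'a::real_vector hopf_struct \<Rightarrow> ('a \<Rightarrow> 'a) \<Rightarrow> bool"
  where "antipode A S \<longleftrightarrow>
    linear S \<and>
    (\<forall>x. lin_ext (\<lambda>(y, z). hopf_mult A (S y) z) (hopf_comult A x)
       = hopf_counit A x *\<^sub>R hopf_unit A) \<and>
    (\<forall>x. lin_ext (\<lambda>(y, z). hopf_mult A y (S z)) (hopf_comult A x)
       = hopf_counit A x *\<^sub>R hopf_unit A)"

definition hopf_morphism ::
  "'a::real_vector hopf_struct \<Rightarrow> 'b::real_vector hopf_struct \<Rightarrow> ('a \<Rightarrow> 'b) \<Rightarrow> bool"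
  where "hopf_morphism A B \<phi> \<longleftrightarrow>
    algebra_morphism A B \<phi> \<and> coalgebra_morphism A B \<phi> \<and>
    (\<forall>S T. antipode A S \<and> antipode B T \<longrightarrow> \<phi> \<circ> S = T \<circ> \<phi>)"

section \<open>Decorated rooted forests\<close>

text \<open>A forest is given by a finite set of vertices (natural numbers), a set of edges
  \<open>(child, parent)\<close> and a decoration, whose values off the vertex set are irrelevant.
  Isomorphic forests get identified only in the space \<open>'u forests\<close> below.\<close>

definition is_forest :: "nat set \<Rightarrow> (nat \<times> nat) set \<Rightarrow> bool"
  where "is_forest V E \<longleftrightarrow> finite V \<and> E \<subseteq> V \<times> V \<and> single_valued E \<and> acyclic E"

lemma is_forest_wf: "is_forest V E \<longleftrightarrow> finite V \<and> E \<subseteq> V \<times> V \<and> single_valued E \<and> wf E"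
  unfolding is_forest_def
  by (meson finite_SigmaI finite_acyclic_wf finite_subset wf_acyclic)

typedef 'u forest =
  "{(V :: nat set, E :: (nat \<times> nat) set, d :: nat \<Rightarrow> 'u). is_forest V E}"
  by (rule exI[of _ "({}, {}, undefined)"]) (simp add: is_forest_wf)

setup_lifting type_definition_forest

lift_definition verts :: "'u forest \<Rightarrow> nat set" is fst .

lift_definition edges :: "'u forest \<Rightarrow> (nat \<times> nat) set" is "\<lambda>(V, E, d). E" .

lift_definition dec :: "'u forest \<Rightarrow> nat \<Rightarrow> 'u" is "\<lambda>(V, E, d). d" .

definition forest_iso :: "'u forest \<Rightarrow> 'u forest \<Rightarrow> bool"
  where "forest_iso f g \<longleftrightarrow> (\<exists>h. bij_betw h (verts f) (verts g) \<and>
    (\<forall>v\<in>verts f. \<forall>w\<in>verts f. (v, w) \<in> edges f \<longleftrightarrow> (h v, h w) \<in> edges g) \<and>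
    (\<forall>v\<in>verts f. dec g (h v) = dec f v))"

lift_definition redecorate :: "('u \<Rightarrow> 'v) \<Rightarrow> 'u forest \<Rightarrow> 'v forest"
  is "\<lambda>\<phi> (V, E, d). (V, E, \<phi> \<circ> d)"
  by auto

lift_definition dec_update :: "'u forest \<Rightarrow> nat \<Rightarrow> 'u \<Rightarrow> 'u forest"
  is "\<lambda>(V, E, d) v u. (V, E, d(v := u))"
  by auto

lift_definition empty_forest :: "'u forest" is "({}, {}, undefined)"
  by (simp add: is_forest_wf)

text \<open>\<open>isolated [\<gamma>\<^sub>1, \<dots>, \<gamma>\<^sub>n]\<close> consists of \<open>n\<close> single vertices.\<close>

lift_definition isolated :: "'u list \<Rightarrow> 'u forest" is "\<lambda>xs. ({..<length xs}, {}, nth xs)"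
  by (simp add: is_forest_wf)

text \<open>Induced forest on a set of vertices; it is only used for sets of vertices closed under
  passing to descendants, and for their complements.\<close>

lift_definition induced :: "'u forest \<Rightarrow> nat set \<Rightarrow> 'u forest"
  is "\<lambda>(V, E, d) A. (V \<inter> A, E \<inter> A \<times> A, d)"
  by (auto simp: is_forest_wf single_valued_def intro: wf_subset)

text \<open>In a disjoint union the vertices of the first forest become even and those of the
  second odd.\<close>

definition union_edges :: "(nat \<times> nat) set \<Rightarrow> (nat \<times> nat) set \<Rightarrow> (nat \<times> nat) set"
  where "union_edges E E' =
    map_prod (\<lambda>n. 2 * n) (\<lambda>n. 2 * n) ` E \<union> map_prod (\<lambda>n. 2 * n + 1) (\<lambda>n. 2 * n + 1) ` E'"

definition union_dec :: "(nat \<Rightarrow> 'u) \<Rightarrow> (nat \<Rightarrow> 'u) \<Rightarrow> nat \<Rightarrow> 'u"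
  where "union_dec d d' n = (if even n then d (n div 2) else d' (n div 2))"

definition union_verts :: "nat set \<Rightarrow> nat set \<Rightarrow> nat set"
  where "union_verts V V' = (\<lambda>n. 2 * n) ` V \<union> (\<lambda>n. 2 * n + 1) ` V'"

lemma is_forest_graft:
  assumes f: "is_forest V E" and g: "is_forest V' E'"
    and R: "R \<subseteq> V - Domain E" and v: "R \<noteq> {} \<Longrightarrow> v \<in> V'"
  shows "is_forest (union_verts V V')
           (union_edges E E' \<union> (\<lambda>r. (2 * r, 2 * v + 1)) ` R)"
proof -
  let ?X = "(\<lambda>r. (2 * r, 2 * v + 1)) ` R"
  let ?E = "map_prod (\<lambda>n. 2 * n) (\<lambda>n. 2 * n) ` E :: (nat \<times> nat) set"
  let ?E' = "map_prod (\<lambda>n. 2 * n + 1) (\<lambda>n. 2 * n + 1) ` E' :: (nat \<times> nat) set"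
  have wfE: "wf ?E" and wfE': "wf ?E'"
    using f g by (auto simp: is_forest_wf inj_def intro!: wf_map_prod_image)
  have wfX: "wf ?X"
    by (rule wf_subset[OF wf_measure[of "\<lambda>n. if even n then 0 else (1::nat)"]]) auto
  have neq: "2 * a \<noteq> Suc (2 * b)" "Suc (2 * b) \<noteq> 2 * a" for a b :: nat
    by presburger+
  have "wf (?X \<union> ?E')"
    by (rule wf_Un[OF wfX wfE']) (auto simp: neq)
  then have "wf (?E \<union> (?X \<union> ?E'))"
    by (rule wf_Un[OF wfE]) (auto simp: neq)
  moreover have "?E \<union> (?X \<union> ?E') = union_edges E E' \<union> ?X"
    by (auto simp: union_edges_def)
  ultimately have "wf (union_edges E E' \<union> ?X)"
    by simp
  moreover have "single_valued (union_edges E E' \<union> ?X)"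
    using f g R unfolding union_edges_def is_forest_def single_valued_def
    by (auto simp: neq)
  moreover have "v \<in> V'" if "r \<in> R" for r
    using v that by blast
  ultimately show ?thesis
    using f g R unfolding is_forest_wf union_verts_def union_edges_def by auto
qed

lift_definition disjoint_union :: "'u forest \<Rightarrow> 'u forest \<Rightarrow> 'u forest"
  is "\<lambda>(V, E, d) (V', E', d'). (union_verts V V', union_edges E E', union_dec d d')"
  using is_forest_graft[where R = "{}"] by auto

text \<open>All roots of the first forest are grafted onto the vertex \<open>v\<close> of the second.\<close>

lift_definition graft :: "'u forest \<Rightarrow> nat \<Rightarrow> 'u forest \<Rightarrow> 'u forest"
  is "\<lambda>(V, E, d) v (V', E', d'). (union_verts V V',
        union_edges E E' \<union> (\<lambda>r. (2 * r, 2 * v + 1)) ` {r \<in> V - Domain E. v \<in> V'},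
        union_dec d d')"
  by (clarsimp split: prod.splits) (rule is_forest_graft[simplified]; auto)

text \<open>\<open>add_root \<gamma> f\<close> is \<open>[f]\<^sub>\<gamma>\<close>; the new root is the vertex \<open>0\<close>.\<close>

lift_definition add_root :: "'u \<Rightarrow> 'u forest \<Rightarrow> 'u forest"
  is "\<lambda>\<gamma> (V, E, d). (insert 0 (Suc ` V),
        map_prod Suc Suc ` E \<union> {(Suc r, 0) | r. r \<in> V - Domain E},
        \<lambda>n. case n of 0 \<Rightarrow> \<gamma> | Suc m \<Rightarrow> d m)"
proof clarsimp
  fix V E
  assume f: "is_forest V E"
  have "wf (map_prod Suc Suc ` E)"
    using f by (intro wf_map_prod_image) (auto simp: is_forest_wf)
  moreover have "wf {(Suc r, 0) | r. r \<in> V \<and> r \<notin> Domain E}"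
    by (rule wf_subset[OF wf_measure[of "\<lambda>n. if n = 0 then 1 else (0::nat)"]]) auto
  ultimately have "wf (map_prod Suc Suc ` E \<union> {(Suc r, 0) | r. r \<in> V \<and> r \<notin> Domain E})"
    by (rule wf_Un) auto
  moreover have
    "single_valued (map_prod Suc Suc ` E \<union> {(Suc r, 0) | r. r \<in> V \<and> r \<notin> Domain E})"
    using f unfolding is_forest_def single_valued_def by auto
  ultimately show "is_forest (insert 0 (Suc ` V))
      (map_prod Suc Suc ` E \<union> {(Suc r, 0) | r. r \<in> V \<and> r \<notin> Domain E})"
    using f by (auto simp: is_forest_wf)
qed

text \<open>Sets of vertices that are closed under passing to descendants; closure under passing
  to children suffices.\<close>

definition upper_sets :: "'u forest \<Rightarrow> nat set set"
  where "upper_sets f = {A. A \<subseteq> verts f \<and> (\<forall>(v, w)\<in>edges f. w \<in> A \<longrightarrow> v \<in> A)}"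

section \<open>The Connes--Kreimer Hopf algebra\<close>

instantiation forest :: (real_vector) presentation
begin

definition relators_forest :: "('a forest \<Rightarrow>\<^sub>0 real) set" where
  "relators_forest =
     {Poly_Mapping.single (dec_update f v (a *\<^sub>R x + b *\<^sub>R y)) 1
        - a *\<^sub>R Poly_Mapping.single (dec_update f v x) 1
        - b *\<^sub>R Poly_Mapping.single (dec_update f v y) 1 | f v a b x y. v \<in> verts f}
   \<union> {Poly_Mapping.single f 1 - Poly_Mapping.single g 1 | f g. forest_iso f g}"

instance ..

end

type_synonym 'u forests = "'u forest presented"

definition ck_mult :: "'u::real_vector forests \<Rightarrow> 'u forests \<Rightarrow> 'u forests"
  where "ck_mult x y = lin_ext (\<lambda>f. lin_ext (\<lambda>g. gen (disjoint_union f g)) y) x"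

definition ck_comult :: "'u::real_vector forests \<Rightarrow> ('u forests \<times> 'u forests) presented"
  where "ck_comult = lin_ext (\<lambda>f. \<Sum>A\<in>upper_sets f.
    gen (induced f A) \<otimes>\<^sub>t gen (induced f (verts f - A)))"

definition ck_counit :: "'u::real_vector forests \<Rightarrow> real"
  where "ck_counit = lin_ext (\<lambda>f. if verts f = {} then 1 else 0)"

definition CK :: "'u::real_vector forests hopf_struct"
  where "CK = \<lparr>hopf_mult = ck_mult, hopf_unit = gen empty_forest, hopf_comult = ck_comult,
    hopf_counit = ck_counit\<rparr>"

definition relabel :: "('u::real_vector \<Rightarrow> 'v::real_vector) \<Rightarrow> 'u forests \<Rightarrow> 'v forests"
  where "relabel \<phi> = lin_ext (\<lambda>f. gen (redecorate \<phi> f))"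

definition primitives :: "'u::real_vector forests set"
  where "primitives = {x. hopf_comult CK x = x \<otimes>\<^sub>t hopf_unit CK + hopf_unit CK \<otimes>\<^sub>t x}"

definition natural_growth :: "'u::real_vector forests \<Rightarrow> 'u forests \<Rightarrow> 'u forests"
  (infixl "\<top>\<^sub>n" 70)
  where "x \<top>\<^sub>n y = lin_ext (\<lambda>f. lin_ext (\<lambda>g.
    if verts f = {} then gen g
    else if verts g = {} then gen f
    else (1 / real (card (verts g))) *\<^sub>R (\<Sum>v\<in>verts g. gen (graft f v g))) y) x"

text \<open>\<open>growth_word [x\<^sub>1, \<dots>, x\<^sub>n]\<close> is \<open>(\<dots>(x\<^sub>1 \<top> x\<^sub>2) \<top> \<dots>) \<top> x\<^sub>n\<close>.\<close>

definition growth_word :: "'u::real_vector forests list \<Rightarrow> 'u forests"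
  where "growth_word xs = foldl (\<top>\<^sub>n) (hopf_unit CK) xs"

text \<open>The tensor algebra over the space of primitives, as a subspace of the one over all of
  \<open>'u forests\<close>.\<close>

definition primitive_words :: "'u::real_vector forests tensor_algebra set"
  where "primitive_words = span {gen ps | ps. set ps \<subseteq> primitives}"

text \<open>The first letter part of the inverse of the isomorphism
  \<open>p\<^sub>1 \<otimes> \<dots> \<otimes> p\<^sub>n \<mapsto> p\<^sub>1 \<top> \<dots> \<top> p\<^sub>n\<close>.\<close>

definition primitive_projection :: "'u::real_vector forests \<Rightarrow> 'u forests"
  where "primitive_projection x = letter_part (inv_into primitive_words (lin_ext growth_word) x)"

section \<open>The quasi-shuffle Hopf algebra\<close>

type_synonym 'u quasi_words = "'u symmetric tensor_algebra"

function qsh_words :: "'u::real_vector symmetric list \<Rightarrow> 'u symmetric list \<Rightarrow> 'u quasi_words"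
  where
    "qsh_words [] v = gen v"
  | "qsh_words (w @ [a]) [] = gen (w @ [a])"
  | "qsh_words (w @ [a]) (v @ [b]) =
       snoc (qsh_words w (v @ [b])) a + snoc (qsh_words (w @ [a]) v) b
         + snoc (qsh_words w v) (a \<odot> b)"
  by (metis prod.exhaust rev_exhaust) auto
termination
  by (relation "measure (\<lambda>(w, v). length w + length v)") auto

definition qsh_mult :: "'u::real_vector quasi_words \<Rightarrow> 'u quasi_words \<Rightarrow> 'u quasi_words"
  where "qsh_mult x y = lin_ext (\<lambda>w. lin_ext (\<lambda>v. qsh_words w v) y) x"

definition QSh :: "'u::real_vector quasi_words hopf_struct"
  where "QSh = \<lparr>hopf_mult = qsh_mult, hopf_unit = gen [], hopf_comult = deconcatenation,
    hopf_counit = empty_word_coeff\<rparr>"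

definition quasi_map ::
  "('u::real_vector \<Rightarrow> 'v::real_vector) \<Rightarrow> 'u quasi_words \<Rightarrow> 'v quasi_words"
  where "quasi_map \<phi> = lin_ext (\<lambda>w. gen (map (symmetric_map \<phi>) w))"

definition iota_letter :: "'u::real_vector symmetric \<Rightarrow> 'u forests"
  where "iota_letter =
    lin_ext (\<lambda>\<gamma>s. primitive_projection (gen (isolated (Rep_nelist \<gamma>s))))"

definition iota :: "'u::real_vector quasi_words \<Rightarrow> 'u forests"
  where "iota = lin_ext (\<lambda>w. growth_word (map iota_letter w))"

text \<open>The recursive condition determining the quasi-arborification map.\<close>

definition quasi_arborification_rec :: "('u::real_vector forests \<Rightarrow> 'u quasi_words) \<Rightarrow> bool"
  where "quasi_arborification_rec \<aa> \<longleftrightarrow>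
    (\<forall>f \<gamma>. \<aa> (gen (add_root \<gamma> f)) = snoc (\<aa> (gen f)) (letter \<gamma>))"

end

theory Submission
  imports Defs "HOL-Combinatorics.Permutations"
begin

text \<open>
  Both \<open>iota\<close> and the quasi-arborification map are explained by one recursion. Words are
  cofree: a linear map \<open>l\<close> from forests to a space of letters that vanishes at the empty forest
  extends to the coalgebra map \<open>L\<close> to words that sends the empty forest to the empty word and has
  \<open>L(f) = \<Sum> L(f') \<otimes> l(f'')\<close> for nonempty \<open>f\<close>, where \<open>f'\<close> and \<open>f''\<close> run over the upper and lower parts of
  the cuts of \<open>f\<close> (\<open>word_lift\<close>; \<open>deconcatenation_word_lift\<close> rests on coassociativity).

  The quasi-arborification map is the lift of the map \<open>antichain_letter\<close> that sends a nonempty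
  forest without edges to the symmetric product of its decorations and any other forest to
  \<open>0\<close>. On a tree the last letter can only be the root, which is the required recursion
  (\<open>quasi_arborification_add_root\<close>). An antichain in a product of two forests lies in the
  first forest, in the second, or is composed of two antichains, and these three
  cases are the three terms of the quasi-shuffle recursion (\<open>quasi_arborification_mult\<close>).
  Every nonempty forest is a product of a tree \<open>[f]\<^sub>\<gamma>\<close> with a smaller forest
  (\<open>forest_decomposition\<close>), so the recursion determines an algebra morphism. Antipodes are
  preserved because the antipode equation can be solved recursively on both sides.

  For \<open>iota\<close> one has to know the projection \<open>\<pi>\<close> onto the primitive elements. Its key is the
  cocycle property \<open>\<Delta>(x \<top> p) = \<Sum> x' \<otimes> (x'' \<top> p) + (x \<top> p) \<otimes> \<one>\<close> for primitive \<open>p\<close>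
  (\<open>ck_comult_growth_primitive\<close>). It comes from an exact formula for the coproduct of the
  sum of all graftings, once division by the number of vertices is known to
  preserve primitive elements. A map \<open>\<pi>\<close> is defined by solving
  \<open>x = \<epsilon>(x) \<one> + \<Sum> x' \<top> \<pi>(x'')\<close> recursively (\<open>primitive_part\<close>, \<open>growth_expansion\<close>). The cocycle
  property shows that its values are primitive and that \<open>\<pi>(x \<top> p) = \<epsilon>(x) p\<close>. Therefore
  the lift of \<open>\<pi>\<close> to words is inverse to
  \<open>p\<^sub>1 \<otimes> \<dots> \<otimes> p\<^sub>n \<mapsto> p\<^sub>1 \<top> \<dots> \<top> p\<^sub>n\<close>, and \<open>\<pi>\<close> is indeed the
  projection in question (\<open>primitive_projection_eq\<close>).

  Finally, \<open>antichain_letter\<close> annihilates \<open>x \<top> p\<close> for \<open>x\<close> in the kernel of the counit, since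
  grafting creates an edge. So it does not distinguish between \<open>\<pi>(x)\<close> and \<open>x\<close>, and its lift sends
  \<open>x \<top> p\<close> to the image of \<open>x\<close> with one letter appended. This gives the left inverse property
  (\<open>quasi_arborification_iota\<close>), which implies that the quasi-arborification map is
  surjective and that \<open>iota\<close> is injective.
\<close>

section \<open>Linear and bilinear maps out of presented spaces\<close>

definition respectful :: "('x::presentation \<Rightarrow> 'v::real_vector) \<Rightarrow> bool"
  where "respectful g \<longleftrightarrow> (\<forall>r\<in>relators. free_ext g r = 0)"

lemma linear_ext: "respectful g \<Longrightarrow> linear (lin_ext g)"
  by (rule linear_lin_ext) (simp add: respectful_def)

lemma ext_gen: "respectful g \<Longrightarrow> lin_ext g (gen x) = g x"
  by (rule lin_ext_gen) (simp add: respectful_def)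

lemma poly_mapping_eq_sum_single:
  fixes p :: "'x \<Rightarrow>\<^sub>0 real"
  shows "p = (\<Sum>x\<in>Poly_Mapping.keys p. Poly_Mapping.lookup p x *\<^sub>R Poly_Mapping.single x 1)"
proof (rule poly_mapping_eqI)
  fix k
  have "Poly_Mapping.lookup (\<Sum>x\<in>A. Poly_Mapping.lookup p x *\<^sub>R Poly_Mapping.single x 1) k
      = (if k \<in> A then Poly_Mapping.lookup p k else 0)" if "finite A" for A
    using that by induction (auto simp: lookup_add lookup_scaleR lookup_single when_def)
  from this[of "Poly_Mapping.keys p"] show "Poly_Mapping.lookup p k = Poly_Mapping.lookup
      (\<Sum>x\<in>Poly_Mapping.keys p. Poly_Mapping.lookup p x *\<^sub>R Poly_Mapping.single x 1) k"
    by (simp add: in_keys_iff)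
qed

lemma abs_presented_eq_free_ext: "abs_presented p = free_ext gen p"
proof -
  have lin: "linear (abs_presented :: _ \<Rightarrow> 'a presented)"
    by (simp add: linear_iff plus_presented.abs_eq scaleR_presented.abs_eq)
  have "abs_presented p = abs_presented
      (\<Sum>x\<in>Poly_Mapping.keys p. Poly_Mapping.lookup p x *\<^sub>R Poly_Mapping.single x 1)"
    by (rule arg_cong[OF poly_mapping_eq_sum_single])
  also have "\<dots> = free_ext gen p"
    by (simp add: linear_sum[OF lin] linear_scale[OF lin] free_ext_def gen.abs_eq)
  finally show ?thesis .
qed

lemma respectful_gen: "respectful gen"
  unfolding respectful_def
proof
  fix r :: "'a \<Rightarrow>\<^sub>0 real"
  assume "r \<in> relators"
  then have "abs_presented r = abs_presented 0"
    by (simp add: presented.abs_eq_iff span_base)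
  then show "free_ext gen r = 0"
    by (simp add: abs_presented_eq_free_ext free_ext_def)
qed

lemma presented_eq_sum_gen:
  obtains A c where "finite A" "(q :: 'x::presentation presented) = (\<Sum>x\<in>A. c x *\<^sub>R gen x)"
proof -
  obtain p where "q = abs_presented p"
    by (metis Quotient_abs_rep[OF Quotient_presented])
  then show ?thesis
    by (intro that[of "Poly_Mapping.keys p" "Poly_Mapping.lookup p"])
       (auto simp: abs_presented_eq_free_ext free_ext_def)
qed

lemma linear_eq_on_gen:
  assumes F: "linear F" and G: "linear G" and eq: "\<And>x. F (gen x) = G (gen x)"
  shows "F q = G q"
proof -
  obtain A c where "finite A" "q = (\<Sum>x\<in>A. c x *\<^sub>R gen x)"
    by (rule presented_eq_sum_gen)
  then show ?thesis
    by (simp add: linear_sum[OF F] linear_sum[OF G] linear_scale[OF F] linear_scale[OF G] eq)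
qed

lemma linear_zero_fun: "linear (\<lambda>x. 0)"
  by (simp add: linear_iff)

lemma linear_self: "linear (\<lambda>x. x)"
  by (simp add: linear_iff)

lemma linear_plus: "linear f \<Longrightarrow> linear g \<Longrightarrow> linear (\<lambda>x. f x + g x)"
  by (simp add: linear_iff algebra_simps)

lemma linear_minus: "linear f \<Longrightarrow> linear g \<Longrightarrow> linear (\<lambda>x. f x - g x)"
  by (simp add: linear_iff algebra_simps)

lemma linear_scaled: "linear f \<Longrightarrow> linear (\<lambda>x. c *\<^sub>R f x)"
  by (simp add: linear_iff algebra_simps)

lemma linear_scaled_vec: "linear f \<Longrightarrow> linear (\<lambda>x. f x *\<^sub>R v)"
  by (simp add: linear_iff algebra_simps)

lemma linear_sum_fun: "(\<And>i. i \<in> A \<Longrightarrow> linear (f i)) \<Longrightarrow> linear (\<lambda>x. \<Sum>i\<in>A. f i x)"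
  by (induction A rule: infinite_finite_induct) (auto intro: linear_zero_fun linear_plus)

lemma linear_comp: "linear g \<Longrightarrow> linear f \<Longrightarrow> linear (\<lambda>x. g (f x))"
  by (simp add: linear_iff)

lemmas linear_arith =
  linear_zero_fun linear_self linear_plus linear_minus linear_scaled linear_scaled_vec
  linear_sum_fun

definition bilinear :: "('a::real_vector \<Rightarrow> 'b::real_vector \<Rightarrow> 'c::real_vector) \<Rightarrow> bool"
  where "bilinear m \<longleftrightarrow> (\<forall>y. linear (\<lambda>x. m x y)) \<and> (\<forall>x. linear (m x))"

lemma bilinearI: "(\<And>y. linear (\<lambda>x. m x y)) \<Longrightarrow> (\<And>x. linear (\<lambda>y. m x y)) \<Longrightarrow> bilinear m"
  by (simp add: bilinear_def)

lemma bilinear_left: "bilinear m \<Longrightarrow> linear f \<Longrightarrow> linear (\<lambda>x. m (f x) y)"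
  by (rule linear_comp[of "\<lambda>z. m z y"]) (simp_all add: bilinear_def)

lemma bilinear_right: "bilinear m \<Longrightarrow> linear f \<Longrightarrow> linear (\<lambda>y. m x (f y))"
  by (rule linear_comp) (simp_all add: bilinear_def)

lemma bilinear_comp:
  "bilinear m \<Longrightarrow> linear f \<Longrightarrow> linear g \<Longrightarrow> bilinear (\<lambda>x y. m (f x) (g y))"
  by (rule bilinearI; (rule bilinear_left bilinear_right; assumption))

lemma bilinear_eq_on_gen:
  assumes m: "bilinear m" and m': "bilinear m'" and eq: "\<And>x y. m (gen x) (gen y) = m' (gen x) (gen y)"
  shows "m p q = m' p q"
proof -
  have "m (gen x) q = m' (gen x) q" for x
    by (rule linear_eq_on_gen[of "m (gen x)" "m' (gen x)"])
       (use m m' eq in \<open>simp_all add: bilinear_def\<close>)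
  then show ?thesis
    by (rule linear_eq_on_gen[of "\<lambda>p. m p q" "\<lambda>p. m' p q", rotated 2])
       (use m m' in \<open>simp_all add: bilinear_def\<close>)
qed

text \<open>Evaluating a doubly extended function at a fixed second argument is again a linear
  combination of functions that respect the relators of the first argument.\<close>

lemma respectful_lin_ext_right:
  fixes F :: "'x::presentation \<Rightarrow> 'y::presentation \<Rightarrow> 'v::real_vector"
  assumes F1: "\<And>g. respectful (\<lambda>f. F f g)" and F2: "\<And>f. respectful (F f)"
  shows "respectful (\<lambda>f. lin_ext (F f) y)"
  unfolding respectful_def
proof
  fix r :: "'x \<Rightarrow>\<^sub>0 real"
  assume r: "r \<in> relators"
  have lin: "linear (\<lambda>y. free_ext (\<lambda>f. lin_ext (F f) y) r)"
    unfolding free_ext_def by (intro linear_arith linear_ext F2)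
  show "free_ext (\<lambda>f. lin_ext (F f) y) r = 0"
    by (rule linear_eq_on_gen[OF lin linear_zero_fun])
       (use F1 r in \<open>simp add: ext_gen[OF F2] respectful_def\<close>)
qed

lemma
  fixes F :: "'x::presentation \<Rightarrow> 'y::presentation \<Rightarrow> 'v::real_vector"
  assumes F1: "\<And>g. respectful (\<lambda>f. F f g)" and F2: "\<And>f. respectful (F f)"
  shows bilinear_ext: "bilinear (\<lambda>x y. lin_ext (\<lambda>f. lin_ext (\<lambda>g. F f g) y) x)"
    and bilinear_ext_gen: "lin_ext (\<lambda>f. lin_ext (\<lambda>g. F f g) (gen g)) (gen f) = F f g"
proof -
  note resp = respectful_lin_ext_right[of F, OF F1 F2]
  show "lin_ext (\<lambda>f. lin_ext (\<lambda>g. F f g) (gen g)) (gen f) = F f g"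
    by (simp add: ext_gen[OF F1] ext_gen[OF F2])
  have "linear (\<lambda>y. lin_ext (\<lambda>f. lin_ext (\<lambda>g. F f g) y) x)" for x
  proof (rule linearI)
    fix y y' :: "'y presented" and c :: real
    have lin: "linear (\<lambda>x. lin_ext (\<lambda>f. lin_ext (\<lambda>g. F f g) y) x)" for y
      using linear_ext[OF resp] .
    note add = linear_add[OF linear_ext[OF F2]] and scale = linear_scale[OF linear_ext[OF F2]]
    show "lin_ext (\<lambda>f. lin_ext (F f) (y + y')) x
        = lin_ext (\<lambda>f. lin_ext (F f) y) x + lin_ext (\<lambda>f. lin_ext (F f) y') x"
      by (rule linear_eq_on_gen[OF lin linear_plus[OF lin lin]]) (simp only: ext_gen[OF resp] flip: add)
    show "lin_ext (\<lambda>f. lin_ext (F f) (c *\<^sub>R y)) x = c *\<^sub>R lin_ext (\<lambda>f. lin_ext (F f) y) x"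
      by (rule linear_eq_on_gen[OF lin linear_scaled[OF lin]]) (simp only: ext_gen[OF resp] flip: scale)
  qed
  then show "bilinear (\<lambda>x y. lin_ext (\<lambda>f. lin_ext (\<lambda>g. F f g) y) x)"
    by (intro bilinearI linear_ext[OF resp])
qed

lemma free_ext_relator3:
  "free_ext g (Poly_Mapping.single u 1 - a *\<^sub>R Poly_Mapping.single v 1 - b *\<^sub>R Poly_Mapping.single w 1)
     = g u - a *\<^sub>R g v - b *\<^sub>R g w"
  by (simp add: linear_diff[OF linear_free_ext] linear_scale[OF linear_free_ext] free_ext_single)

lemma free_ext_relator2:
  "free_ext g (Poly_Mapping.single u 1 - Poly_Mapping.single v 1) = g u - g v"
  by (simp add: linear_diff[OF linear_free_ext] free_ext_single)

lemma linear_iff_combination: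
  "linear f \<longleftrightarrow> (\<forall>a b x y. f (a *\<^sub>R x + b *\<^sub>R y) = a *\<^sub>R f x + b *\<^sub>R f y)"
proof
  assume *: "\<forall>a b x y. f (a *\<^sub>R x + b *\<^sub>R y) = a *\<^sub>R f x + b *\<^sub>R f y"
  show "linear f"
    unfolding linear_iff using *[rule_format, of 1 _ 1] *[rule_format, of _ _ 0] by simp
qed (simp add: linear_iff)

lemma ball_parametrised5:
  "(\<forall>r\<in>{F a b c d e | a b c d e. True}. P r) \<longleftrightarrow> (\<forall>a b c d e. P (F a b c d e))"
  by blast

lemma ball_parametrised6:
  "(\<forall>r\<in>{F a b c d e f | a b c d e f. True}. P r) \<longleftrightarrow> (\<forall>a b c d e f. P (F a b c d e f))"
  by blast

subsection \<open>Tensor products\<close>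

lemma respectful_prod: "respectful (\<lambda>(x, y). m x y) \<longleftrightarrow> bilinear m"
proof -
  have "respectful (\<lambda>(x, y). m x y) \<longleftrightarrow>
      (\<forall>a b x y z. m (a *\<^sub>R x + b *\<^sub>R y) z = a *\<^sub>R m x z + b *\<^sub>R m y z) \<and>
      (\<forall>a b x y z. m z (a *\<^sub>R x + b *\<^sub>R y) = a *\<^sub>R m z x + b *\<^sub>R m z y)"
    unfolding respectful_def relators_prod_def ball_Un ball_parametrised5 free_ext_relator3
    by (simp add: diff_diff_eq)
  then show ?thesis
    unfolding bilinear_def linear_iff_combination by blast
qed

lemma bilinear_tensor: "bilinear (\<lambda>x y. x \<otimes>\<^sub>t y)"
  using respectful_gen[where 'a = "'a \<times> 'b"] by (simp flip: respectful_prod)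

lemmas linear_tensor_left = bilinear_left[OF bilinear_tensor]
lemmas linear_tensor_right = bilinear_right[OF bilinear_tensor]

lemma linear_tensor_ext: "bilinear m \<Longrightarrow> linear (lin_ext (\<lambda>(x, y). m x y))"
  by (rule linear_ext) (simp add: respectful_prod)

lemma tensor_ext_gen: "bilinear m \<Longrightarrow> lin_ext (\<lambda>(x, y). m x y) (x \<otimes>\<^sub>t y) = m x y"
  by (subst ext_gen) (simp_all add: respectful_prod)

lemma
  assumes "linear \<phi>" "linear \<psi>"
  shows linear_tensor_map: "linear (tensor_map \<phi> \<psi>)"
    and tensor_map_tensor: "tensor_map \<phi> \<psi> (x \<otimes>\<^sub>t y) = \<phi> x \<otimes>\<^sub>t \<psi> y"
proof -
  have "bilinear (\<lambda>x y. \<phi> x \<otimes>\<^sub>t \<psi> y)"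
    by (rule bilinear_comp[OF bilinear_tensor assms])
  from linear_tensor_ext[OF this] tensor_ext_gen[OF this]
  show "linear (tensor_map \<phi> \<psi>)" "tensor_map \<phi> \<psi> (x \<otimes>\<^sub>t y) = \<phi> x \<otimes>\<^sub>t \<psi> y"
    by (simp_all add: tensor_map_def)
qed

section \<open>Words\<close>

definition multilinear :: "('a::real_vector list \<Rightarrow> 'v::real_vector) \<Rightarrow> bool"
  where "multilinear F \<longleftrightarrow> (\<forall>us vs. linear (\<lambda>x. F (us @ x # vs)))"

lemma respectful_list: "respectful F \<longleftrightarrow> multilinear F"
proof -
  have "respectful F \<longleftrightarrow> (\<forall>us vs a b x y.
      F (us @ (a *\<^sub>R x + b *\<^sub>R y) # vs) = a *\<^sub>R F (us @ x # vs) + b *\<^sub>R F (us @ y # vs))"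
    unfolding respectful_def relators_list_def ball_parametrised6 free_ext_relator3
    by (simp add: diff_diff_eq)
  then show ?thesis
    unfolding multilinear_def linear_iff_combination by blast
qed

lemma linear_word_ext: "multilinear F \<Longrightarrow> linear (lin_ext F)"
  by (rule linear_ext) (simp add: respectful_list)

lemma word_ext_gen: "multilinear F \<Longrightarrow> lin_ext F (gen w) = F w"
  by (rule ext_gen) (simp add: respectful_list)

lemma multilinearI: "(\<And>us vs. linear (\<lambda>x. F (us @ x # vs))) \<Longrightarrow> multilinear F"
  by (simp add: multilinear_def)

lemma linear_gen_slot: "linear f \<Longrightarrow> linear (\<lambda>x. gen (us @ f x # vs))"
  using respectful_gen[where 'a = "'b list"] linear_comp[of "\<lambda>x. gen (us @ x # vs)" f]
  by (simp add: respectful_list multilinear_def)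

lemma linear_slot: "multilinear F \<Longrightarrow> linear f \<Longrightarrow> linear (\<lambda>x. F (us @ f x # vs))"
  using linear_comp[of "\<lambda>x. F (us @ x # vs)" f] by (simp add: multilinear_def)

lemma multilinear_snoc_gen: "multilinear (\<lambda>w. gen (w @ [v]))"
  by (rule multilinearI) (simp add: linear_gen_slot linear_self)

lemma snoc_gen: "snoc (gen w) v = gen (w @ [v])"
  unfolding snoc_def by (rule word_ext_gen[OF multilinear_snoc_gen])

lemma bilinear_snoc: "bilinear snoc"
proof (rule bilinearI)
  show lin: "linear (\<lambda>x. snoc x v)" for v :: 'a
    unfolding snoc_def by (rule linear_word_ext[OF multilinear_snoc_gen])
  have lg: "linear (\<lambda>v. snoc (gen w) v)" for w :: "'a list"
    using linear_gen_slot[OF linear_self, of w "[]"] by (simp add: snoc_gen)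
  show "linear (\<lambda>v. snoc x v)" for x :: "'a tensor_algebra"
  proof (rule linearI)
    fix v v' :: 'a and c :: real
    show "snoc x (v + v') = snoc x v + snoc x v'"
      by (rule linear_eq_on_gen[OF lin linear_plus[OF lin lin]]) (rule linear_add[OF lg])
    show "snoc x (c *\<^sub>R v) = c *\<^sub>R snoc x v"
      by (rule linear_eq_on_gen[OF lin linear_scaled[OF lin]]) (rule linear_scale[OF lg])
  qed
qed

lemmas linear_snoc_left = bilinear_left[OF bilinear_snoc]
lemmas linear_snoc_right = bilinear_right[OF bilinear_snoc]

lemma snoc_zero [simp]: "snoc x 0 = 0" "snoc 0 v = 0"
  using linear_0[OF linear_snoc_right[OF linear_self], of x]
    linear_0[OF linear_snoc_left[OF linear_self], of v] by auto

lemma multilinear_deconcatenation: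
  "multilinear (\<lambda>w. \<Sum>i\<le>length w. gen (take i w) \<otimes>\<^sub>t gen (drop i w))"
proof (rule multilinearI)
  fix us vs :: "'a list"
  have "linear (\<lambda>x. gen (take i (us @ x # vs)) \<otimes>\<^sub>t gen (drop i (us @ x # vs)))" for i
  proof (cases "i \<le> length us")
    case True
    then show ?thesis
      by (simp add: linear_tensor_right linear_gen_slot linear_self)
  next
    case False
    then obtain j where "i = length us + Suc j"
      by (metis less_imp_Suc_add not_le add_Suc_right)
    then show ?thesis
      by (simp add: linear_tensor_left linear_gen_slot linear_self)
  qed
  then have "linear (\<lambda>x. \<Sum>i\<le>length us + Suc (length vs).
      gen (take i (us @ x # vs)) \<otimes>\<^sub>t gen (drop i (us @ x # vs)))"
    by (rule linear_sum_fun)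
  then show "linear (\<lambda>x. \<Sum>i\<le>length (us @ x # vs).
      gen (take i (us @ x # vs)) \<otimes>\<^sub>t gen (drop i (us @ x # vs)))"
    by simp
qed

lemma linear_deconcatenation: "linear deconcatenation"
  unfolding deconcatenation_def by (rule linear_word_ext[OF multilinear_deconcatenation])

lemma deconcatenation_gen:
  "deconcatenation (gen w) = (\<Sum>i\<le>length w. gen (take i w) \<otimes>\<^sub>t gen (drop i w))"
  unfolding deconcatenation_def by (rule word_ext_gen[OF multilinear_deconcatenation])

text \<open>An appended letter stays in the right factor, except for the one cut behind it.\<close>

lemma deconcatenation_snoc:
  "deconcatenation (snoc x v)
     = lin_ext (\<lambda>(y, z). y \<otimes>\<^sub>t snoc z v) (deconcatenation x) + snoc x v \<otimes>\<^sub>t gen []"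
proof (rule linear_eq_on_gen[of "\<lambda>x. deconcatenation (snoc x v)" "\<lambda>x. lin_ext (\<lambda>(y, z). y \<otimes>\<^sub>t snoc z v) (deconcatenation x)
      + snoc x v \<otimes>\<^sub>t gen []"])
  have bil: "bilinear (\<lambda>y z. y \<otimes>\<^sub>t snoc z v)"
    by (intro bilinear_comp[OF bilinear_tensor] linear_snoc_left linear_self)
  show "linear (\<lambda>x. lin_ext (\<lambda>(y, z). y \<otimes>\<^sub>t snoc z v) (deconcatenation x) + snoc x v \<otimes>\<^sub>t gen [])"
    by (intro linear_plus linear_comp[OF linear_tensor_ext[OF bil]] linear_deconcatenation
        linear_tensor_left linear_snoc_left linear_self)
  show "linear (\<lambda>x. deconcatenation (snoc x v))"
    by (intro linear_comp[OF linear_deconcatenation] linear_snoc_left linear_self)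
  fix w
  show "deconcatenation (snoc (gen w) v) = lin_ext (\<lambda>(y, z). y \<otimes>\<^sub>t snoc z v)
      (deconcatenation (gen w)) + snoc (gen w) v \<otimes>\<^sub>t gen []"
    by (simp add: deconcatenation_gen snoc_gen linear_sum[OF linear_tensor_ext[OF bil]]
        tensor_ext_gen[OF bil])
qed

lemma multilinear_empty_word_coeff: "multilinear (\<lambda>w. if w = [] then 1 else (0::real))"
  by (rule multilinearI) (simp add: linear_zero_fun)

lemma linear_empty_word_coeff: "linear empty_word_coeff"
  unfolding empty_word_coeff_def by (rule linear_word_ext[OF multilinear_empty_word_coeff])

lemma empty_word_coeff_gen: "empty_word_coeff (gen w) = (if w = [] then 1 else 0)"
  unfolding empty_word_coeff_def by (rule word_ext_gen[OF multilinear_empty_word_coeff])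

lemma empty_word_coeff_snoc: "empty_word_coeff (snoc x v) = 0"
  by (rule linear_eq_on_gen[OF linear_comp[OF linear_empty_word_coeff
          linear_snoc_left[OF linear_self]] linear_zero_fun])
     (simp add: snoc_gen empty_word_coeff_gen)

lemma multilinear_letter_part: "multilinear (\<lambda>w. case w of [v] \<Rightarrow> v | _ \<Rightarrow> 0)"
proof (rule multilinearI)
  show "linear (\<lambda>x. case us @ x # vs of [v] \<Rightarrow> v | _ \<Rightarrow> 0)" for us vs :: "'a list"
  proof (cases "us = [] \<and> vs = []")
    case True
    then show ?thesis
      by (simp add: linear_self)
  next
    case False
    then have "(case us @ x # vs of [v] \<Rightarrow> v | _ \<Rightarrow> 0) = 0" for x
      by (auto split: list.split simp: append_eq_Cons_conv)
    then show ?thesis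
      by (simp add: linear_zero_fun)
  qed
qed

lemma linear_letter_part: "linear letter_part"
  unfolding letter_part_def by (rule linear_word_ext[OF multilinear_letter_part])

lemma letter_part_gen: "letter_part (gen w) = (case w of [v] \<Rightarrow> v | _ \<Rightarrow> 0)"
  unfolding letter_part_def by (rule word_ext_gen[OF multilinear_letter_part])

lemma letter_part_snoc: "letter_part (snoc x v) = empty_word_coeff x *\<^sub>R v"
proof (rule linear_eq_on_gen[of "\<lambda>x. letter_part (snoc x v)" "\<lambda>x. empty_word_coeff x *\<^sub>R v"])
  show "letter_part (snoc (gen w) v) = empty_word_coeff (gen w) *\<^sub>R v" for w
    by (auto simp: snoc_gen letter_part_gen empty_word_coeff_gen split: list.split)
qed (intro linear_comp[OF linear_letter_part] linear_snoc_left linear_scaled_vec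
    linear_empty_word_coeff linear_self)+

section \<open>Symmetric powers\<close>

lemma respectful_nelist:
  "respectful g \<longleftrightarrow> (\<forall>us vs. linear (\<lambda>x. g (Abs_nelist (us @ x # vs)))) \<and>
     (\<forall>xs ys. mset (Rep_nelist xs) = mset (Rep_nelist ys) \<longrightarrow> g xs = g ys)"
proof -
  have "(\<forall>r\<in>{Poly_Mapping.single xs 1 - Poly_Mapping.single ys 1 | xs ys.
        mset (Rep_nelist xs) = mset (Rep_nelist ys)}. free_ext g r = 0) \<longleftrightarrow>
      (\<forall>xs ys. mset (Rep_nelist xs) = mset (Rep_nelist ys) \<longrightarrow>
        free_ext g (Poly_Mapping.single xs 1 - Poly_Mapping.single ys 1) = 0)"
    by blast
  then show ?thesis
    unfolding respectful_def relators_nelist_def ball_Un ball_parametrised6 free_ext_relator3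
      free_ext_relator2 linear_iff_combination
    by (simp add: diff_diff_eq)
qed

text \<open>The empty product is set to \<open>0\<close>, since the symmetric algebra at hand has no unit; this
  makes the symmetric product of the decorations of the empty forest vanish.\<close>

definition symmetric_product :: "'u::real_vector list \<Rightarrow> 'u symmetric"
  where "symmetric_product xs = (if xs = [] then 0 else gen (Abs_nelist xs))"

lemma symmetric_product_Nil [simp]: "symmetric_product [] = 0"
  by (simp add: symmetric_product_def)

lemma gen_nelist: "gen xs = symmetric_product (Rep_nelist xs)"
  using Rep_nelist[of xs] by (simp add: symmetric_product_def Rep_nelist_inverse)

lemma symmetric_product_permute:
  assumes "mset xs = mset ys"
  shows "symmetric_product xs = symmetric_product ys"
proof (cases "xs = []")
  case False
  then have "ys \<noteq> []"
    using assms by auto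
  then show ?thesis
    using respectful_gen[where 'a = "'a nelist", unfolded respectful_nelist, THEN conjunct2]
      False assms
    by (metis (mono_tags, lifting) Abs_nelist_inverse mem_Collect_eq symmetric_product_def)
qed (use assms in simp)

lemma multilinear_symmetric_product: "multilinear symmetric_product"
  using respectful_gen[where 'a = "'a nelist", unfolded respectful_nelist, THEN conjunct1]
  by (simp add: multilinear_def symmetric_product_def)

lemma letter_eq_symmetric_product: "letter \<gamma> = symmetric_product [\<gamma>]"
  by (simp add: letter_def symmetric_product_def nelist_single_def)

lemma symmetric_linear_eqI:
  assumes "linear F" "linear G"
    and "\<And>xs. xs \<noteq> [] \<Longrightarrow> F (symmetric_product xs) = G (symmetric_product xs)"
  shows "F s = G s"
  by (rule linear_eq_on_gen[of F G]) (use assms Rep_nelist in \<open>auto simp: gen_nelist\<close>)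

lemma gen_nelist_append:
  "gen (nelist_append xs ys) = symmetric_product (Rep_nelist xs @ Rep_nelist ys)"
  by (simp add: gen_nelist nelist_append.rep_eq)

lemma
  fixes xs ys :: "'a::real_vector nelist"
  shows respectful_nelist_append_left: "respectful (\<lambda>xs. gen (nelist_append xs ys))"
    and respectful_nelist_append_right: "respectful (\<lambda>ys. gen (nelist_append xs ys))"
proof -
  have left: "linear (\<lambda>x. symmetric_product (us @ x # vs @ ws))" for us vs ws :: "'a list"
    using linear_slot[OF multilinear_symmetric_product linear_self, of us "vs @ ws"] by simp
  have right: "linear (\<lambda>x. symmetric_product (ws @ us @ x # vs))" for us vs ws :: "'a list"
    using linear_slot[OF multilinear_symmetric_product linear_self, of "ws @ us" vs] by simp
  show "respectful (\<lambda>xs. gen (nelist_append xs ys))"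
    unfolding respectful_nelist gen_nelist_append
    by (auto simp: Abs_nelist_inverse intro!: symmetric_product_permute left)
  show "respectful (\<lambda>ys. gen (nelist_append xs ys))"
    unfolding respectful_nelist gen_nelist_append
    by (auto simp: Abs_nelist_inverse intro!: symmetric_product_permute right)
qed

lemma bilinear_odot: "bilinear (\<odot>)"
  using bilinear_ext[of "\<lambda>xs ys. gen (nelist_append xs ys)"] respectful_nelist_append_left
    respectful_nelist_append_right
  unfolding odot_def[abs_def] by blast

lemma odot_symmetric_product:
  assumes "xs \<noteq> []" "ys \<noteq> []"
  shows "symmetric_product xs \<odot> symmetric_product ys = symmetric_product (xs @ ys)"
proof -
  have "gen (Abs_nelist xs) \<odot> gen (Abs_nelist ys)
      = gen (nelist_append (Abs_nelist xs) (Abs_nelist ys))"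
    unfolding odot_def by (rule bilinear_ext_gen[OF respectful_nelist_append_left
          respectful_nelist_append_right])
  then show ?thesis
    using assms by (simp add: symmetric_product_def nelist_append_def Abs_nelist_inverse)
qed

lemmas linear_odot_left = bilinear_left[OF bilinear_odot]
lemmas linear_odot_right = bilinear_right[OF bilinear_odot]

lemma odot_zero [simp]: "0 \<odot> s = 0" "s \<odot> 0 = 0"
  using linear_0[OF linear_odot_left[OF linear_self], of s]
    linear_0[OF linear_odot_right[OF linear_self], of s] by auto

lemma odot_commute: "s \<odot> t = t \<odot> s"
proof (rule bilinear_eq_on_gen[of "(\<odot>)" "\<lambda>s t. t \<odot> s"])
  show "gen xs \<odot> gen ys = gen ys \<odot> gen xs" for xs ys :: "'a nelist"
    using Rep_nelist[of xs] Rep_nelist[of ys]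
    by (auto simp: gen_nelist odot_symmetric_product intro!: symmetric_product_permute)
qed (intro bilinear_odot bilinearI linear_odot_left linear_odot_right linear_self)+

context
  fixes \<phi> :: "'u::real_vector \<Rightarrow> 'v::real_vector"
  assumes \<phi>: "linear \<phi>"
begin

lemma respectful_nelist_map: "respectful (\<lambda>xs. gen (nelist_map \<phi> xs))"
  using linear_slot[OF multilinear_symmetric_product \<phi>]
  by (auto simp: respectful_nelist gen_nelist nelist_map.rep_eq Abs_nelist_inverse
      intro!: symmetric_product_permute)

lemma linear_symmetric_map: "linear (symmetric_map \<phi>)"
  unfolding symmetric_map_def by (rule linear_ext[OF respectful_nelist_map])

lemma symmetric_map_product: "symmetric_map \<phi> (symmetric_product xs) = symmetric_product (map \<phi> xs)"
proof (cases "xs = []")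
  case True
  then show ?thesis
    by (simp add: linear_0[OF linear_symmetric_map])
next
  case False
  have "symmetric_map \<phi> (gen (Abs_nelist xs)) = gen (nelist_map \<phi> (Abs_nelist xs))"
    unfolding symmetric_map_def by (rule ext_gen[OF respectful_nelist_map])
  with False show ?thesis
    by (simp add: symmetric_product_def nelist_map_def Abs_nelist_inverse)
qed

lemma multilinear_quasi_map: "multilinear (\<lambda>w. gen (map (symmetric_map \<phi>) w))"
  by (rule multilinearI) (simp add: linear_gen_slot linear_symmetric_map)

lemma linear_quasi_map: "linear (quasi_map \<phi>)"
  unfolding quasi_map_def by (rule linear_word_ext[OF multilinear_quasi_map])

lemma quasi_map_gen: "quasi_map \<phi> (gen w) = gen (map (symmetric_map \<phi>) w)"
  unfolding quasi_map_def by (rule word_ext_gen[OF multilinear_quasi_map])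

lemma quasi_map_snoc: "quasi_map \<phi> (snoc x s) = snoc (quasi_map \<phi> x) (symmetric_map \<phi> s)"
  by (rule linear_eq_on_gen[of "\<lambda>x. quasi_map \<phi> (snoc x s)"])
     (auto intro!: linear_comp[OF linear_quasi_map] linear_snoc_left linear_quasi_map linear_self
       simp: snoc_gen quasi_map_gen)

end

section \<open>Quasi-shuffles\<close>

lemma qsh_words_Nil_right [simp]: "qsh_words w [] = gen w"
  by (cases w rule: rev_cases) auto

lemma qsh_words_commute: "qsh_words w v = qsh_words v w"
proof (induction w v rule: qsh_words.induct)
  case (3 w a v b)
  then show ?case
    by (simp add: odot_commute[of a b])
qed auto

text \<open>The recursion removes last letters from either word. Hence the induction runs over the
  letters behind the slot together with those of the other word; commutativity then carries
  the result over to slots in the second word.\<close>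

lemma linear_qsh_words_slot: "linear (\<lambda>x. qsh_words (us @ x # vs) v)"
proof (induction "length vs + length v" arbitrary: vs v rule: less_induct)
  case less
  show ?case
  proof (cases v rule: rev_cases)
    case Nil
    then show ?thesis
      by (simp add: linear_gen_slot linear_self)
  next
    case (snoc v' d)
    show ?thesis
    proof (cases vs rule: rev_cases)
      case Nil
      have "linear (\<lambda>x. qsh_words (us @ [x]) v')"
        using less[of "[]" v'] Nil snoc by simp
      then show ?thesis
        by (simp add: snoc Nil linear_plus linear_snoc_left linear_snoc_right linear_odot_left
            linear_self)
    next
      case (snoc vs' c)
      have "linear (\<lambda>x. qsh_words (us @ x # vs') (v' @ [d]))" "linear (\<lambda>x. qsh_words (us @ x # vs') v')"
        "linear (\<lambda>x. qsh_words ((us @ x # vs') @ [c]) v')"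
        using less[of vs' v] less[of vs' v'] less[of vs v'] snoc \<open>v = v' @ [d]\<close> by auto
      then have "linear (\<lambda>x. qsh_words ((us @ x # vs') @ [c]) (v' @ [d]))"
        unfolding qsh_words.simps by (intro linear_plus linear_snoc_left)
      then show ?thesis
        by (simp add: snoc \<open>v = v' @ [d]\<close>)
    qed
  qed
qed

lemma respectful_qsh_words:
  fixes w v :: "'a::real_vector symmetric list"
  shows "respectful (\<lambda>w. qsh_words w v)" "respectful (qsh_words w)"
proof -
  show *: "respectful (\<lambda>w. qsh_words w v)" for v :: "'a symmetric list"
    by (simp add: respectful_list multilinear_def linear_qsh_words_slot)
  have "qsh_words w = (\<lambda>v. qsh_words v w)"
    by (rule ext) (rule qsh_words_commute)
  then show "respectful (qsh_words w)"
    by (rule ssubst) (rule *)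
qed

lemma bilinear_qsh_mult: "bilinear qsh_mult"
  using bilinear_ext[of qsh_words] respectful_qsh_words unfolding qsh_mult_def[abs_def] by blast

lemmas linear_qsh_mult_left = bilinear_left[OF bilinear_qsh_mult]
lemmas linear_qsh_mult_right = bilinear_right[OF bilinear_qsh_mult]

lemma qsh_mult_gen: "qsh_mult (gen w) (gen v) = qsh_words w v"
  unfolding qsh_mult_def by (rule bilinear_ext_gen[OF respectful_qsh_words])

lemma qsh_mult_unit_right [simp]: "qsh_mult x (gen []) = x"
  by (rule linear_eq_on_gen[of "\<lambda>x. qsh_mult x (gen [])" "\<lambda>x. x"])
     (auto intro: linear_qsh_mult_left linear_self simp: qsh_mult_gen)

lemma qsh_mult_unit_left [simp]: "qsh_mult (gen []) x = x"
  by (rule linear_eq_on_gen[of "\<lambda>x. qsh_mult (gen []) x" "\<lambda>x. x"])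
     (auto intro: linear_qsh_mult_right linear_self simp: qsh_mult_gen)

lemma qsh_mult_snoc:
  "qsh_mult (snoc x a) (snoc y b)
     = snoc (qsh_mult x (snoc y b)) a + snoc (qsh_mult (snoc x a) y) b + snoc (qsh_mult x y) (a \<odot> b)"
proof (rule bilinear_eq_on_gen[of "\<lambda>x y. qsh_mult (snoc x a) (snoc y b)"
      "\<lambda>x y. snoc (qsh_mult x (snoc y b)) a + snoc (qsh_mult (snoc x a) y) b
        + snoc (qsh_mult x y) (a \<odot> b)"])
  show "bilinear (\<lambda>x y. qsh_mult (snoc x a) (snoc y b))"
    by (intro bilinearI linear_qsh_mult_left linear_qsh_mult_right linear_snoc_left linear_self)
  show "bilinear (\<lambda>x y. snoc (qsh_mult x (snoc y b)) a + snoc (qsh_mult (snoc x a) y) b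
      + snoc (qsh_mult x y) (a \<odot> b))"
    by (intro bilinearI linear_plus linear_snoc_left linear_qsh_mult_left linear_qsh_mult_right
        linear_self)
qed (simp add: snoc_gen qsh_mult_gen)

section \<open>Forests and their isomorphisms\<close>

lemma redecorate_simps [simp]:
  "verts (redecorate \<phi> f) = verts f" "edges (redecorate \<phi> f) = edges f"
  "dec (redecorate \<phi> f) = \<phi> \<circ> dec f"
  by (transfer; auto)+

lemma dec_update_simps [simp]:
  "verts (dec_update f v x) = verts f" "edges (dec_update f v x) = edges f"
  "dec (dec_update f v x) = (dec f)(v := x)"
  by (transfer; auto)+

lemma empty_forest_simps [simp]: "verts empty_forest = {}" "edges empty_forest = {}"
  by (transfer; auto)+

lemma isolated_simps [simp]:
  "verts (isolated xs) = {..<length xs}" "edges (isolated xs) = {}" "dec (isolated xs) = nth xs"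
  by (transfer; auto)+

lemma induced_simps [simp]:
  "verts (induced f A) = verts f \<inter> A" "edges (induced f A) = edges f \<inter> A \<times> A"
  "dec (induced f A) = dec f"
  by (transfer; auto)+

lemma disjoint_union_simps:
  "verts (disjoint_union f g) = union_verts (verts f) (verts g)"
  "edges (disjoint_union f g) = union_edges (edges f) (edges g)"
  "dec (disjoint_union f g) = union_dec (dec f) (dec g)"
  by (transfer; auto)+

lemma graft_simps:
  "verts (graft f v g) = union_verts (verts f) (verts g)"
  "edges (graft f v g) = union_edges (edges f) (edges g) \<union>
     (\<lambda>r. (2 * r, 2 * v + 1)) ` {r \<in> verts f - Domain (edges f). v \<in> verts g}"
  "dec (graft f v g) = union_dec (dec f) (dec g)"
  by (transfer; auto)+

lemma add_root_simps:
  "verts (add_root \<gamma> f) = insert 0 (Suc ` verts f)"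
  "edges (add_root \<gamma> f) = map_prod Suc Suc ` edges f \<union>
     {(Suc r, 0) | r. r \<in> verts f - Domain (edges f)}"
  "dec (add_root \<gamma> f) = (\<lambda>n. case n of 0 \<Rightarrow> \<gamma> | Suc m \<Rightarrow> dec f m)"
  by (transfer; auto)+

lemma forest_eqI: "verts f = verts g \<Longrightarrow> edges f = edges g \<Longrightarrow> dec f = dec g \<Longrightarrow> f = g"
  by transfer auto

lemma is_forest_forest: "is_forest (verts f) (edges f)"
  by transfer auto

lemma finite_verts [simp]: "finite (verts f)"
  using is_forest_forest[of f] by (simp add: is_forest_def)

lemma edges_in_verts: "(v, w) \<in> edges f \<Longrightarrow> v \<in> verts f \<and> w \<in> verts f"
  using is_forest_forest[of f] by (auto simp: is_forest_def)

lemma single_valued_edges: "single_valued (edges f)"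
  using is_forest_forest[of f] by (simp add: is_forest_def)

lemma wf_ancestors: "wf ((edges f)\<inverse>)"
  using is_forest_forest[of f] finite_subset[of "edges f" "verts f \<times> verts f"]
  by (intro finite_acyclic_wf_converse) (auto simp: is_forest_def)

lemma root_exists:
  assumes "verts f \<noteq> {}"
  obtains r where "r \<in> verts f" "r \<notin> Domain (edges f)"
proof -
  obtain r where r: "r \<in> verts f" "\<And>y. (y, r) \<in> (edges f)\<inverse> \<Longrightarrow> y \<notin> verts f"
    using wfE_min[OF wf_ancestors[of f]] assms by (metis all_not_in_conv)
  then have "r \<notin> Domain (edges f)"
    using edges_in_verts by fastforce
  with r(1) show ?thesis
    by (rule that)
qed

text \<open>Upper sets and vertices for grafting are transported along isomorphisms, for which the
  bijection hidden in \<open>forest_iso\<close> needs a name.\<close>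

definition iso_map :: "(nat \<Rightarrow> nat) \<Rightarrow> 'u forest \<Rightarrow> 'u forest \<Rightarrow> bool"
  where "iso_map h f g \<longleftrightarrow> bij_betw h (verts f) (verts g) \<and>
    (\<forall>v\<in>verts f. \<forall>w\<in>verts f. (v, w) \<in> edges f \<longleftrightarrow> (h v, h w) \<in> edges g) \<and>
    (\<forall>v\<in>verts f. dec g (h v) = dec f v)"

lemma forest_iso_iff: "forest_iso f g \<longleftrightarrow> (\<exists>h. iso_map h f g)"
  by (simp add: forest_iso_def iso_map_def)

lemma iso_map_edge:
  assumes h: "iso_map h f g" and e: "(a, b) \<in> edges g"
  obtains v w where "a = h v" "b = h w" "v \<in> verts f" "w \<in> verts f" "(v, w) \<in> edges f"
proof -
  have "a \<in> h ` verts f" "b \<in> h ` verts f"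
    using h edges_in_verts[OF e] by (auto simp: iso_map_def bij_betw_def)
  then show ?thesis
    using h e that by (auto simp: iso_map_def)
qed

lemma iso_map_Domain:
  assumes h: "iso_map h f g" and v: "v \<in> verts f"
  shows "h v \<in> Domain (edges g) \<longleftrightarrow> v \<in> Domain (edges f)"
proof
  assume "h v \<in> Domain (edges g)"
  then obtain b where "(h v, b) \<in> edges g"
    by auto
  then obtain v' w where "h v = h v'" "v' \<in> verts f" "(v', w) \<in> edges f"
    by (metis iso_map_edge[OF h])
  then show "v \<in> Domain (edges f)"
    using h v by (auto simp: iso_map_def bij_betw_def inj_on_def)
next
  assume "v \<in> Domain (edges f)"
  then show "h v \<in> Domain (edges g)"
    using h v edges_in_verts by (fastforce simp: iso_map_def)
qed

lemma card_iso: "forest_iso f g \<Longrightarrow> card (verts f) = card (verts g)"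
  by (auto simp: forest_iso_iff iso_map_def bij_betw_same_card)

lemma respectful_forest:
  "respectful F \<longleftrightarrow> (\<forall>f v. v \<in> verts f \<longrightarrow> linear (\<lambda>x. F (dec_update f v x))) \<and>
     (\<forall>f g. forest_iso f g \<longrightarrow> F f = F g)"
proof -
  have 1: "(\<forall>r\<in>{Poly_Mapping.single (dec_update f v (a *\<^sub>R x + b *\<^sub>R y)) 1
        - a *\<^sub>R Poly_Mapping.single (dec_update f v x) 1
        - b *\<^sub>R Poly_Mapping.single (dec_update f v y) 1 | f v a b x y. v \<in> verts f}.
          free_ext F r = 0) \<longleftrightarrow>
     (\<forall>f v a b x y. v \<in> verts f \<longrightarrow> free_ext F (Poly_Mapping.single (dec_update f v (a *\<^sub>R x + b *\<^sub>R y)) 1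
        - a *\<^sub>R Poly_Mapping.single (dec_update f v x) 1
        - b *\<^sub>R Poly_Mapping.single (dec_update f v y) 1) = 0)"
    by blast
  have 2: "(\<forall>r\<in>{Poly_Mapping.single f 1 - Poly_Mapping.single g 1 | f g. forest_iso f g}.
        free_ext F r = 0) \<longleftrightarrow>
      (\<forall>f g. forest_iso f g \<longrightarrow> free_ext F (Poly_Mapping.single f 1 - Poly_Mapping.single g 1) = 0)"
    by blast
  show ?thesis
    unfolding respectful_def relators_forest_def ball_Un 1 2 free_ext_relator3
      free_ext_relator2 linear_iff_combination
    by (simp add: diff_diff_eq)
qed

lemma gen_iso: "forest_iso f g \<Longrightarrow> gen f = gen g"
  using respectful_gen[where 'a = "'a forest"] by (metis respectful_forest)

lemma linear_gen_dec_update: "v \<in> verts f \<Longrightarrow> linear (\<lambda>x. gen (dec_update f v x))"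
  using respectful_gen[where 'a = "'a forest"] by (simp add: respectful_forest)

lemma gen_cong_forest:
  assumes "verts f = verts g" "edges f = edges g" "\<And>v. v \<in> verts f \<Longrightarrow> dec f v = dec g v"
  shows "gen f = gen g"
proof (rule gen_iso)
  show "forest_iso f g"
    using assms unfolding forest_iso_iff iso_map_def by (intro exI[of _ "\<lambda>x. x"]) (auto simp: bij_betw_def)
qed

lemma gen_empty: "verts f = {} \<Longrightarrow> gen f = gen empty_forest"
  using edges_in_verts[of _ _ f] by (intro gen_cong_forest) auto

lemma nat_parity_cases:
  obtains a where "n = 2 * a" | a where "n = Suc (2 * a :: nat)"
  by (metis oddE evenE Suc_eq_plus1)

lemmas parity_simps = Suc_double_not_eq_double double_not_eq_Suc_double

lemma union_verts_iff [simp]: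
  "2 * a \<in> union_verts V W \<longleftrightarrow> a \<in> V" "Suc (2 * a) \<in> union_verts V W \<longleftrightarrow> a \<in> W"
  by (auto simp: union_verts_def parity_simps)

lemma parity_set_eqI:
  assumes "\<And>a. 2 * a \<in> S \<longleftrightarrow> 2 * a \<in> T" "\<And>a. Suc (2 * a) \<in> S \<longleftrightarrow> Suc (2 * a) \<in> T"
  shows "S = T"
  by (rule set_eqI) (metis assms nat_parity_cases)

lemma parity_rel_eqI:
  assumes "\<And>a b. (2 * a, 2 * b) \<in> S \<longleftrightarrow> (2 * a, 2 * b) \<in> T"
    and "\<And>a b. (2 * a, Suc (2 * b)) \<in> S \<longleftrightarrow> (2 * a, Suc (2 * b)) \<in> T"
    and "\<And>a b. (Suc (2 * a), 2 * b) \<in> S \<longleftrightarrow> (Suc (2 * a), 2 * b) \<in> T"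
    and "\<And>a b. (Suc (2 * a), Suc (2 * b)) \<in> S \<longleftrightarrow> (Suc (2 * a), Suc (2 * b)) \<in> T"
  shows "S = T"
proof (rule set_eqI)
  fix p :: "nat \<times> nat"
  obtain m n where p: "p = (m, n)"
    by (cases p)
  show "p \<in> S \<longleftrightarrow> p \<in> T"
    unfolding p by (cases m rule: nat_parity_cases; cases n rule: nat_parity_cases) (use assms in auto)
qed

lemma ball_union_verts:
  "(\<forall>n\<in>union_verts V W. P n) \<longleftrightarrow> (\<forall>a\<in>V. P (2 * a)) \<and> (\<forall>b\<in>W. P (Suc (2 * b)))"
  by (auto simp: union_verts_def)

lemma union_edges_iff [simp]:
  "(2 * a, 2 * b) \<in> union_edges E E' \<longleftrightarrow> (a, b) \<in> E"
  "(Suc (2 * a), Suc (2 * b)) \<in> union_edges E E' \<longleftrightarrow> (a, b) \<in> E'"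
  "(2 * a, Suc (2 * b)) \<notin> union_edges E E'" "(Suc (2 * a), 2 * b) \<notin> union_edges E E'"
  by (auto simp: union_edges_def parity_simps image_iff; force)+

lemma graft_edges_iff [simp]:
  "(2 * a, 2 * b) \<in> edges (graft f v g) \<longleftrightarrow> (a, b) \<in> edges f"
  "(Suc (2 * a), Suc (2 * b)) \<in> edges (graft f v g) \<longleftrightarrow> (a, b) \<in> edges g"
  "(2 * a, Suc (2 * b)) \<in> edges (graft f v g) \<longleftrightarrow>
     a \<in> verts f \<and> a \<notin> Domain (edges f) \<and> b = v \<and> v \<in> verts g"
  "(Suc (2 * a), 2 * b) \<notin> edges (graft f v g)"
  by (auto simp: graft_simps parity_simps)

lemma union_dec_simps [simp]:
  "union_dec d d' (2 * a) = d a" "union_dec d d' (Suc (2 * a)) = d' a"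
  by (simp_all add: union_dec_def)

text \<open>Grafting onto a vertex outside the second forest adds no edges. Therefore invariance under
  isomorphisms and the description of the cuts need to be shown for \<open>graft\<close> only; with an
  outside vertex they become statements on disjoint unions.\<close>

lemma graft_outside: "v \<notin> verts g \<Longrightarrow> graft f v g = disjoint_union f g"
  by (rule forest_eqI) (auto simp: graft_simps disjoint_union_simps)

lemma iso_map_graft:
  assumes h: "iso_map h f f'" and k: "iso_map k g g'"
    and v: "v \<in> verts g \<and> v' = k v \<or> v \<notin> verts g \<and> v' \<notin> verts g'"
  shows "forest_iso (graft f v g) (graft f' v' g')"
proof -
  define H where "H n = (if even n then 2 * h (n div 2) else Suc (2 * k (n div 2)))" for n
  have H [simp]: "H (2 * a) = 2 * h a" "H (Suc (2 * a)) = Suc (2 * k a)" for a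
    by (simp_all add: H_def)
  have hk: "bij_betw h (verts f) (verts f')" "bij_betw k (verts g) (verts g')"
    using h k by (auto simp: iso_map_def)
  have "inj_on H (union_verts (verts f) (verts g))"
    using hk by (auto simp: inj_on_def ball_union_verts bij_betw_def parity_simps)
  moreover have "H ` union_verts (verts f) (verts g) = union_verts (verts f') (verts g')"
  proof -
    have "H ` union_verts (verts f) (verts g) = union_verts (h ` verts f) (k ` verts g)"
      by (simp add: union_verts_def image_Un image_image)
    with hk show ?thesis
      by (simp add: bij_betw_def)
  qed
  ultimately have "bij_betw H (verts (graft f v g)) (verts (graft f' v' g'))"
    by (simp add: bij_betw_def graft_simps)
  moreover have "k b = v' \<and> v' \<in> verts g' \<longleftrightarrow> b = v \<and> v \<in> verts g" if "b \<in> verts g" for b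
    using v that hk(2) by (auto simp: bij_betw_def inj_on_def)
  ultimately have "iso_map H (graft f v g) (graft f' v' g')"
    using h k hk iso_map_Domain[OF h] unfolding iso_map_def
    by (simp add: graft_simps(1,3) ball_union_verts) (auto simp: bij_betw_def)
  then show ?thesis
    by (auto simp: forest_iso_iff)
qed

lemma iso_map_id: "iso_map (\<lambda>x. x) f f"
  by (simp add: iso_map_def bij_betw_def)

lemma forest_iso_disjoint_union:
  assumes "forest_iso f f'" "forest_iso g g'"
  shows "forest_iso (disjoint_union f g) (disjoint_union f' g')"
proof -
  obtain h k where hk: "iso_map h f f'" "iso_map k g g'"
    using assms by (auto simp: forest_iso_iff)
  obtain v where "v \<notin> verts g \<union> verts g'"
    using ex_new_if_finite[of "verts g \<union> verts g'"] by auto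
  then show ?thesis
    using iso_map_graft[OF hk, of v v] by (simp add: graft_outside)
qed

lemma graft_dec_update_left:
  "graft (dec_update f u x) v g = dec_update (graft f v g) (2 * u) x"
  by (rule forest_eqI) (auto simp: graft_simps union_dec_def fun_eq_iff elim: evenE)

lemma graft_dec_update_right:
  "graft f v (dec_update g u x) = dec_update (graft f v g) (Suc (2 * u)) x"
  by (rule forest_eqI) (auto simp: graft_simps union_dec_def fun_eq_iff elim: oddE)

lemma disjoint_union_dec_update:
  "disjoint_union (dec_update f u x) g = dec_update (disjoint_union f g) (2 * u) x"
  "disjoint_union f (dec_update g u x) = dec_update (disjoint_union f g) (Suc (2 * u)) x"
  by (rule forest_eqI; auto simp: disjoint_union_simps union_dec_def fun_eq_iff elim: evenE oddE)+

lemma forest_iso_refl: "forest_iso f f"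
  using iso_map_id by (auto simp: forest_iso_iff)

lemma
  fixes f g :: "'u::real_vector forest"
  shows respectful_disjoint_union_left: "respectful (\<lambda>f. gen (disjoint_union f g))"
    and respectful_disjoint_union_right: "respectful (\<lambda>g. gen (disjoint_union f g))"
  unfolding respectful_forest disjoint_union_dec_update
  by (auto intro!: linear_gen_dec_update gen_iso forest_iso_disjoint_union forest_iso_refl
      simp: disjoint_union_simps)

lemma bilinear_ck_mult: "bilinear ck_mult"
  using bilinear_ext[of "\<lambda>f g. gen (disjoint_union f g)"] respectful_disjoint_union_left
    respectful_disjoint_union_right
  unfolding ck_mult_def[abs_def] by blast

lemmas linear_ck_mult_left = bilinear_left[OF bilinear_ck_mult]
lemmas linear_ck_mult_right = bilinear_right[OF bilinear_ck_mult]

lemma ck_mult_gen: "ck_mult (gen f) (gen g) = gen (disjoint_union f g)"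
  unfolding ck_mult_def
  by (rule bilinear_ext_gen[OF respectful_disjoint_union_left respectful_disjoint_union_right])

lemma gen_disjoint_union_empty_left:
  assumes "verts e = {}"
  shows "gen (disjoint_union e g) = gen g"
proof -
  have "edges e = {}"
    using edges_in_verts[of _ _ e] assms by auto
  then have "iso_map (\<lambda>n. Suc (2 * n)) g (disjoint_union e g)"
    using assms
    by (auto simp: iso_map_def disjoint_union_simps bij_betw_def inj_on_def union_verts_def)
  then show ?thesis
    using gen_iso by (metis forest_iso_iff)
qed

lemma gen_disjoint_union_empty_right:
  assumes "verts e = {}"
  shows "gen (disjoint_union f e) = gen f"
proof -
  have "edges e = {}"
    using edges_in_verts[of _ _ e] assms by auto
  then have "iso_map (\<lambda>n. 2 * n) f (disjoint_union f e)"
    using assms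
    by (auto simp: iso_map_def disjoint_union_simps bij_betw_def inj_on_def union_verts_def)
  then show ?thesis
    using gen_iso by (metis forest_iso_iff)
qed

lemma ck_mult_unit_right [simp]: "ck_mult x (gen empty_forest) = x"
  by (rule linear_eq_on_gen[of "\<lambda>x. ck_mult x (gen empty_forest)" "\<lambda>x. x"])
     (auto intro: linear_ck_mult_left linear_self simp: ck_mult_gen gen_disjoint_union_empty_right)

section \<open>The coproduct of forests\<close>

text \<open>Writing \<open>convolve m x\<close> for \<open>\<Sum> m x' x''\<close>, the sum running over the coproduct
  of \<open>x\<close>, all structure maps below come out linear by construction.\<close>

definition convolve ::
  "('u::real_vector forests \<Rightarrow> 'u forests \<Rightarrow> 'v::real_vector) \<Rightarrow> 'u forests \<Rightarrow> 'v"
  where "convolve m x = lin_ext (\<lambda>(y, z). m y z) (ck_comult x)"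

text \<open>Isomorphisms preserve and reflect the edges, so they induce a bijection between cuts; this
  is why the coproduct is well defined on isomorphism classes.\<close>

lemma upper_sets_iso:
  assumes h: "iso_map h f g"
  shows "bij_betw (image h) (upper_sets f) (upper_sets g)"
proof -
  have bij: "bij_betw h (verts f) (verts g)"
    using h by (simp add: iso_map_def)
  then have inj: "inj_on h (verts f)" and img: "h ` verts f = verts g"
    by (auto simp: bij_betw_def)
  have iff: "h ` A \<in> upper_sets g \<longleftrightarrow> A \<in> upper_sets f" if A: "A \<subseteq> verts f" for A
  proof
    have mem: "h v \<in> h ` A \<longleftrightarrow> v \<in> A" if "v \<in> verts f" for v
      using inj A that by (auto simp: inj_on_def)
    show "A \<in> upper_sets f" if "h ` A \<in> upper_sets g"
    proof -
      have "v \<in> A" if e: "(v, w) \<in> edges f" and w: "w \<in> A" for v w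
      proof -
        have vw: "v \<in> verts f" "w \<in> verts f"
          using edges_in_verts[OF e] by auto
        with e h have "(h v, h w) \<in> edges g"
          by (auto simp: iso_map_def)
        then have "h v \<in> h ` A"
          using \<open>h ` A \<in> upper_sets g\<close> w by (auto simp: upper_sets_def)
        with mem vw show ?thesis
          by simp
      qed
      with A show ?thesis
        by (auto simp: upper_sets_def)
    qed
    show "h ` A \<in> upper_sets g" if "A \<in> upper_sets f"
    proof -
      have "a \<in> h ` A" if e: "(a, b) \<in> edges g" and b: "b \<in> h ` A" for a b
        using iso_map_edge[OF h e] b mem \<open>A \<in> upper_sets f\<close>
        by (smt (verit) case_prodD mem_Collect_eq upper_sets_def)
      then show ?thesis
        using image_mono[OF A, of h] img by (auto simp: upper_sets_def)
    qed
  qed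
  have "image h ` upper_sets f = upper_sets g"
  proof safe
    show "h ` A \<in> upper_sets g" if "A \<in> upper_sets f" for A
      using iff[of A] that by (auto simp: upper_sets_def)
    show "B \<in> image h ` upper_sets f" if "B \<in> upper_sets g" for B
    proof -
      have "B \<subseteq> h ` verts f"
        using that img by (auto simp: upper_sets_def)
      then obtain A where "A \<subseteq> verts f" "B = h ` A"
        by (auto simp: subset_image_iff)
      with that iff show ?thesis
        by blast
    qed
  qed
  moreover have "inj_on (image h) (upper_sets f)"
    by (rule inj_on_subset[OF inj_on_image_Pow[OF inj]]) (auto simp: upper_sets_def)
  ultimately show ?thesis
    by (simp add: bij_betw_def)
qed

lemma gen_induced_iso:
  assumes h: "iso_map h f g" and A: "A \<subseteq> verts f"
  shows "gen (induced g (h ` A)) = gen (induced f A)"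
proof -
  have inj: "inj_on h (verts f)" and img: "h ` verts f = verts g"
    using h by (auto simp: iso_map_def bij_betw_def)
  have "verts g \<inter> h ` A = h ` A"
    using img A by auto
  moreover have "verts f \<inter> A = A"
    using A by auto
  moreover have "bij_betw h A (h ` A)"
    using inj A by (auto simp: bij_betw_def inj_on_subset)
  ultimately have "iso_map h (induced f A) (induced g (h ` A))"
    using h A by (auto simp: iso_map_def subset_eq)
  then show ?thesis
    using gen_iso by (metis forest_iso_iff)
qed

lemma finite_upper_sets [simp]: "finite (upper_sets f)"
  by (rule finite_subset[of _ "Pow (verts f)"]) (auto simp: upper_sets_def)

lemma gen_induced_dec_update:
  "gen (induced (dec_update f v x) A)
     = (if v \<in> A then gen (dec_update (induced f A) v x) else gen (induced f A))"
  by (auto intro!: gen_cong_forest)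

lemma respectful_coproduct:
  "respectful (\<lambda>f. \<Sum>A\<in>upper_sets f. gen (induced f A) \<otimes>\<^sub>t gen (induced f (verts f - A)))"
  unfolding respectful_forest
proof (intro conjI allI impI)
  fix f :: "'a forest" and v
  assume v: "v \<in> verts f"
  have "upper_sets (dec_update f v x) = upper_sets f" for x
    by (simp add: upper_sets_def)
  moreover have "linear (\<lambda>x. gen (induced (dec_update f v x) A)
      \<otimes>\<^sub>t gen (induced (dec_update f v x) (verts f - A)))" for A
  proof (cases "v \<in> A")
    case True
    with v show ?thesis
      by (simp add: gen_induced_dec_update linear_tensor_left linear_gen_dec_update)
  next
    case False
    with v show ?thesis
      by (simp add: gen_induced_dec_update linear_tensor_right linear_gen_dec_update)
  qed
  ultimately show "linear (\<lambda>x. \<Sum>A\<in>upper_sets (dec_update f v x).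
      gen (induced (dec_update f v x) A)
      \<otimes>\<^sub>t gen (induced (dec_update f v x) (verts (dec_update f v x) - A)))"
    by (simp add: linear_sum_fun)
next
  fix f g :: "'a forest"
  assume "forest_iso f g"
  then obtain h where h: "iso_map h f g"
    by (auto simp: forest_iso_iff)
  then have inj: "inj_on h (verts f)" and img: "h ` verts f = verts g"
    by (auto simp: iso_map_def bij_betw_def)
  have "gen (induced f A) \<otimes>\<^sub>t gen (induced f (verts f - A))
      = gen (induced g (h ` A)) \<otimes>\<^sub>t gen (induced g (verts g - h ` A))" if "A \<in> upper_sets f" for A
  proof -
    have A: "A \<subseteq> verts f"
      using that by (auto simp: upper_sets_def)
    then have "verts g - h ` A = h ` (verts f - A)"
      using inj_on_image_set_diff[OF inj _ A, of "verts f"] img by simp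
    then show ?thesis
      using gen_induced_iso[OF h A] gen_induced_iso[OF h, of "verts f - A"] by simp
  qed
  then have "(\<Sum>A\<in>upper_sets f. gen (induced f A) \<otimes>\<^sub>t gen (induced f (verts f - A)))
      = (\<Sum>A\<in>upper_sets f. gen (induced g (h ` A)) \<otimes>\<^sub>t gen (induced g (verts g - h ` A)))"
    by (rule sum.cong[OF refl])
  also have "\<dots> = (\<Sum>B\<in>upper_sets g. gen (induced g B) \<otimes>\<^sub>t gen (induced g (verts g - B)))"
    by (rule sum.reindex_bij_betw[OF upper_sets_iso[OF h],
          of "\<lambda>B. gen (induced g B) \<otimes>\<^sub>t gen (induced g (verts g - B))"])
  finally show "(\<Sum>A\<in>upper_sets f. gen (induced f A) \<otimes>\<^sub>t gen (induced f (verts f - A)))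
      = (\<Sum>B\<in>upper_sets g. gen (induced g B) \<otimes>\<^sub>t gen (induced g (verts g - B)))" .
qed

lemma linear_ck_comult: "linear ck_comult"
  unfolding ck_comult_def by (rule linear_ext[OF respectful_coproduct])

lemma ck_comult_gen:
  "ck_comult (gen f) = (\<Sum>A\<in>upper_sets f. gen (induced f A) \<otimes>\<^sub>t gen (induced f (verts f - A)))"
  unfolding ck_comult_def by (rule ext_gen[OF respectful_coproduct])

lemma respectful_counit: "respectful (\<lambda>f. if verts f = {} then 1 else (0::real))"
  using card_iso by (fastforce simp: respectful_forest linear_zero_fun)

lemma linear_ck_counit: "linear ck_counit"
  unfolding ck_counit_def by (rule linear_ext[OF respectful_counit])

lemma ck_counit_gen: "ck_counit (gen f) = (if verts f = {} then 1 else 0)"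
  unfolding ck_counit_def by (rule ext_gen[OF respectful_counit])

lemma linear_convolve: "bilinear m \<Longrightarrow> linear (convolve m)"
  unfolding convolve_def by (intro linear_comp[OF linear_tensor_ext] linear_ck_comult)

lemma convolve_gen:
  assumes "bilinear m"
  shows "convolve m (gen f) = (\<Sum>A\<in>upper_sets f. m (gen (induced f A)) (gen (induced f (verts f - A))))"
  by (simp add: convolve_def ck_comult_gen linear_sum[OF linear_tensor_ext[OF assms]]
      tensor_ext_gen[OF assms])

lemma convolve_image:
  assumes G: "linear G" and m: "bilinear m"
  shows "G (convolve m x) = convolve (\<lambda>y z. G (m y z)) x"
proof -
  have bil: "bilinear (\<lambda>y z. G (m y z))"
    by (intro bilinearI linear_comp[OF G]) (use m in \<open>simp_all add: bilinear_def\<close>)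
  show ?thesis
    by (rule linear_eq_on_gen[OF linear_comp[OF G linear_convolve[OF m]] linear_convolve[OF bil]])
       (simp add: convolve_gen[OF m] convolve_gen[OF bil] linear_sum[OF G])
qed

lemma convolve_add:
  assumes m: "bilinear m" and m': "bilinear m'"
  shows "convolve (\<lambda>y z. m y z + m' y z) x = convolve m x + convolve m' x"
proof -
  have bil: "bilinear (\<lambda>y z. m y z + m' y z)"
    by (intro bilinearI linear_plus) (use m m' in \<open>simp_all add: bilinear_def\<close>)
  show ?thesis
    by (rule linear_eq_on_gen[OF linear_convolve[OF bil]
          linear_plus[OF linear_convolve[OF m] linear_convolve[OF m']]])
       (simp add: convolve_gen[OF m] convolve_gen[OF m'] convolve_gen[OF bil] sum.distrib)
qed

lemma linear_convolve_param:
  assumes lin: "\<And>y z. linear (\<lambda>t. M t y z)" and bil: "\<And>t. bilinear (M t)"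
  shows "linear (\<lambda>t. convolve (M t) x)"
proof -
  obtain A c where "finite A" "x = (\<Sum>f\<in>A. c f *\<^sub>R gen f)"
    by (rule presented_eq_sum_gen)
  then have "convolve (M t) x = (\<Sum>f\<in>A. c f *\<^sub>R (\<Sum>B\<in>upper_sets f.
      M t (gen (induced f B)) (gen (induced f (verts f - B)))))" for t
    by (simp add: linear_sum[OF linear_convolve[OF bil]] linear_scale[OF linear_convolve[OF bil]]
        convolve_gen[OF bil])
  then show ?thesis
    by (simp add: linear_arith lin)
qed

lemma ck_comult_eq_convolve: "ck_comult x = convolve (\<lambda>y z. y \<otimes>\<^sub>t z) x"
  by (rule linear_eq_on_gen[OF linear_ck_comult linear_convolve[OF bilinear_tensor]])
     (simp add: ck_comult_gen convolve_gen bilinear_tensor)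

lemma upper_sets_bounds [simp]: "{} \<in> upper_sets f" "verts f \<in> upper_sets f"
  using edges_in_verts by (fastforce simp: upper_sets_def)+

lemma induced_verts [simp]: "induced f (verts f) = f"
  using edges_in_verts by (intro forest_eqI) auto

lemma gen_induced_empty [simp]: "gen (induced f {}) = gen empty_forest"
  by (rule gen_empty) simp

lemma upper_set_subset: "A \<in> upper_sets f \<Longrightarrow> A \<subseteq> verts f"
  by (simp add: upper_sets_def)

lemma verts_induced_upper [simp]: "A \<in> upper_sets f \<Longrightarrow> verts (induced f A) = A"
  by (auto dest: upper_set_subset)

lemma bilinear_scaleR_counit: "linear g \<Longrightarrow> bilinear (\<lambda>y z. ck_counit y *\<^sub>R g z)"
  by (intro bilinearI linear_scaled linear_scaled_vec linear_ck_counit)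

lemma bilinear_scaleR_counit_right: "linear g \<Longrightarrow> bilinear (\<lambda>y z. ck_counit z *\<^sub>R g y)"
  by (intro bilinearI linear_scaled linear_scaled_vec linear_ck_counit)

lemma convolve_counit_left:
  assumes g: "linear g"
  shows "convolve (\<lambda>y z. ck_counit y *\<^sub>R g z) x = g x"
proof (rule linear_eq_on_gen[OF linear_convolve[OF bilinear_scaleR_counit[OF g]] g])
  fix f :: "'a forest"
  have "(\<Sum>A\<in>upper_sets f. ck_counit (gen (induced f A)) *\<^sub>R g (gen (induced f (verts f - A))))
      = (\<Sum>A\<in>upper_sets f. if A = {} then g (gen f) else 0)"
    by (rule sum.cong) (auto simp: ck_counit_gen dest: upper_set_subset)
  then show "convolve (\<lambda>y z. ck_counit y *\<^sub>R g z) (gen f) = g (gen f)"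
    by (simp add: convolve_gen bilinear_scaleR_counit g)
qed

lemma convolve_counit_right:
  assumes g: "linear g"
  shows "convolve (\<lambda>y z. ck_counit z *\<^sub>R g y) x = g x"
proof (rule linear_eq_on_gen[OF linear_convolve[OF bilinear_scaleR_counit_right[OF g]] g])
  fix f :: "'a forest"
  have "(\<Sum>A\<in>upper_sets f. ck_counit (gen (induced f (verts f - A))) *\<^sub>R g (gen (induced f A)))
      = (\<Sum>A\<in>upper_sets f. if A = verts f then g (gen f) else 0)"
    by (rule sum.cong) (auto simp: ck_counit_gen dest: upper_set_subset)
  then show "convolve (\<lambda>y z. ck_counit z *\<^sub>R g y) (gen f) = g (gen f)"
    by (simp add: convolve_gen bilinear_scaleR_counit_right g)
qed

lemma sum_counit_lower:
  assumes "linear G"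
  shows "(\<Sum>A\<in>upper_sets g. ck_counit (gen (induced g (verts g - A))) *\<^sub>R G (gen (induced g A))) = G (gen g)"
  using convolve_counit_right[OF assms, of "gen g"]
  by (simp add: convolve_gen[OF bilinear_scaleR_counit_right[OF assms]])

lemma upper_sets_induced_upper:
  "A \<in> upper_sets f \<Longrightarrow> upper_sets (induced f A) = {B \<in> upper_sets f. B \<subseteq> A}"
  unfolding upper_sets_def by fastforce

lemma upper_sets_induced_lower:
  "B \<in> upper_sets f \<Longrightarrow>
     upper_sets (induced f (verts f - B)) = {C. C \<subseteq> verts f - B \<and> B \<union> C \<in> upper_sets f}"
proof (rule set_eqI)
  fix C assume B: "B \<in> upper_sets f"
  then have up: "v \<in> B" if "(v, w) \<in> edges f" "w \<in> B" for v w
    using that by (auto simp: upper_sets_def)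
  have "C \<in> upper_sets (induced f (verts f - B)) \<longleftrightarrow> C \<subseteq> verts f - B \<and>
      (\<forall>v w. (v, w) \<in> edges f \<longrightarrow> v \<in> verts f - B \<longrightarrow> w \<in> verts f - B \<longrightarrow> w \<in> C \<longrightarrow> v \<in> C)"
    by (auto simp: upper_sets_def)
  moreover have "B \<union> C \<in> upper_sets f \<longleftrightarrow>
      C \<subseteq> verts f \<and> (\<forall>v w. (v, w) \<in> edges f \<longrightarrow> w \<in> B \<union> C \<longrightarrow> v \<in> B \<union> C)"
    using upper_set_subset[OF B] by (auto simp: upper_sets_def)
  ultimately show "C \<in> upper_sets (induced f (verts f - B)) \<longleftrightarrow>
      C \<in> {C. C \<subseteq> verts f - B \<and> B \<union> C \<in> upper_sets f}"
    using up edges_in_verts[of _ _ f] by blast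
qed

lemma sum_upper_set_chains:
  "(\<Sum>A\<in>upper_sets f. \<Sum>B\<in>upper_sets (induced f A). F B (A - B) (verts f - A))
     = (\<Sum>B\<in>upper_sets f. \<Sum>C\<in>upper_sets (induced f (verts f - B)). F B C (verts f - B - C))"
proof -
  have "(\<Sum>(A, B)\<in>Sigma (upper_sets f) (\<lambda>A. upper_sets (induced f A)). F B (A - B) (verts f - A))
      = (\<Sum>(B, C)\<in>Sigma (upper_sets f) (\<lambda>B. upper_sets (induced f (verts f - B))).
          F B C (verts f - B - C))"
    by (rule sum.reindex_bij_witness[where i = "\<lambda>(B, C). (B \<union> C, B)" and j = "\<lambda>(A, B). (B, A - B)"])
       (auto simp: upper_sets_induced_upper upper_sets_induced_lower Un_absorb1 Diff_Un
         dest: upper_set_subset upper_set_subset[THEN subsetD] intro!: arg_cong[of _ _ "F _ _"])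
  then show ?thesis
    by (simp add: sum.Sigma)
qed

lemma induced_induced: "induced (induced f A) B = induced f (A \<inter> B)"
  by (rule forest_eqI) auto

text \<open>Coassociativity: both sides range over the ways of cutting a forest twice, that is over
  chains of two upper sets.\<close>

lemma convolve_coassoc:
  assumes F1: "\<And>y z. linear (\<lambda>x. F x y z)" and F2: "\<And>x z. linear (\<lambda>y. F x y z)"
    and F3: "\<And>x y. linear (\<lambda>z. F x y z)"
  shows "convolve (\<lambda>w z. convolve (\<lambda>x y. F x y z) w) u
       = convolve (\<lambda>x w. convolve (\<lambda>y z. F x y z) w) u"
proof -
  have bil12: "bilinear (\<lambda>x y. F x y z)" and bil23: "bilinear (\<lambda>y z. F x y z)" for x z
    by (intro bilinearI F1 F2 F3)+
  have bilL: "bilinear (\<lambda>w z. convolve (\<lambda>x y. F x y z) w)"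
    by (intro bilinearI linear_convolve linear_convolve_param bil12 F3)
  have bilR: "bilinear (\<lambda>x w. convolve (\<lambda>y z. F x y z) w)"
    by (intro bilinearI linear_convolve linear_convolve_param bil23 F1)
  show ?thesis
  proof (rule linear_eq_on_gen[OF linear_convolve[OF bilL] linear_convolve[OF bilR]])
    fix f :: "'a forest"
    let ?F = "\<lambda>A B C. F (gen (induced f A)) (gen (induced f B)) (gen (induced f C))"
    have "convolve (\<lambda>w z. convolve (\<lambda>x y. F x y z) w) (gen f)
        = (\<Sum>A\<in>upper_sets f. \<Sum>B\<in>upper_sets (induced f A). ?F B (A - B) (verts f - A))"
      unfolding convolve_gen[OF bilL] convolve_gen[OF bil12]
    proof (intro sum.cong refl)
      fix A B
      assume "A \<in> upper_sets f" "B \<in> upper_sets (induced f A)"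
      then have "A \<inter> B = B" "A \<inter> (verts (induced f A) - B) = A - B"
        by (auto simp: upper_sets_induced_upper dest: upper_set_subset[THEN subsetD])
      then show "F (gen (induced (induced f A) B))
          (gen (induced (induced f A) (verts (induced f A) - B))) (gen (induced f (verts f - A)))
        = ?F B (A - B) (verts f - A)"
        by (simp only: induced_induced)
    qed
    also have "\<dots> = (\<Sum>B\<in>upper_sets f. \<Sum>C\<in>upper_sets (induced f (verts f - B)).
        ?F B C (verts f - B - C))"
      by (rule sum_upper_set_chains)
    also have "\<dots> = convolve (\<lambda>x w. convolve (\<lambda>y z. F x y z) w) (gen f)"
      unfolding convolve_gen[OF bilR] convolve_gen[OF bil23]
    proof (intro sum.cong refl)
      fix B C
      assume "B \<in> upper_sets f" "C \<in> upper_sets (induced f (verts f - B))"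
      then have "(verts f - B) \<inter> C = C"
        "(verts f - B) \<inter> (verts (induced f (verts f - B)) - C) = verts f - B - C"
        by (auto simp: upper_sets_induced_lower)
      then show "?F B C (verts f - B - C) = F (gen (induced f B))
          (gen (induced (induced f (verts f - B)) C))
          (gen (induced (induced f (verts f - B)) (verts (induced f (verts f - B)) - C)))"
        by (simp only: induced_induced)
    qed
    finally show "convolve (\<lambda>w z. convolve (\<lambda>x y. F x y z) w) (gen f)
        = convolve (\<lambda>x w. convolve (\<lambda>y z. F x y z) w) (gen f)" .
  qed
qed

text \<open>Passing to parents leads from any vertex to a root, and upper sets are closed under the way
  back.\<close>

lemma upper_set_with_all_roots:
  assumes A: "A \<in> upper_sets f" and roots: "\<And>r. r \<in> verts f \<Longrightarrow> r \<notin> Domain (edges f) \<Longrightarrow> r \<in> A"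
  shows "A = verts f"
proof -
  have "x \<in> verts f \<longrightarrow> x \<in> A" for x
  proof (induction x rule: wf_induct_rule[OF wf_ancestors[of f]])
    case (1 x)
    show ?case
    proof (cases "x \<in> Domain (edges f)")
      case True
      then obtain y where "(x, y) \<in> edges f"
        by auto
      with 1 A edges_in_verts show ?thesis
        by (fastforce simp: upper_sets_def)
    qed (use roots in auto)
  qed
  with upper_set_subset[OF A] show ?thesis
    by auto
qed

text \<open>All roots of \<open>f\<close> become children of \<open>v\<close>, and every vertex of \<open>f\<close> descends from one of them.
  So an upper set that contains \<open>v\<close> contains all of \<open>f\<close>, and the parts of the others in \<open>f\<close> and
  in \<open>g\<close> are independent of each other.\<close>

lemma upper_sets_graft:
  "upper_sets (graft f v g) = (\<lambda>(C, B). union_verts B C) `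
     (SIGMA C:upper_sets g. if v \<in> C then {verts f} else upper_sets f)" (is "?L = ?R")
proof (intro equalityI subsetI)
  fix S assume S: "S \<in> ?L"
  define B C where "B = {a. 2 * a \<in> S}" and "C = {a. Suc (2 * a) \<in> S}"
  have S_eq: "S = union_verts B C"
    by (rule parity_set_eqI) (simp_all add: B_def C_def)
  have sub: "B \<subseteq> verts f" "C \<subseteq> verts g"
    using upper_set_subset[OF S] by (auto simp: B_def C_def graft_simps)
  have up: "x \<in> S" if "(x, y) \<in> edges (graft f v g)" "y \<in> S" for x y
    using S that by (auto simp: upper_sets_def)
  have B: "B \<in> upper_sets f" and C: "C \<in> upper_sets g"
    using sub up[of "2 * _" "2 * _"] up[of "Suc (2 * _)" "Suc (2 * _)"]
    by (auto simp: upper_sets_def B_def C_def)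
  moreover have "B = verts f" if "v \<in> C"
  proof (rule upper_set_with_all_roots[OF B])
    fix r assume "r \<in> verts f" "r \<notin> Domain (edges f)"
    with that sub show "r \<in> B"
      by (auto simp: B_def C_def intro!: up[of "2 * r" "Suc (2 * v)"])
  qed
  ultimately show "S \<in> ?R"
    by (auto simp: S_eq)
next
  fix S assume "S \<in> ?R"
  then obtain B C where S: "S = union_verts B C" and C: "C \<in> upper_sets g"
    and "B \<in> (if v \<in> C then {verts f} else upper_sets f)"
    by auto
  then have B: "B \<in> upper_sets f" "v \<in> C \<Longrightarrow> B = verts f"
    by (auto split: if_splits)
  have "x \<in> S" if "(x, y) \<in> edges (graft f v g)" "y \<in> S" for x y
    using that B C unfolding S
    by (cases x rule: nat_parity_cases; cases y rule: nat_parity_cases)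
       (auto simp: upper_sets_def)
  moreover have "S \<subseteq> verts (graft f v g)"
    using B(1) C by (auto simp: S graft_simps upper_sets_def union_verts_def)
  ultimately show "S \<in> ?L"
    by (auto simp: upper_sets_def)
qed

lemma inj_union_verts: "inj_on (\<lambda>(C, B). union_verts B C) X"
proof (rule inj_onI, clarify)
  fix B C B' C'
  assume eq: "union_verts B C = union_verts B' C'"
  have "a \<in> B \<longleftrightarrow> a \<in> B'" "a \<in> C \<longleftrightarrow> a \<in> C'" for a
    using eq by (metis union_verts_iff)+
  then show "C = C' \<and> B = B'"
    by auto
qed

text \<open>Cutting a grafted forest produces grafted forests and disjoint unions of the pieces of the two
  forests, depending on the side on which \<open>v\<close> lies. These are equalities and not only
  isomorphisms, because induced forests keep the names of the vertices.\<close>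

lemma induced_graft_upper:
  assumes "v \<in> C" "C \<subseteq> verts g"
  shows "induced (graft f v g) (union_verts (verts f) C) = graft f v (induced g C)"
proof (rule forest_eqI)
  show "verts (induced (graft f v g) (union_verts (verts f) C)) = verts (graft f v (induced g C))"
    by (rule parity_set_eqI) (auto simp: graft_simps(1))
  show "edges (induced (graft f v g) (union_verts (verts f) C)) = edges (graft f v (induced g C))"
    using assms edges_in_verts by (intro parity_rel_eqI) auto
qed (simp add: graft_simps)

lemma induced_graft_split:
  assumes "v \<notin> C"
  shows "induced (graft f v g) (union_verts B C) = disjoint_union (induced f B) (induced g C)"
proof (rule forest_eqI)
  show "verts (induced (graft f v g) (union_verts B C))
      = verts (disjoint_union (induced f B) (induced g C))"
    by (rule parity_set_eqI) (auto simp: graft_simps(1) disjoint_union_simps)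
  show "edges (induced (graft f v g) (union_verts B C))
      = edges (disjoint_union (induced f B) (induced g C))"
    using assms by (intro parity_rel_eqI) (auto simp: disjoint_union_simps)
qed (simp add: graft_simps disjoint_union_simps)

lemma induced_graft_lower:
  assumes "B \<in> upper_sets f" "v \<notin> C"
  shows "induced (graft f v g) (union_verts (verts f - B) (verts g - C))
       = graft (induced f (verts f - B)) v (induced g (verts g - C))"
proof (rule forest_eqI)
  show "verts (induced (graft f v g) (union_verts (verts f - B) (verts g - C)))
      = verts (graft (induced f (verts f - B)) v (induced g (verts g - C)))"
    by (rule parity_set_eqI) (auto simp: graft_simps(1))
  have "a \<in> Domain (edges f \<inter> (verts f - B) \<times> (verts f - B)) \<longleftrightarrow> a \<in> Domain (edges f)"
    if "a \<in> verts f - B" for a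
    using that assms(1) edges_in_verts by (fastforce simp: upper_sets_def)
  with assms show "edges (induced (graft f v g) (union_verts (verts f - B) (verts g - C)))
      = edges (graft (induced f (verts f - B)) v (induced g (verts g - C)))"
    using edges_in_verts by (intro parity_rel_eqI) auto
qed (simp add: graft_simps)

lemma ck_comult_graft:
  "ck_comult (gen (graft f v g)) = (\<Sum>C\<in>upper_sets g.
     if v \<in> C then gen (graft f v (induced g C)) \<otimes>\<^sub>t gen (induced g (verts g - C))
     else \<Sum>B\<in>upper_sets f. gen (disjoint_union (induced f B) (induced g C))
       \<otimes>\<^sub>t gen (graft (induced f (verts f - B)) v (induced g (verts g - C))))"
  (is "_ = sum ?t _")
proof -
  define \<Phi> where "\<Phi> S = gen (induced (graft f v g) S)
      \<otimes>\<^sub>t gen (induced (graft f v g) (verts (graft f v g) - S))" for S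
  have compl: "verts (graft f v g) - union_verts B C = union_verts (verts f - B) (verts g - C)"
    for B C
    by (rule parity_set_eqI) (auto simp: graft_simps(1))
  have "ck_comult (gen (graft f v g)) = sum \<Phi> (upper_sets (graft f v g))"
    by (simp add: ck_comult_gen \<Phi>_def)
  also have "\<dots> = (\<Sum>(C, B)\<in>(SIGMA C:upper_sets g. if v \<in> C then {verts f} else upper_sets f).
      \<Phi> (union_verts B C))"
    unfolding upper_sets_graft
    by (subst sum.reindex[OF inj_union_verts]) (simp add: case_prod_unfold o_def)
  also have "\<dots> = (\<Sum>C\<in>upper_sets g. \<Sum>B\<in>(if v \<in> C then {verts f} else upper_sets f).
      \<Phi> (union_verts B C))"
    by (rule sum.Sigma[symmetric]) auto
  also have "\<dots> = sum ?t (upper_sets g)"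
  proof (rule sum.cong[OF refl])
    fix C assume C: "C \<in> upper_sets g"
    show "(\<Sum>B\<in>(if v \<in> C then {verts f} else upper_sets f). \<Phi> (union_verts B C)) = ?t C"
    proof (cases "v \<in> C")
      case True
      then have "v \<notin> verts g - C"
        by auto
      with True C show ?thesis
        by (simp add: \<Phi>_def compl induced_graft_upper upper_set_subset induced_graft_split
            gen_disjoint_union_empty_left)
    next
      case False
      then show ?thesis
        by (auto simp: \<Phi>_def compl induced_graft_lower induced_graft_split intro!: sum.cong)
    qed
  qed
  finally show ?thesis .
qed

lemma ck_comult_disjoint_union:
  "ck_comult (gen (disjoint_union f g)) = (\<Sum>C\<in>upper_sets g. \<Sum>B\<in>upper_sets f.
     gen (disjoint_union (induced f B) (induced g C)) \<otimes>\<^sub>t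
     gen (disjoint_union (induced f (verts f - B)) (induced g (verts g - C))))"
proof -
  obtain v where v: "v \<notin> verts g"
    using ex_new_if_finite[OF infinite_UNIV_nat finite_verts[of g]] by auto
  then have "v \<notin> C" if "C \<in> upper_sets g" for C
    using upper_set_subset[OF that] by auto
  with v show ?thesis
    using ck_comult_graft[of f v g] by (simp add: graft_outside)
qed

section \<open>Natural growth\<close>

text \<open>\<open>graft_sum\<close> is natural growth before averaging over the vertices of the second argument.
  Keeping the average separate makes the compatibility with the coproduct an exact
  identity.\<close>

definition graft_sum :: "'u::real_vector forests \<Rightarrow> 'u forests \<Rightarrow> 'u forests"
  where "graft_sum x y = lin_ext (\<lambda>f. lin_ext (\<lambda>g. \<Sum>v\<in>verts g. gen (graft f v g)) y) x"

lemma
  fixes f g :: "'u::real_vector forest"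
  shows respectful_graft_sum_left: "respectful (\<lambda>f. \<Sum>v\<in>verts g. gen (graft f v g))"
    and respectful_graft_sum_right: "respectful (\<lambda>g. \<Sum>v\<in>verts g. gen (graft f v g))"
proof -
  have iso: "gen (graft f v g) = gen (graft f' (k v) g')"
    if "forest_iso f f'" "iso_map k g g'" "v \<in> verts g" for f f' g g' :: "'u forest" and k v
  proof -
    obtain h where "iso_map h f f'"
      using \<open>forest_iso f f'\<close> by (auto simp: forest_iso_iff)
    from iso_map_graft[OF this that(2), of v "k v"] that(3) show ?thesis
      by (intro gen_iso) simp
  qed
  show "respectful (\<lambda>f. \<Sum>v\<in>verts g. gen (graft f v g))"
    unfolding respectful_forest graft_dec_update_left
    by (auto intro!: linear_sum_fun linear_gen_dec_update sum.cong iso[OF _ iso_map_id]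
        simp: graft_simps)
  have "(\<Sum>v\<in>verts g. gen (graft f v g)) = (\<Sum>v\<in>verts g'. gen (graft f v g'))"
    if k: "iso_map k g g'" for g g' k
  proof -
    have "(\<Sum>v\<in>verts g. gen (graft f v g)) = (\<Sum>v\<in>verts g. gen (graft f (k v) g'))"
      by (rule sum.cong[OF refl]) (rule iso[OF forest_iso_refl k])
    also have "\<dots> = (\<Sum>v\<in>verts g'. gen (graft f v g'))"
      using k by (intro sum.reindex_bij_betw) (simp add: iso_map_def)
    finally show ?thesis .
  qed
  then show "respectful (\<lambda>g. \<Sum>v\<in>verts g. gen (graft f v g))"
    unfolding respectful_forest graft_dec_update_right forest_iso_iff
    by (auto intro!: linear_sum_fun linear_gen_dec_update simp: graft_simps)
qed

lemma bilinear_graft_sum: "bilinear graft_sum"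
  using bilinear_ext[of "\<lambda>f g. \<Sum>v\<in>verts g. gen (graft f v g)"] respectful_graft_sum_left
    respectful_graft_sum_right
  unfolding graft_sum_def[abs_def] by blast

lemmas linear_graft_sum_left = bilinear_left[OF bilinear_graft_sum]
lemmas linear_graft_sum_right = bilinear_right[OF bilinear_graft_sum]

lemma graft_sum_gen: "graft_sum (gen f) (gen g) = (\<Sum>v\<in>verts g. gen (graft f v g))"
  unfolding graft_sum_def
  by (rule bilinear_ext_gen[OF respectful_graft_sum_left respectful_graft_sum_right])

lemma graft_sum_unit_right: "graft_sum x (gen empty_forest) = 0"
  by (rule linear_eq_on_gen[of "\<lambda>x. graft_sum x (gen empty_forest)" "\<lambda>x. 0"])
     (auto intro: linear_graft_sum_left linear_arith simp: graft_sum_gen)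

text \<open>If the grafting vertex lies in the upper part of a cut, then so does all of \<open>x\<close>; otherwise
  \<open>x\<close> is cut as well and its lower part remains grafted.\<close>

lemma ck_comult_graft_sum:
  "ck_comult (graft_sum x y) = convolve (\<lambda>y' y''. graft_sum x y' \<otimes>\<^sub>t y''
     + convolve (\<lambda>x' x''. ck_mult x' y' \<otimes>\<^sub>t graft_sum x'' y'') x) y"
proof -
  have bil: "bilinear (\<lambda>x' x''. ck_mult x' y' \<otimes>\<^sub>t graft_sum x'' y'')"
    for y' y'' :: "'a forests"
    by (intro bilinearI linear_tensor_left linear_tensor_right linear_ck_mult_left
        linear_graft_sum_left linear_self)
  have bil2: "bilinear (\<lambda>y' y''. graft_sum x y' \<otimes>\<^sub>t y''
      + convolve (\<lambda>x' x''. ck_mult x' y' \<otimes>\<^sub>t graft_sum x'' y'') x)" for x :: "'a forests"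
    by (intro bilinearI linear_plus linear_convolve_param bil linear_tensor_left
        linear_tensor_right linear_ck_mult_right linear_graft_sum_right linear_self)
  show ?thesis
  proof (rule bilinear_eq_on_gen[of "\<lambda>x y. ck_comult (graft_sum x y)" "\<lambda>x y.
      convolve (\<lambda>y' y''. graft_sum x y' \<otimes>\<^sub>t y''
        + convolve (\<lambda>x' x''. ck_mult x' y' \<otimes>\<^sub>t graft_sum x'' y'') x) y"])
    show "bilinear (\<lambda>x y. ck_comult (graft_sum x y :: 'a forests))"
      by (intro bilinearI linear_comp[OF linear_ck_comult] linear_graft_sum_left
          linear_graft_sum_right linear_self)
    show "bilinear (\<lambda>x y. convolve (\<lambda>y' y''. graft_sum x y' \<otimes>\<^sub>t y''
        + convolve (\<lambda>x' x''. ck_mult x' y' \<otimes>\<^sub>t graft_sum x'' y'') x) (y :: 'a forests))"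
      by (intro bilinearI linear_convolve linear_convolve_param[OF _ bil2] bil2 linear_plus bil
          linear_tensor_left linear_graft_sum_left linear_self)
    fix f g :: "'a forest"
    let ?u = "\<lambda>C v. gen (graft f v (induced g C)) \<otimes>\<^sub>t gen (induced g (verts g - C))"
    let ?d = "\<lambda>C B v. gen (disjoint_union (induced f B) (induced g C))
       \<otimes>\<^sub>t gen (graft (induced f (verts f - B)) v (induced g (verts g - C)))"
    have "ck_comult (graft_sum (gen f) (gen g)) = (\<Sum>v\<in>verts g. \<Sum>C\<in>upper_sets g.
        if v \<in> C then ?u C v else \<Sum>B\<in>upper_sets f. ?d C B v)"
      by (simp add: graft_sum_gen linear_sum[OF linear_ck_comult] ck_comult_graft)
    also have "\<dots> = (\<Sum>C\<in>upper_sets g. \<Sum>v\<in>verts g.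
        if v \<in> C then ?u C v else \<Sum>B\<in>upper_sets f. ?d C B v)"
      by (rule sum.swap)
    also have "\<dots> = (\<Sum>C\<in>upper_sets g. (\<Sum>v\<in>C. ?u C v)
        + (\<Sum>v\<in>verts g - C. \<Sum>B\<in>upper_sets f. ?d C B v))"
    proof (rule sum.cong[OF refl])
      fix C assume "C \<in> upper_sets g"
      then have C: "C \<subseteq> verts g"
        by (rule upper_set_subset)
      then have "{v \<in> verts g. v \<in> C} = C" "{v \<in> verts g. v \<notin> C} = verts g - C"
        by auto
      then show "(\<Sum>v\<in>verts g. if v \<in> C then ?u C v else \<Sum>B\<in>upper_sets f. ?d C B v)
          = (\<Sum>v\<in>C. ?u C v) + (\<Sum>v\<in>verts g - C. \<Sum>B\<in>upper_sets f. ?d C B v)"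
        by (simp add: sum.If_cases Int_def Collect_neg_eq Diff_eq)
    qed
    also have "\<dots> = (\<Sum>C\<in>upper_sets g.
        graft_sum (gen f) (gen (induced g C)) \<otimes>\<^sub>t gen (induced g (verts g - C))
        + (\<Sum>B\<in>upper_sets f. ck_mult (gen (induced f B)) (gen (induced g C))
            \<otimes>\<^sub>t graft_sum (gen (induced f (verts f - B))) (gen (induced g (verts g - C)))))"
    proof (rule sum.cong[OF refl], rule arg_cong2[of _ _ _ _ "(+)"])
      fix C assume "C \<in> upper_sets g"
      then have C: "verts g \<inter> C = C"
        using upper_set_subset by blast
      show "(\<Sum>v\<in>C. ?u C v)
          = graft_sum (gen f) (gen (induced g C)) \<otimes>\<^sub>t gen (induced g (verts g - C))"
        by (simp add: graft_sum_gen linear_sum[OF linear_tensor_left[OF linear_self]] C)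
      show "(\<Sum>v\<in>verts g - C. \<Sum>B\<in>upper_sets f. ?d C B v)
          = (\<Sum>B\<in>upper_sets f. ck_mult (gen (induced f B)) (gen (induced g C))
            \<otimes>\<^sub>t graft_sum (gen (induced f (verts f - B))) (gen (induced g (verts g - C))))"
        by (subst sum.swap) (simp add: graft_sum_gen ck_mult_gen
            linear_sum[OF linear_tensor_right[OF linear_self]] Int_absorb1)
    qed
    also have "\<dots> = convolve (\<lambda>y' y''. graft_sum (gen f) y' \<otimes>\<^sub>t y''
        + convolve (\<lambda>x' x''. ck_mult x' y' \<otimes>\<^sub>t graft_sum x'' y'') (gen f)) (gen g)"
      unfolding convolve_gen[OF bil2] by (simp add: convolve_gen[OF bil])
    finally show "ck_comult (graft_sum (gen f) (gen g)) = convolve (\<lambda>y' y''. graft_sum (gen f) y' \<otimes>\<^sub>t y''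
        + convolve (\<lambda>x' x''. ck_mult x' y' \<otimes>\<^sub>t graft_sum x'' y'') (gen f)) (gen g)" .
  qed
qed

lemma lin_ext_linear:
  assumes L: "linear L"
  shows "lin_ext (\<lambda>x. L (gen x)) y = L y"
proof -
  have "free_ext (\<lambda>x. L (gen x)) r = L (free_ext gen r)" for r
    by (simp add: free_ext_def linear_sum[OF L] linear_scale[OF L])
  then have resp: "respectful (\<lambda>x. L (gen x))"
    using respectful_gen linear_0[OF L] by (auto simp: respectful_def)
  show ?thesis
    by (rule linear_eq_on_gen[OF linear_ext[OF resp] L]) (rule ext_gen[OF resp])
qed

text \<open>On the empty forest the value is \<open>0\<close>, as \<open>1 / 0 = 0\<close>.\<close>

definition inverse_degree :: "'u::real_vector forests \<Rightarrow> 'u forests"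
  where "inverse_degree = lin_ext (\<lambda>f. (1 / real (card (verts f))) *\<^sub>R gen f)"

lemma respectful_inverse_degree: "respectful (\<lambda>f. (1 / real (card (verts f))) *\<^sub>R gen f)"
  unfolding respectful_forest
  by (auto intro!: linear_scaled linear_gen_dec_update simp: card_iso gen_iso)

lemma linear_inverse_degree: "linear inverse_degree"
  unfolding inverse_degree_def by (rule linear_ext[OF respectful_inverse_degree])

lemma inverse_degree_gen: "inverse_degree (gen f) = (1 / real (card (verts f))) *\<^sub>R gen f"
  unfolding inverse_degree_def by (rule ext_gen[OF respectful_inverse_degree])

lemma gen_graft_empty:
  assumes "verts f = {}"
  shows "gen (graft f v g) = gen g"
proof -
  have "graft f v g = disjoint_union f g"
    using assms by (intro forest_eqI) (auto simp: graft_simps disjoint_union_simps)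
  with assms show ?thesis
    by (simp add: gen_disjoint_union_empty_left)
qed

text \<open>The first clause in the definition of natural growth is subsumed by averaging, because
  grafting the empty forest changes nothing. For empty \<open>y\<close> the graft sum vanishes, and the
  counit supplies the value \<open>x\<close>.\<close>

lemma natural_growth_eq: "x \<top>\<^sub>n y = graft_sum x (inverse_degree y) + ck_counit y *\<^sub>R x"
proof -
  let ?B = "\<lambda>x y :: 'a forests. graft_sum x (inverse_degree y) + ck_counit y *\<^sub>R x"
  have growth: "(if verts f = {} then gen g
      else if verts g = {} then gen f
      else (1 / real (card (verts g))) *\<^sub>R (\<Sum>v\<in>verts g. gen (graft f v g)))
    = ?B (gen f) (gen g)" for f g :: "'a forest"
  proof -
    have "?B (gen f) (gen g) = (1 / real (card (verts g))) *\<^sub>R (\<Sum>v\<in>verts g. gen (graft f v g))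
        + ck_counit (gen g) *\<^sub>R gen f"
      by (simp add: inverse_degree_gen linear_scale[OF linear_graft_sum_right[OF linear_self]]
          graft_sum_gen)
    then show ?thesis
      by (auto simp: ck_counit_gen gen_graft_empty sum_constant_scaleR gen_empty[of f] gen_empty[of g])
  qed
  have lin1: "linear (\<lambda>x. ?B x y)" and lin2: "linear (\<lambda>y. ?B x y)" for x y
    by (intro linear_plus linear_graft_sum_left linear_graft_sum_right linear_inverse_degree
        linear_scaled linear_scaled_vec linear_ck_counit linear_self)+
  show ?thesis
    unfolding natural_growth_def growth
    using lin_ext_linear[OF lin1] lin_ext_linear[OF lin2] by simp
qed

lemma bilinear_natural_growth: "bilinear (\<top>\<^sub>n)"
  unfolding natural_growth_eq[abs_def]
  by (intro bilinearI linear_plus linear_graft_sum_left linear_graft_sum_right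
      linear_inverse_degree linear_scaled linear_scaled_vec linear_ck_counit linear_self)

lemmas linear_growth_left = bilinear_left[OF bilinear_natural_growth]
lemmas linear_growth_right = bilinear_right[OF bilinear_natural_growth]

lemma growth_zero [simp]: "0 \<top>\<^sub>n x = 0" "x \<top>\<^sub>n 0 = 0"
  using linear_0[OF linear_growth_left[OF linear_self], of x]
    linear_0[OF linear_growth_right[OF linear_self], of x] by auto

lemma growth_unit_right [simp]: "x \<top>\<^sub>n gen empty_forest = x"
  by (simp add: natural_growth_eq inverse_degree_gen ck_counit_gen
      linear_0[OF linear_graft_sum_right[OF linear_self]])

lemma growth_unit_left [simp]: "gen empty_forest \<top>\<^sub>n y = y"
proof (rule linear_eq_on_gen[of "\<lambda>y. gen empty_forest \<top>\<^sub>n y" "\<lambda>y. y"])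
  show "gen empty_forest \<top>\<^sub>n gen g = gen g" for g :: "'a forest"
    by (auto simp: natural_growth_eq inverse_degree_gen ck_counit_gen graft_sum_gen gen_graft_empty
        linear_scale[OF linear_graft_sum_right[OF linear_self]] sum_constant_scaleR gen_empty[of g])
qed (auto intro: linear_growth_right linear_self)

subsection \<open>Primitive elements\<close>

lemma primitives_iff:
  "p \<in> primitives \<longleftrightarrow> ck_comult p = p \<otimes>\<^sub>t gen empty_forest + gen empty_forest \<otimes>\<^sub>t p"
  by (simp add: primitives_def CK_def)

lemma convolve_primitive:
  assumes "p \<in> primitives" "bilinear m"
  shows "convolve m p = m p (gen empty_forest) + m (gen empty_forest) p"
  using assms by (simp add: convolve_def primitives_iff linear_add[OF linear_tensor_ext]
      tensor_ext_gen)

lemma counit_unit [simp]: "ck_counit (gen empty_forest) = 1"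
  by (simp add: ck_counit_gen)

lemma counit_primitive: "p \<in> primitives \<Longrightarrow> ck_counit p = 0"
  using convolve_counit_left[OF linear_ck_counit, of p]
    convolve_primitive[OF _ bilinear_scaleR_counit[OF linear_ck_counit], of p]
  by simp

text \<open>The total degree is additive under the coproduct, so division by it on the one hand and
  by the sum of the two degrees on the tensor square on the other hand commute with the
  coproduct. On \<open>p \<otimes> \<one> + \<one> \<otimes> p\<close> the sum of the two degrees is the degree of \<open>p\<close>.\<close>

lemma inverse_degree_primitive:
  assumes p: "p \<in> primitives"
  shows "inverse_degree p \<in> primitives"
proof -
  define k where "k x y = lin_ext (\<lambda>f. lin_ext (\<lambda>g.
    (1 / real (card (verts f) + card (verts g))) *\<^sub>R gen f \<otimes>\<^sub>t gen g) y) x" for x y :: "'a forests"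
  have r1: "respectful (\<lambda>f. (1 / real (card (verts f) + card (verts g))) *\<^sub>R gen f \<otimes>\<^sub>t gen g)"
    and r2: "respectful (\<lambda>g. (1 / real (card (verts f) + card (verts g))) *\<^sub>R gen f \<otimes>\<^sub>t gen g)"
    for f g :: "'a forest"
    unfolding respectful_forest
    by (auto intro!: linear_scaled linear_tensor_left linear_tensor_right linear_gen_dec_update
        simp: card_iso gen_iso)
  have k: "bilinear k"
    unfolding k_def[abs_def] by (rule bilinear_ext[OF r1 r2])
  have k_gen: "k (gen f) (gen g)
      = (1 / real (card (verts f) + card (verts g))) *\<^sub>R gen f \<otimes>\<^sub>t gen g" for f g
    unfolding k_def by (rule bilinear_ext_gen[OF r1 r2])
  have "ck_comult (inverse_degree x) = convolve k x" for x
  proof (rule linear_eq_on_gen[of "\<lambda>x. ck_comult (inverse_degree x)" "convolve k"])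
    fix f :: "'a forest"
    have "card (verts f \<inter> A) + card (verts f \<inter> (verts f - A)) = card (verts f)" for A
      by (metis Diff_Int_distrib2 Int_Diff Int_absorb card_Int_Diff finite_verts)
    then show "ck_comult (inverse_degree (gen f)) = convolve k (gen f)"
      by (simp add: inverse_degree_gen convolve_gen[OF k] k_gen linear_scale[OF linear_ck_comult]
          ck_comult_gen scaleR_sum_right)
  qed (intro linear_comp[OF linear_ck_comult] linear_inverse_degree linear_convolve k)+
  moreover have "k x (gen empty_forest) = inverse_degree x \<otimes>\<^sub>t gen empty_forest" for x
    by (rule linear_eq_on_gen[of "\<lambda>x. k x (gen empty_forest)"])
       (auto intro: bilinear_left[OF k] linear_tensor_left linear_inverse_degree linear_self
         simp: k_gen inverse_degree_gen linear_scale[OF linear_tensor_left[OF linear_self]])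
  moreover have "k (gen empty_forest) x = gen empty_forest \<otimes>\<^sub>t inverse_degree x" for x
    by (rule linear_eq_on_gen[of "\<lambda>x. k (gen empty_forest) x"])
       (auto intro: bilinear_right[OF k] linear_tensor_right linear_inverse_degree linear_self
         simp: k_gen inverse_degree_gen linear_scale[OF linear_tensor_right[OF linear_self]])
  ultimately show ?thesis
    by (simp add: primitives_iff convolve_primitive[OF p k])
qed

lemma convolve_zero [simp]: "convolve (\<lambda>y z. 0) x = 0"
proof -
  have bil: "bilinear (\<lambda>y z. 0)"
    by (intro bilinearI linear_zero_fun)
  show ?thesis
    by (rule linear_eq_on_gen[OF linear_convolve[OF bil] linear_zero_fun])
       (simp add: convolve_gen[OF bil])
qed

text \<open>This cocycle property is what makes natural growth by primitive elements correspond to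
  appending a letter to a word.\<close>

lemma ck_comult_growth_primitive:
  assumes p: "p \<in> primitives"
  shows "ck_comult (x \<top>\<^sub>n p)
       = convolve (\<lambda>x' x''. x' \<otimes>\<^sub>t (x'' \<top>\<^sub>n p)) x + (x \<top>\<^sub>n p) \<otimes>\<^sub>t gen empty_forest"
proof -
  define q where "q = inverse_degree p"
  have q: "q \<in> primitives"
    unfolding q_def by (rule inverse_degree_primitive[OF p])
  have growth: "y \<top>\<^sub>n p = graft_sum y q" for y
    by (simp add: natural_growth_eq q_def counit_primitive[OF p])
  have bil: "bilinear (\<lambda>x' x''. ck_mult x' y' \<otimes>\<^sub>t graft_sum x'' y'')"
    for y' y'' :: "'a forests"
    by (intro bilinearI linear_tensor_left linear_tensor_right linear_ck_mult_left
        linear_graft_sum_left linear_self)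
  have bil2: "bilinear (\<lambda>y' y''. graft_sum x y' \<otimes>\<^sub>t y''
      + convolve (\<lambda>x' x''. ck_mult x' y' \<otimes>\<^sub>t graft_sum x'' y'') x)"
    by (intro bilinearI linear_plus linear_convolve_param bil linear_tensor_left
        linear_tensor_right linear_ck_mult_right linear_graft_sum_right linear_self)
  show ?thesis
    by (simp add: growth ck_comult_graft_sum convolve_primitive[OF q bil2] graft_sum_unit_right
        linear_0[OF linear_tensor_left[OF linear_self]]
        linear_0[OF linear_tensor_right[OF linear_self]])
qed

section \<open>Recursion on the number of vertices\<close>

text \<open>Linear maps are defined by recursion along the coproduct as limits of iterations: if the
  value of \<open>T L\<close> at a forest depends only on the values of \<open>L\<close> at smaller forests,
  iterating \<open>T\<close> becomes stationary at every forest. As all iterates are linear,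
  the limit inherits its compatibility with the relations from them.\<close>

lemma linear_fixed_point_exists:
  fixes T :: "('u::real_vector forests \<Rightarrow> 'v::real_vector) \<Rightarrow> 'u forests \<Rightarrow> 'v"
  assumes lin: "\<And>L. linear L \<Longrightarrow> linear (T L)"
    and local: "\<And>L L' f. linear L \<Longrightarrow> linear L' \<Longrightarrow>
      (\<And>g. card (verts g) < card (verts f) \<Longrightarrow> L (gen g) = L' (gen g)) \<Longrightarrow>
      T L (gen f) = T L' (gen f)"
  shows "\<exists>L. linear L \<and> (\<forall>x. L x = T L x)"
proof -
  define I where "I n = (T ^^ n) (\<lambda>x. 0)" for n
  have I_Suc: "I (Suc n) = T (I n)" for n
    by (simp add: I_def)
  have linI: "linear (I n)" for n
    by (induction n) (auto simp: I_def intro: linear_zero_fun lin)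
  have step: "I (Suc n) (gen f) = I n (gen f)" if "card (verts f) < n" for n f
    using that
  proof (induction n arbitrary: f)
    case (Suc n)
    have "T (I (Suc n)) (gen f) = T (I n) (gen f)"
      by (rule local[OF linI linI]) (use Suc in auto)
    then show ?case
      by (simp add: I_Suc)
  qed simp
  have stable: "I n (gen f) = I (Suc (card (verts f))) (gen f)" if "card (verts f) < n" for n f
    using that by (induction n) (auto simp: less_Suc_eq step)
  define L where "L = lin_ext (\<lambda>f. I (Suc (card (verts f))) (gen f))"
  have resp: "respectful (\<lambda>f. I (Suc (card (verts f))) (gen f))"
    unfolding respectful_forest
    by (auto intro!: linear_comp[OF linI] linear_gen_dec_update simp: card_iso gen_iso)
  have linL: "linear L"
    unfolding L_def by (rule linear_ext[OF resp])
  have L_gen: "L (gen f) = I (Suc (card (verts f))) (gen f)" for f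
    unfolding L_def by (rule ext_gen[OF resp])
  have "T L (gen f) = L (gen f)" for f
  proof -
    have "T L (gen f) = T (I (card (verts f))) (gen f)"
      by (rule local[OF linL linI]) (simp only: L_gen stable[of _ "card (verts f)"])
    then show ?thesis
      by (simp add: L_gen I_Suc)
  qed
  then have "L x = T L x" for x
    using linear_eq_on_gen[OF linL lin[OF linL]] by metis
  with linL show ?thesis
    by blast
qed

lemma card_upper_less: "A \<in> upper_sets f \<Longrightarrow> A \<noteq> verts f \<Longrightarrow> card (verts (induced f A)) < card (verts f)"
  using upper_set_subset[of A f] by (intro psubset_card_mono) auto

lemma card_lower_less:
  "A \<in> upper_sets f \<Longrightarrow> A \<noteq> {} \<Longrightarrow> card (verts (induced f (verts f - A))) < card (verts f)"
  using upper_set_subset[of A f] by (intro psubset_card_mono) auto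

lemma forest_induct_card:
  assumes "\<And>f. (\<And>g. card (verts g) < card (verts f) \<Longrightarrow> P g) \<Longrightarrow> P f"
  shows "P (f :: 'u forest)"
  by (induction "card (verts f)" arbitrary: f rule: less_induct) (use assms in auto)

lemma convolve_unit: "bilinear m \<Longrightarrow> convolve m (gen empty_forest) = m (gen empty_forest) (gen empty_forest)"
proof -
  assume m: "bilinear m"
  have "upper_sets (empty_forest :: 'a forest) = {{}}"
    by (auto simp: upper_sets_def)
  then show ?thesis
    by (simp add: convolve_gen[OF m])
qed

lemma ck_counit_growth: "ck_counit (x \<top>\<^sub>n y) = ck_counit x * ck_counit y"
proof -
  have "ck_counit (graft_sum x y) = 0" for x y :: "'a forests"
  proof (rule bilinear_eq_on_gen[of "\<lambda>x y. ck_counit (graft_sum x y)" "\<lambda>x y. 0"])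
    show "ck_counit (graft_sum (gen f) (gen g)) = 0" for f g :: "'a forest"
      by (auto simp: graft_sum_gen linear_sum[OF linear_ck_counit] ck_counit_gen graft_simps
          union_verts_def intro!: sum.neutral)
  qed (intro bilinearI linear_zero_fun linear_comp[OF linear_ck_counit] linear_graft_sum_left
      linear_graft_sum_right linear_self)+
  then show ?thesis
    by (simp add: natural_growth_eq linear_add[OF linear_ck_counit] linear_scale[OF linear_ck_counit]
        mult.commute)
qed

lemma convolve_growth_primitive:
  fixes p :: "'u::real_vector forests"
  assumes p: "p \<in> primitives" and m: "bilinear m"
  shows "convolve m (x \<top>\<^sub>n p)
       = convolve (\<lambda>x' x''. m x' (x'' \<top>\<^sub>n p)) x + m (x \<top>\<^sub>n p) (gen empty_forest)"
proof -
  have "bilinear (\<lambda>(x' :: 'u forests) x''. x' \<otimes>\<^sub>t (x'' \<top>\<^sub>n p))"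
    by (intro bilinear_comp[OF bilinear_tensor] linear_growth_left linear_self)
  then have "lin_ext (\<lambda>(y, z). m y z) (convolve (\<lambda>x' x''. x' \<otimes>\<^sub>t (x'' \<top>\<^sub>n p)) x)
      = convolve (\<lambda>x' x''. m x' (x'' \<top>\<^sub>n p)) x"
    by (simp add: convolve_image[OF linear_tensor_ext[OF m]] tensor_ext_gen[OF m])
  then show ?thesis
    by (simp add: convolve_def[of m] ck_comult_growth_primitive[OF p]
        linear_add[OF linear_tensor_ext[OF m]] tensor_ext_gen[OF m])
qed

section \<open>The projection onto primitive elements\<close>

text \<open>If every forest is a combination of words \<open>p\<^sub>1 \<top> \<dots> \<top> p\<^sub>n\<close> in
  primitive elements and the coproduct deconcatenates these words, then splitting off the last
  letter gives \<open>x = \<epsilon>(x) \<one> + \<Sum> x' \<top> \<pi>(x'')\<close>. Solving for the term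
  \<open>\<one> \<top> \<pi>(x)\<close> turns this into a recursion that defines \<open>\<pi>\<close>; subtracting the counit from the
  upper part is what removes this term from the sum.\<close>

definition primitive_part :: "'u::real_vector forests \<Rightarrow> 'u forests"
  where "primitive_part = (SOME L. linear L \<and> (\<forall>x. L x = x - ck_counit x *\<^sub>R gen empty_forest
    - convolve (\<lambda>y z. (y - ck_counit y *\<^sub>R gen empty_forest) \<top>\<^sub>n L z) x))"

lemma
  fixes x :: "'a::real_vector forests"
  shows linear_primitive_part: "linear (primitive_part :: 'a forests \<Rightarrow> _)"
    and growth_expansion: "ck_counit x *\<^sub>R gen empty_forest
      + convolve (\<lambda>y z. y \<top>\<^sub>n primitive_part z) x = x"
proof -
  define T where "T L x = x - ck_counit x *\<^sub>R gen empty_forest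
    - convolve (\<lambda>y z. (y - ck_counit y *\<^sub>R gen empty_forest) \<top>\<^sub>n L z) x"
    for L and x :: "'a forests"
  have bil: "bilinear (\<lambda>y z. (y - ck_counit y *\<^sub>R gen empty_forest) \<top>\<^sub>n L z)"
    if "linear L" for L :: "'a forests \<Rightarrow> 'a forests"
    by (intro bilinearI linear_growth_left linear_growth_right linear_minus linear_scaled_vec
        linear_ck_counit linear_self that)
  have ex: "\<exists>L. linear L \<and> (\<forall>x. L x = T L x)"
  proof (rule linear_fixed_point_exists)
    show "linear (T L)" if "linear L" for L
      unfolding T_def[abs_def]
      by (intro linear_minus linear_self linear_scaled_vec linear_ck_counit linear_convolve bil that)
    fix L L' :: "'a forests \<Rightarrow> 'a forests" and f :: "'a forest"
    assume L: "linear L" "linear L'"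
      and eq: "\<And>g. card (verts g) < card (verts f) \<Longrightarrow> L (gen g) = L' (gen g)"
    show "T L (gen f) = T L' (gen f)"
      unfolding T_def convolve_gen[OF bil[OF L(1)]] convolve_gen[OF bil[OF L(2)]]
    proof (rule arg_cong2[of _ _ _ _ "(-)", OF refl], rule sum.cong[OF refl])
      fix A assume A: "A \<in> upper_sets f"
      show "(gen (induced f A) - ck_counit (gen (induced f A)) *\<^sub>R gen empty_forest)
            \<top>\<^sub>n L (gen (induced f (verts f - A)))
          = (gen (induced f A) - ck_counit (gen (induced f A)) *\<^sub>R gen empty_forest)
            \<top>\<^sub>n L' (gen (induced f (verts f - A)))"
      proof (cases "A = {}")
        case False
        then show ?thesis
          using eq[OF card_lower_less[OF A]] by simp
      qed simp
    qed
  qed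
  note fixed_point = someI_ex[OF ex[unfolded T_def], folded primitive_part_def, folded T_def]
  from fixed_point show lin: "linear (primitive_part :: 'a forests \<Rightarrow> _)"
    by (rule conjunct1)
  from fixed_point have eq: "primitive_part x = T primitive_part x" for x
    by blast
  have bil1: "bilinear (\<lambda>(y :: 'a forests) z. y \<top>\<^sub>n primitive_part z)"
    by (intro bilinear_comp[OF bilinear_natural_growth] linear_self lin)
  have bil2: "bilinear (\<lambda>(y :: 'a forests) (z :: 'a forests). (- ck_counit y) *\<^sub>R primitive_part z)"
    by (intro bilinearI linear_scaled lin linear_scaled_vec linear_compose_neg linear_ck_counit)
  have minus: "(y - ck_counit y *\<^sub>R gen empty_forest) \<top>\<^sub>n z = y \<top>\<^sub>n z + (- ck_counit y) *\<^sub>R z"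
    for y z :: "'a forests"
    by (simp add: linear_diff[OF linear_growth_left[OF linear_self]]
        linear_scale[OF linear_growth_left[OF linear_self]])
  have "convolve (\<lambda>y z. (- ck_counit y) *\<^sub>R primitive_part z) x = - primitive_part x"
    using convolve_counit_left[OF linear_compose_neg[OF lin], of x] by simp
  then show "ck_counit x *\<^sub>R gen empty_forest + convolve (\<lambda>y z. y \<top>\<^sub>n primitive_part z) x = x"
    using eq[of x] by (simp only: T_def minus convolve_add[OF bil1 bil2]) (simp add: algebra_simps)
qed

lemma bilinear_growth_primitive_part: "bilinear (\<lambda>y z. y \<top>\<^sub>n primitive_part z)"
  by (intro bilinear_comp[OF bilinear_natural_growth] linear_self linear_primitive_part)

lemma primitive_part_unit [simp]: "primitive_part (gen empty_forest) = 0"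
  using growth_expansion[of "gen empty_forest"]
  by (simp add: convolve_unit[OF bilinear_growth_primitive_part])

lemma primitive_part_primitive: "p \<in> primitives \<Longrightarrow> primitive_part p = p"
  using growth_expansion[of p] convolve_primitive[OF _ bilinear_growth_primitive_part, of p]
  by (simp add: counit_primitive)

text \<open>Inductively, all terms \<open>x' \<top> \<pi>(x'')\<close> of the expansion except for \<open>\<one> \<top> \<pi>(x)\<close>
  have a known coproduct. By coassociativity these coproducts add up to what is left of the
  coproduct of \<open>x\<close> when \<open>\<pi>(x) \<otimes> \<one> + \<one> \<otimes> \<pi>(x)\<close> is taken away.\<close>

lemma primitive_part_gen_in_primitives: "primitive_part (gen f) \<in> primitives"
proof (induction f rule: forest_induct_card)
  case (1 f)
  let ?\<pi> = "primitive_part" and ?one = "gen empty_forest :: 'a forests"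
  let ?l = "\<lambda>A. gen (induced f A)" and ?r = "\<lambda>A. gen (induced f (verts f - A))"
  define R where "R = (\<Sum>A\<in>upper_sets f - {{}}. ?l A \<top>\<^sub>n ?\<pi> (?r A))"
  have gen_f: "gen f = ck_counit (gen f) *\<^sub>R ?one + (?\<pi> (gen f) + R)"
    using growth_expansion[of "gen f"]
    by (simp add: convolve_gen[OF bilinear_growth_primitive_part] R_def
        sum.remove[of "upper_sets f" "{}"])
  have bil: "bilinear (\<lambda>(x :: 'a forests) y. x \<otimes>\<^sub>t (y \<top>\<^sub>n ?\<pi> z))" for z :: "'a forests"
    by (intro bilinear_comp[OF bilinear_tensor] linear_growth_left linear_self)
  have bil2: "bilinear (\<lambda>w z. convolve (\<lambda>x y. x \<otimes>\<^sub>t (y \<top>\<^sub>n ?\<pi> z)) (w :: 'a forests))"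
    by (intro bilinearI linear_convolve linear_convolve_param bil linear_tensor_right
        linear_growth_right linear_primitive_part)
  have "ck_comult R = (\<Sum>A\<in>upper_sets f - {{}}.
      convolve (\<lambda>x y. x \<otimes>\<^sub>t (y \<top>\<^sub>n ?\<pi> (?r A))) (?l A) + (?l A \<top>\<^sub>n ?\<pi> (?r A)) \<otimes>\<^sub>t ?one)"
    unfolding R_def linear_sum[OF linear_ck_comult]
    by (intro sum.cong refl ck_comult_growth_primitive 1 card_lower_less) auto
  also have "\<dots> = (\<Sum>A\<in>upper_sets f - {{}}. convolve (\<lambda>x y. x \<otimes>\<^sub>t (y \<top>\<^sub>n ?\<pi> (?r A))) (?l A))
      + R \<otimes>\<^sub>t ?one"
    by (simp add: sum.distrib R_def linear_sum[OF linear_tensor_left[OF linear_self]])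
  also have "(\<Sum>A\<in>upper_sets f - {{}}. convolve (\<lambda>x y. x \<otimes>\<^sub>t (y \<top>\<^sub>n ?\<pi> (?r A))) (?l A))
      = convolve (\<lambda>w z. convolve (\<lambda>x y. x \<otimes>\<^sub>t (y \<top>\<^sub>n ?\<pi> z)) w) (gen f) - ?one \<otimes>\<^sub>t ?\<pi> (gen f)"
    by (simp add: convolve_gen[OF bil2] sum.remove[of "upper_sets f" "{}"] convolve_unit[OF bil])
  also have "convolve (\<lambda>w z. convolve (\<lambda>x y. x \<otimes>\<^sub>t (y \<top>\<^sub>n ?\<pi> z)) w) (gen f)
      = convolve (\<lambda>x w. convolve (\<lambda>y z. x \<otimes>\<^sub>t (y \<top>\<^sub>n ?\<pi> z)) w) (gen f)"
    by (intro convolve_coassoc linear_tensor_left linear_tensor_right linear_growth_left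
        linear_growth_right linear_primitive_part linear_self)
  also have "\<dots> = convolve (\<lambda>x w. x \<otimes>\<^sub>t w + ck_counit w *\<^sub>R (- (x \<otimes>\<^sub>t ?one))) (gen f)"
  proof -
    have "convolve (\<lambda>y z. x \<otimes>\<^sub>t (y \<top>\<^sub>n ?\<pi> z)) w = x \<otimes>\<^sub>t w + ck_counit w *\<^sub>R (- (x \<otimes>\<^sub>t ?one))"
      for x w :: "'a forests"
    proof -
      have lin: "linear (\<lambda>w. x \<otimes>\<^sub>t w)"
        by (intro linear_tensor_right linear_self)
      have "convolve (\<lambda>y z. x \<otimes>\<^sub>t (y \<top>\<^sub>n ?\<pi> z)) w = x \<otimes>\<^sub>t convolve (\<lambda>y z. y \<top>\<^sub>n ?\<pi> z) w"
        using convolve_image[OF lin bilinear_growth_primitive_part] by metis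
      also have "convolve (\<lambda>y z. y \<top>\<^sub>n ?\<pi> z) w = w - ck_counit w *\<^sub>R ?one"
        using growth_expansion[of w] by (simp add: algebra_simps)
      finally show ?thesis
        by (simp add: linear_diff[OF lin] linear_scale[OF lin])
    qed
    then show ?thesis
      by simp
  qed
  also have "\<dots> = ck_comult (gen f) - gen f \<otimes>\<^sub>t ?one"
  proof -
    have lin: "linear (\<lambda>x. - (x \<otimes>\<^sub>t ?one))"
      by (intro linear_compose_neg linear_tensor_left linear_self)
    show ?thesis
      by (subst convolve_add[OF bilinear_tensor bilinear_scaleR_counit_right[OF lin]])
         (simp only: convolve_counit_right[OF lin] ck_comult_eq_convolve, simp)
  qed
  finally have "ck_comult R = ck_comult (gen f) - gen f \<otimes>\<^sub>t ?one - ?one \<otimes>\<^sub>t ?\<pi> (gen f) + R \<otimes>\<^sub>t ?one" .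
  moreover have "ck_comult (gen f)
      = ck_counit (gen f) *\<^sub>R (?one \<otimes>\<^sub>t ?one) + (ck_comult (?\<pi> (gen f)) + ck_comult R)"
  proof -
    have "ck_comult ?one = ?one \<otimes>\<^sub>t ?one"
      by (simp add: ck_comult_eq_convolve convolve_unit[OF bilinear_tensor])
    then show ?thesis
      by (subst gen_f) (simp add: linear_add[OF linear_ck_comult] linear_scale[OF linear_ck_comult])
  qed
  moreover have "gen f \<otimes>\<^sub>t ?one
      = ck_counit (gen f) *\<^sub>R (?one \<otimes>\<^sub>t ?one) + (?\<pi> (gen f) \<otimes>\<^sub>t ?one + R \<otimes>\<^sub>t ?one)"
    by (subst gen_f) (simp add: linear_add[OF linear_tensor_left[OF linear_self]]
        linear_scale[OF linear_tensor_left[OF linear_self]])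
  ultimately show ?case
    by (simp add: primitives_iff algebra_simps)
qed

lemma subspace_primitives: "subspace primitives"
  unfolding subspace_def
  by (auto simp: primitives_iff linear_0[OF linear_ck_comult] linear_add[OF linear_ck_comult]
      linear_scale[OF linear_ck_comult]
      linear_0[OF linear_tensor_left[OF linear_self]] linear_0[OF linear_tensor_right[OF linear_self]]
      linear_add[OF linear_tensor_left[OF linear_self]] linear_add[OF linear_tensor_right[OF linear_self]]
      linear_scale[OF linear_tensor_left[OF linear_self]]
      linear_scale[OF linear_tensor_right[OF linear_self]] algebra_simps)

lemma primitive_part_in_primitives: "primitive_part x \<in> primitives"
proof -
  obtain A c where "finite A" "x = (\<Sum>f\<in>A. c f *\<^sub>R gen f)"
    by (rule presented_eq_sum_gen)
  then show ?thesis
    by (simp add: linear_sum[OF linear_primitive_part] linear_scale[OF linear_primitive_part]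
        subspace_sum[OF subspace_primitives] subspace_scale[OF subspace_primitives]
        primitive_part_gen_in_primitives)
qed

text \<open>Expand \<open>f \<top> p\<close> for a nonempty forest \<open>f\<close>. By the cocycle property only terms
  \<open>f' \<top> \<pi>(f'' \<top> p)\<close> occur, where \<open>f'\<close> and \<open>f''\<close> are the parts of a cut of \<open>f\<close>. By induction
  those with proper parts vanish, and the one with empty \<open>f''\<close> is \<open>f \<top> p\<close> itself, so that
  nothing is left for \<open>\<pi>(f \<top> p)\<close>.\<close>

lemma primitive_part_growth:
  assumes p: "p \<in> primitives"
  shows "primitive_part (x \<top>\<^sub>n p) = ck_counit x *\<^sub>R p"
proof (rule linear_eq_on_gen[of "\<lambda>x. primitive_part (x \<top>\<^sub>n p)" "\<lambda>x. ck_counit x *\<^sub>R p"])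
  fix f :: "'a forest"
  let ?\<pi> = "primitive_part :: 'a forests \<Rightarrow> 'a forests"
  show "primitive_part (gen f \<top>\<^sub>n p) = ck_counit (gen f) *\<^sub>R p"
  proof (induction f rule: forest_induct_card)
    case (1 f)
    let ?l = "\<lambda>A. gen (induced f A)" and ?r = "\<lambda>A. gen (induced f (verts f - A))"
    show ?case
    proof (cases "verts f = {}")
      case True
      then show ?thesis
        by (simp add: gen_empty[of f] primitive_part_primitive[OF p])
    next
      case False
      have bil: "bilinear (\<lambda>x y. x \<top>\<^sub>n ?\<pi> (y \<top>\<^sub>n p))"
        by (intro bilinear_comp[OF bilinear_natural_growth] linear_self
            linear_comp[OF linear_primitive_part] linear_growth_left)
      have "gen f \<top>\<^sub>n p = convolve (\<lambda>x y. x \<top>\<^sub>n ?\<pi> (y \<top>\<^sub>n p)) (gen f)"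
        using growth_expansion[of "gen f \<top>\<^sub>n p"]
        by (simp add: ck_counit_growth counit_primitive[OF p]
            convolve_growth_primitive[OF p bilinear_growth_primitive_part])
      also have "\<dots> = ?\<pi> (gen f \<top>\<^sub>n p)
          + (\<Sum>A\<in>upper_sets f - {{}}. ?l A \<top>\<^sub>n ?\<pi> (?r A \<top>\<^sub>n p))"
        by (simp add: convolve_gen[OF bil] sum.remove[of "upper_sets f" "{}"])
      also have "(\<Sum>A\<in>upper_sets f - {{}}. ?l A \<top>\<^sub>n ?\<pi> (?r A \<top>\<^sub>n p))
          = (\<Sum>A\<in>upper_sets f - {{}}. if A = verts f then gen f \<top>\<^sub>n p else 0)"
      proof (rule sum.cong[OF refl])
        fix A assume "A \<in> upper_sets f - {{}}"
        then have "?\<pi> (?r A \<top>\<^sub>n p) = ck_counit (?r A) *\<^sub>R p" "A \<subseteq> verts f"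
          using 1[OF card_lower_less] upper_set_subset by auto
        then show "?l A \<top>\<^sub>n ?\<pi> (?r A \<top>\<^sub>n p) = (if A = verts f then gen f \<top>\<^sub>n p else 0)"
          by (auto simp: ck_counit_gen)
      qed
      also have "\<dots> = gen f \<top>\<^sub>n p"
        using False by simp
      finally show ?thesis
        using False by (simp add: ck_counit_gen)
    qed
  qed
qed (intro linear_comp[OF linear_primitive_part] linear_growth_left linear_scaled_vec
    linear_ck_counit linear_self)+

section \<open>Maps into words\<close>

text \<open>The space of words over \<open>'v\<close> is cofree: a linear map \<open>l\<close> from forests to letters that
  vanishes at the empty forest lifts to a coalgebra map to words whose letter part is
  \<open>l\<close>. The last letter of the lift is the value of \<open>l\<close> at the lower part of a cut, and the letters
  before it come from the upper part.\<close>

definition word_lift ::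
  "('u::real_vector forests \<Rightarrow> 'v::real_vector) \<Rightarrow> 'u forests \<Rightarrow> 'v tensor_algebra"
  where "word_lift l = (SOME L. linear L \<and> (\<forall>x. L x = ck_counit x *\<^sub>R gen []
    + convolve (\<lambda>y z. snoc (L y) (l z)) x))"

lemma bilinear_snoc_letter:
  "linear l \<Longrightarrow> linear L \<Longrightarrow> bilinear (\<lambda>y z. snoc (L y) (l z))"
  by (intro bilinear_comp[OF bilinear_snoc])

context
  fixes l :: "'u::real_vector forests \<Rightarrow> 'v::real_vector"
  assumes lin_l: "linear l" and l_unit: "l (gen empty_forest) = 0"
begin

lemma
  shows linear_word_lift: "linear (word_lift l)"
    and word_lift_eq: "word_lift l x
      = ck_counit x *\<^sub>R gen [] + convolve (\<lambda>y z. snoc (word_lift l y) (l z)) x"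
proof -
  define T where "T L x = ck_counit x *\<^sub>R gen [] + convolve (\<lambda>y z. snoc (L y) (l z)) x" for L x
  have ex: "\<exists>L. linear L \<and> (\<forall>x. L x = T L x)"
  proof (rule linear_fixed_point_exists)
    show "linear (T L)" if "linear L" for L
      unfolding T_def[abs_def]
      by (intro linear_plus linear_scaled_vec linear_ck_counit linear_convolve
          bilinear_snoc_letter lin_l that)
    fix L L' :: "'u forests \<Rightarrow> 'v tensor_algebra" and f :: "'u forest"
    assume L: "linear L" "linear L'"
      and eq: "\<And>g. card (verts g) < card (verts f) \<Longrightarrow> L (gen g) = L' (gen g)"
    show "T L (gen f) = T L' (gen f)"
      unfolding T_def convolve_gen[OF bilinear_snoc_letter[OF lin_l L(1)]]
        convolve_gen[OF bilinear_snoc_letter[OF lin_l L(2)]]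
    proof (rule arg_cong2[of _ _ _ _ "(+)", OF refl], rule sum.cong[OF refl])
      fix A assume A: "A \<in> upper_sets f"
      show "snoc (L (gen (induced f A))) (l (gen (induced f (verts f - A))))
          = snoc (L' (gen (induced f A))) (l (gen (induced f (verts f - A))))"
      proof (cases "A = verts f")
        case False
        then show ?thesis
          using eq[OF card_upper_less[OF A]] by simp
      qed (simp add: l_unit)
    qed
  qed
  note fixed_point = someI_ex[OF ex[unfolded T_def], folded word_lift_def]
  from fixed_point show "linear (word_lift l)"
    by (rule conjunct1)
  from fixed_point show "word_lift l x
      = ck_counit x *\<^sub>R gen [] + convolve (\<lambda>y z. snoc (word_lift l y) (l z)) x"
    by blast
qed

lemma word_lift_gen:
  "word_lift l (gen f) = ck_counit (gen f) *\<^sub>R gen []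
     + (\<Sum>A\<in>upper_sets f. snoc (word_lift l (gen (induced f A))) (l (gen (induced f (verts f - A)))))"
  by (subst word_lift_eq)
     (simp add: convolve_gen[OF bilinear_snoc_letter[OF lin_l linear_word_lift]])

lemma word_lift_unit [simp]: "word_lift l (gen empty_forest) = gen []"
  by (subst word_lift_eq)
     (simp add: convolve_unit[OF bilinear_snoc_letter[OF lin_l linear_word_lift]] l_unit)

lemma empty_word_coeff_word_lift: "empty_word_coeff (word_lift l x) = ck_counit x"
  by (subst word_lift_eq)
     (simp add: linear_add[OF linear_empty_word_coeff] linear_scale[OF linear_empty_word_coeff]
       convolve_image[OF linear_empty_word_coeff bilinear_snoc_letter[OF lin_l linear_word_lift]]
       empty_word_coeff_snoc empty_word_coeff_gen)

lemma letter_part_word_lift: "letter_part (word_lift l x) = l x"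
  by (subst word_lift_eq)
     (simp add: linear_add[OF linear_letter_part] linear_scale[OF linear_letter_part]
       convolve_image[OF linear_letter_part bilinear_snoc_letter[OF lin_l linear_word_lift]]
       letter_part_snoc letter_part_gen empty_word_coeff_word_lift convolve_counit_left[OF lin_l])

lemma bilinear_word_lift_tensor: "bilinear (\<lambda>y z. word_lift l y \<otimes>\<^sub>t word_lift l z)"
  by (intro bilinear_comp[OF bilinear_tensor] linear_word_lift)

text \<open>Deconcatenating the lift of a forest means cutting off the last letter first and cutting the
  remaining upper part afterwards. By coassociativity the second cut may be made first, and then
  the recursion for the lift reassembles the lower two of the three pieces.\<close>

lemma deconcatenation_word_lift:
  "deconcatenation (word_lift l x) = convolve (\<lambda>y z. word_lift l y \<otimes>\<^sub>t word_lift l z) x"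
proof (rule linear_eq_on_gen[OF linear_comp[OF linear_deconcatenation linear_word_lift]
      linear_convolve[OF bilinear_word_lift_tensor]])
  fix f
  show "deconcatenation (word_lift l (gen f))
      = convolve (\<lambda>y z. word_lift l y \<otimes>\<^sub>t word_lift l z) (gen f)"
  proof (induction f rule: forest_induct_card)
    case (1 f)
    let ?L = "word_lift l" and ?nil = "gen [] :: 'v tensor_algebra"
    let ?l = "\<lambda>A. gen (induced f A)" and ?r = "\<lambda>A. gen (induced f (verts f - A))"
    have bil: "bilinear (\<lambda>x y. ?L x \<otimes>\<^sub>t snoc (?L y) (l z))" for z
      by (intro bilinear_comp[OF bilinear_tensor] linear_snoc_left linear_word_lift)
    have bil2: "bilinear (\<lambda>w z. convolve (\<lambda>x y. ?L x \<otimes>\<^sub>t snoc (?L y) (l z)) w)"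
      by (intro bilinearI linear_convolve linear_convolve_param bil linear_tensor_right
          linear_snoc_right lin_l)
    have bil_snoc: "bilinear (\<lambda>(y :: 'v tensor_algebra) z. y \<otimes>\<^sub>t snoc z v)" for v :: 'v
      by (intro bilinear_comp[OF bilinear_tensor] linear_self linear_snoc_left)
    define S where "S = (\<Sum>A\<in>upper_sets f. snoc (?L (?l A)) (l (?r A)))"
    have L_f: "?L (gen f) = ck_counit (gen f) *\<^sub>R ?nil + S"
      unfolding S_def by (rule word_lift_gen)
    have "deconcatenation S = (\<Sum>A\<in>upper_sets f.
        convolve (\<lambda>x y. ?L x \<otimes>\<^sub>t snoc (?L y) (l (?r A))) (?l A) + snoc (?L (?l A)) (l (?r A)) \<otimes>\<^sub>t ?nil)"
      unfolding S_def linear_sum[OF linear_deconcatenation]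
    proof (rule sum.cong[OF refl])
      fix A assume A: "A \<in> upper_sets f"
      show "deconcatenation (snoc (?L (?l A)) (l (?r A)))
          = convolve (\<lambda>x y. ?L x \<otimes>\<^sub>t snoc (?L y) (l (?r A))) (?l A)
            + snoc (?L (?l A)) (l (?r A)) \<otimes>\<^sub>t ?nil"
      proof (cases "A = verts f")
        case True
        then show ?thesis
          by (simp add: l_unit linear_0[OF linear_deconcatenation]
              linear_0[OF linear_tensor_right[OF linear_self]]
              linear_0[OF linear_tensor_left[OF linear_self]])
      next
        case False
        show ?thesis
          by (simp add: deconcatenation_snoc 1[OF card_upper_less[OF A False]]
              convolve_image[OF linear_tensor_ext[OF bil_snoc] bilinear_word_lift_tensor]
              tensor_ext_gen[OF bil_snoc])
      qed
    qed
    also have "\<dots> = convolve (\<lambda>w z. convolve (\<lambda>x y. ?L x \<otimes>\<^sub>t snoc (?L y) (l z)) w) (gen f) + S \<otimes>\<^sub>t ?nil"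
      by (simp add: sum.distrib convolve_gen[OF bil2] S_def
          linear_sum[OF linear_tensor_left[OF linear_self]])
    also have "convolve (\<lambda>w z. convolve (\<lambda>x y. ?L x \<otimes>\<^sub>t snoc (?L y) (l z)) w) (gen f)
        = convolve (\<lambda>x w. convolve (\<lambda>y z. ?L x \<otimes>\<^sub>t snoc (?L y) (l z)) w) (gen f)"
      by (intro convolve_coassoc linear_tensor_left linear_tensor_right linear_snoc_left
          linear_snoc_right linear_word_lift lin_l)
    also have "\<dots> = convolve (\<lambda>x w. ?L x \<otimes>\<^sub>t ?L w + ck_counit w *\<^sub>R (- (?L x \<otimes>\<^sub>t ?nil))) (gen f)"
    proof -
      have "convolve (\<lambda>y z. ?L x \<otimes>\<^sub>t snoc (?L y) (l z)) w
          = ?L x \<otimes>\<^sub>t ?L w + ck_counit w *\<^sub>R (- (?L x \<otimes>\<^sub>t ?nil))" for x w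
      proof -
        have lin: "linear (\<lambda>w. ?L x \<otimes>\<^sub>t w)"
          by (intro linear_tensor_right linear_self)
        have "convolve (\<lambda>y z. ?L x \<otimes>\<^sub>t snoc (?L y) (l z)) w
            = ?L x \<otimes>\<^sub>t convolve (\<lambda>y z. snoc (?L y) (l z)) w"
          using convolve_image[OF lin bilinear_snoc_letter[OF lin_l linear_word_lift]] by metis
        also have "convolve (\<lambda>y z. snoc (?L y) (l z)) w = ?L w - ck_counit w *\<^sub>R ?nil"
          using word_lift_eq[of w] by (simp add: algebra_simps)
        finally show ?thesis
          by (simp add: linear_diff[OF lin] linear_scale[OF lin])
      qed
      then show ?thesis
        by simp
    qed
    also have "\<dots> = convolve (\<lambda>y z. ?L y \<otimes>\<^sub>t ?L z) (gen f) - ?L (gen f) \<otimes>\<^sub>t ?nil"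
    proof -
      have lin: "linear (\<lambda>x. - (?L x \<otimes>\<^sub>t ?nil))"
        by (intro linear_compose_neg linear_tensor_left linear_word_lift)
      show ?thesis
        by (subst convolve_add[OF bilinear_word_lift_tensor bilinear_scaleR_counit_right[OF lin]])
           (simp only: convolve_counit_right[OF lin], simp)
    qed
    finally have "deconcatenation S
        = convolve (\<lambda>y z. ?L y \<otimes>\<^sub>t ?L z) (gen f) - ?L (gen f) \<otimes>\<^sub>t ?nil + S \<otimes>\<^sub>t ?nil" .
    moreover have "deconcatenation ?nil = ?nil \<otimes>\<^sub>t ?nil"
      by (simp add: deconcatenation_gen)
    ultimately have "deconcatenation (ck_counit (gen f) *\<^sub>R ?nil + S)
        = ck_counit (gen f) *\<^sub>R (?nil \<otimes>\<^sub>t ?nil)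
          + (convolve (\<lambda>y z. ?L y \<otimes>\<^sub>t ?L z) (gen f) - ?L (gen f) \<otimes>\<^sub>t ?nil + S \<otimes>\<^sub>t ?nil)"
      by (simp only: linear_add[OF linear_deconcatenation] linear_scale[OF linear_deconcatenation])
    moreover have "?L (gen f) \<otimes>\<^sub>t ?nil = ck_counit (gen f) *\<^sub>R (?nil \<otimes>\<^sub>t ?nil) + S \<otimes>\<^sub>t ?nil"
      by (simp only: L_f linear_add[OF linear_tensor_left[OF linear_self]]
          linear_scale[OF linear_tensor_left[OF linear_self]])
    ultimately show ?case
      by (simp only: flip: L_f) simp
  qed
qed

text \<open>Under the cocycle property of \<open>x \<top> p\<close> the last letter is \<open>l(x'' \<top> p)\<close>, which by the
  hypothesis on \<open>l\<close> is nonzero only if all of \<open>x\<close> is in the upper part.\<close>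

lemma word_lift_growth:
  assumes p: "p \<in> primitives" and growth: "\<And>x. l (x \<top>\<^sub>n p) = ck_counit x *\<^sub>R l p"
  shows "word_lift l (x \<top>\<^sub>n p) = snoc (word_lift l x) (l p)"
proof -
  have "word_lift l (x \<top>\<^sub>n p) = convolve (\<lambda>y z. snoc (word_lift l y) (l (z \<top>\<^sub>n p))) x"
    by (subst word_lift_eq) (simp add: ck_counit_growth counit_primitive[OF p] l_unit
        convolve_growth_primitive[OF p bilinear_snoc_letter[OF lin_l linear_word_lift]])
  also have "\<dots> = convolve (\<lambda>y z. ck_counit z *\<^sub>R snoc (word_lift l y) (l p)) x"
    by (simp add: growth linear_scale[OF linear_snoc_right[OF linear_self]])
  also have "\<dots> = snoc (word_lift l x) (l p)"
    by (intro convolve_counit_right linear_snoc_left linear_word_lift)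
  finally show ?thesis .
qed

end

subsection \<open>Words of primitive elements\<close>

lemma growth_word_Nil [simp]: "growth_word [] = gen empty_forest"
  by (simp add: growth_word_def CK_def)

lemma growth_word_snoc: "growth_word (xs @ [x]) = growth_word xs \<top>\<^sub>n x"
  by (simp add: growth_word_def)

lemma multilinear_growth_word: "multilinear growth_word"
proof (rule multilinearI)
  show "linear (\<lambda>x. growth_word (us @ x # vs))" for us vs :: "'a forests list"
  proof (induction vs rule: rev_induct)
    case Nil
    show ?case
      by (simp add: growth_word_snoc linear_growth_right linear_self)
  next
    case (snoc v vs)
    have "growth_word (us @ x # vs @ [v]) = growth_word (us @ x # vs) \<top>\<^sub>n v" for x
      using growth_word_snoc[of "us @ x # vs" v] by simp
    then show ?case
      by (simp add: linear_growth_left snoc)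
  qed
qed

abbreviation grow :: "'u::real_vector forests tensor_algebra \<Rightarrow> 'u forests"
  where "grow \<equiv> lin_ext growth_word"

lemmas linear_grow = linear_word_ext[OF multilinear_growth_word]
lemmas grow_gen = word_ext_gen[OF multilinear_growth_word]

lemma grow_snoc: "grow (snoc x p) = grow x \<top>\<^sub>n p"
  by (rule linear_eq_on_gen[OF linear_comp[OF linear_grow linear_snoc_left[OF linear_self]]
        linear_growth_left[OF linear_grow]])
     (simp add: snoc_gen grow_gen growth_word_snoc)

text \<open>This applies to the projection onto primitives, whose lift thereby inverts the formation of
  growth words, and to the letters of the quasi-arborification map, whose lift thereby becomes
  computable on the image of \<open>iota\<close>.\<close>

lemma word_lift_growth_word:
  fixes l :: "'u::real_vector forests \<Rightarrow> 'v::real_vector"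
  assumes lin: "linear l" and unit: "l (gen empty_forest) = 0"
    and growth: "\<And>x p. p \<in> primitives \<Longrightarrow> l (x \<top>\<^sub>n p) = ck_counit x *\<^sub>R l p"
    and ps: "set ps \<subseteq> primitives"
  shows "word_lift l (growth_word ps) = gen (map l ps)"
  using ps
proof (induction ps rule: rev_induct)
  case Nil
  show ?case
    by (simp add: word_lift_unit[OF lin unit])
next
  case (snoc p ps)
  then have p: "p \<in> primitives"
    by auto
  have "word_lift l (growth_word ps \<top>\<^sub>n p) = snoc (word_lift l (growth_word ps)) (l p)"
    by (rule word_lift_growth[OF lin unit p growth[OF p]])
  with snoc show ?case
    by (simp add: growth_word_snoc snoc_gen)
qed

lemma ck_comult_growth_word:
  "set ps \<subseteq> primitives \<Longrightarrow> ck_comult (growth_word ps)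
     = (\<Sum>i\<le>length ps. growth_word (take i ps) \<otimes>\<^sub>t growth_word (drop i ps))"
proof (induction ps rule: rev_induct)
  case Nil
  show ?case
    by (simp add: ck_comult_eq_convolve convolve_unit[OF bilinear_tensor])
next
  case (snoc p ps)
  have bil: "bilinear (\<lambda>(x :: 'a forests) y. x \<otimes>\<^sub>t (y \<top>\<^sub>n p))"
    by (intro bilinear_comp[OF bilinear_tensor] linear_self linear_growth_left)
  have "convolve (\<lambda>x y. x \<otimes>\<^sub>t (y \<top>\<^sub>n p)) (growth_word ps)
      = (\<Sum>i\<le>length ps. growth_word (take i ps) \<otimes>\<^sub>t (growth_word (drop i ps) \<top>\<^sub>n p))"
    using snoc by (simp add: convolve_def linear_sum[OF linear_tensor_ext[OF bil]]
        tensor_ext_gen[OF bil])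
  moreover have "p \<in> primitives"
    using snoc by simp
  ultimately show ?case
    by (simp add: growth_word_snoc ck_comult_growth_primitive)
qed

text \<open>Lifting \<open>\<pi>\<close> to words inverts \<open>p\<^sub>1 \<otimes> \<dots> \<otimes> p\<^sub>n \<mapsto> p\<^sub>1 \<top> \<dots> \<top> p\<^sub>n\<close>, so that this
  map is bijective and the one-letter part of its inverse is \<open>\<pi>\<close>.\<close>

lemma grow_word_lift: "grow (word_lift primitive_part x) = x"
proof (rule linear_eq_on_gen[OF linear_comp[OF linear_grow
        linear_word_lift[OF linear_primitive_part primitive_part_unit]] linear_self])
  fix f :: "'a forest"
  show "grow (word_lift primitive_part (gen f)) = gen f"
  proof (induction f rule: forest_induct_card)
    case (1 f)
    have "grow (word_lift primitive_part (gen f)) = ck_counit (gen f) *\<^sub>R gen empty_forest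
        + (\<Sum>A\<in>upper_sets f. grow (word_lift primitive_part (gen (induced f A)))
            \<top>\<^sub>n primitive_part (gen (induced f (verts f - A))))"
      unfolding word_lift_gen[OF linear_primitive_part primitive_part_unit, of f]
      by (simp add: linear_add[OF linear_grow] linear_scale[OF linear_grow]
          linear_sum[OF linear_grow] grow_snoc grow_gen)
    also have "(\<Sum>A\<in>upper_sets f. grow (word_lift primitive_part (gen (induced f A)))
            \<top>\<^sub>n primitive_part (gen (induced f (verts f - A))))
        = (\<Sum>A\<in>upper_sets f. gen (induced f A) \<top>\<^sub>n primitive_part (gen (induced f (verts f - A))))"
    proof (rule sum.cong[OF refl])
      fix A assume A: "A \<in> upper_sets f"
      show "grow (word_lift primitive_part (gen (induced f A)))
            \<top>\<^sub>n primitive_part (gen (induced f (verts f - A)))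
          = gen (induced f A) \<top>\<^sub>n primitive_part (gen (induced f (verts f - A)))"
      proof (cases "A = verts f")
        case False
        then show ?thesis
          using 1[OF card_upper_less[OF A]] by simp
      qed simp
    qed
    also have "ck_counit (gen f) *\<^sub>R gen empty_forest + \<dots> = gen f"
      using growth_expansion[of "gen f"] by (simp add: convolve_gen[OF bilinear_growth_primitive_part])
    finally show ?case .
  qed
qed

lemma word_lift_grow:
  assumes "w \<in> primitive_words"
  shows "word_lift primitive_part (grow w) = w"
proof (rule linear_eq_on[of "\<lambda>w. word_lift primitive_part (grow w)" "\<lambda>w. w"])
  show "w \<in> span {gen ps | ps. set ps \<subseteq> primitives}"
    using assms by (simp add: primitive_words_def)
  fix b :: "'a forests tensor_algebra"
  assume "b \<in> {gen ps | ps. set ps \<subseteq> primitives}"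
  then obtain ps where ps: "b = gen ps" "set ps \<subseteq> primitives"
    by auto
  then have "map primitive_part ps = ps"
    by (auto intro!: map_idI primitive_part_primitive)
  then show "word_lift primitive_part (grow b) = b"
    using word_lift_growth_word[OF linear_primitive_part primitive_part_unit _ ps(2)]
    by (simp add: ps(1) grow_gen primitive_part_growth primitive_part_primitive)
qed (intro linear_comp[OF linear_word_lift] linear_primitive_part primitive_part_unit linear_grow
    linear_self)+

lemma snoc_in_primitive_words:
  assumes w: "w \<in> primitive_words" and p: "p \<in> primitives"
  shows "snoc w p \<in> primitive_words"
proof -
  have lin: "linear (\<lambda>w. snoc w p)"
    by (intro linear_snoc_left linear_self)
  have "snoc w p \<in> (\<lambda>w. snoc w p) ` span {gen ps | ps. set ps \<subseteq> primitives}"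
    using w by (auto simp: primitive_words_def)
  also have "\<dots> = span ((\<lambda>w. snoc w p) ` {gen ps | ps. set ps \<subseteq> primitives})"
    by (rule linear_span_image[OF lin, symmetric])
  also have "\<dots> \<subseteq> span {gen ps | ps. set ps \<subseteq> primitives}"
  proof (rule span_mono)
    have "set (ps @ [p]) \<subseteq> primitives" if "set ps \<subseteq> primitives" for ps
      using that p by simp
    then show "(\<lambda>w. snoc w p) ` {gen ps | ps. set ps \<subseteq> primitives}
        \<subseteq> {gen ps | ps. set ps \<subseteq> primitives}"
      unfolding snoc_gen image_Collect by (force simp: snoc_gen)
  qed
  finally show ?thesis
    by (simp add: primitive_words_def)
qed

lemma word_lift_in_primitive_words: "word_lift primitive_part x \<in> primitive_words"
proof -
  have sub: "subspace primitive_words"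
    unfolding primitive_words_def by (rule subspace_span)
  have "word_lift primitive_part (gen f) \<in> primitive_words" for f :: "'a forest"
  proof (induction f rule: forest_induct_card)
    case (1 f)
    have "snoc (word_lift primitive_part (gen (induced f A)))
        (primitive_part (gen (induced f (verts f - A)))) \<in> primitive_words"
      if A: "A \<in> upper_sets f" for A
    proof (cases "A = verts f")
      case True
      then show ?thesis
        by (simp add: subspace_0[OF sub])
    next
      case False
      then show ?thesis
        by (intro snoc_in_primitive_words 1 card_upper_less A primitive_part_in_primitives)
    qed
    moreover have "gen [] \<in> primitive_words"
      unfolding primitive_words_def by (rule span_base) auto
    ultimately show ?case
      unfolding word_lift_gen[OF linear_primitive_part primitive_part_unit, of f]
      by (intro subspace_add[OF sub] subspace_scale[OF sub] subspace_sum[OF sub])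
  qed
  moreover obtain A c where "finite A" "x = (\<Sum>f\<in>A. c f *\<^sub>R gen f)"
    by (rule presented_eq_sum_gen)
  moreover note lin = linear_word_lift[OF linear_primitive_part primitive_part_unit]
  ultimately show ?thesis
    by (simp add: linear_sum[OF lin] linear_scale[OF lin] subspace_sum[OF sub]
        subspace_scale[OF sub])
qed

lemma primitive_projection_eq: "primitive_projection x = primitive_part x"
proof -
  have "inj_on grow primitive_words"
    by (rule inj_on_inverseI[of _ "word_lift primitive_part"]) (rule word_lift_grow)
  then have "inv_into primitive_words grow (grow (word_lift primitive_part x))
      = word_lift primitive_part x"
    by (rule inv_into_f_f) (rule word_lift_in_primitive_words)
  then show ?thesis
    by (simp add: primitive_projection_def grow_word_lift
        letter_part_word_lift[OF linear_primitive_part primitive_part_unit])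
qed

section \<open>The quasi-arborification map\<close>

text \<open>The lift of this map to words sums over all ways to build up a forest by successively
  adding blocks of pairwise incomparable vertices, descendants before ancestors; each block
  contributes the symmetric product of its decorations as a letter.\<close>

definition antichain_letter :: "'u::real_vector forests \<Rightarrow> 'u symmetric"
  where "antichain_letter = lin_ext (\<lambda>f. if edges f = {}
    then symmetric_product (map (dec f) (sorted_list_of_set (verts f))) else 0)"

lemma symmetric_product_decorations:
  assumes "mset xs = image_mset (dec f) (mset_set (verts f))"
  shows "symmetric_product (map (dec f) (sorted_list_of_set (verts f))) = symmetric_product xs"
proof (rule symmetric_product_permute)
  have "mset (sorted_list_of_set (verts f)) = mset_set (verts f)"
    using mset_sorted_list_of_multiset[of "mset_set (verts f)"] by simp
  with assms show "mset (map (dec f) (sorted_list_of_set (verts f))) = mset xs"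
    by simp
qed

lemma mset_decorations: "mset (map (dec f) (sorted_list_of_set (verts f))) = image_mset (dec f) (mset_set (verts f))"
  using mset_sorted_list_of_multiset[of "mset_set (verts f)"] by simp

lemma respectful_antichain_letter:
  "respectful (\<lambda>f. if edges f = {}
     then symmetric_product (map (dec f) (sorted_list_of_set (verts f))) else 0)"
  unfolding respectful_forest
proof (intro conjI allI impI)
  fix f :: "'a forest" and v
  assume "v \<in> verts f"
  then have "v \<in> set (sorted_list_of_set (verts f))"
    by simp
  then obtain us vs where l: "sorted_list_of_set (verts f) = us @ v # vs"
    by (meson split_list)
  have "distinct (us @ v # vs)"
    by (simp flip: l)
  then have updated: "map ((dec f)(v := x)) (us @ v # vs) = map (dec f) us @ x # map (dec f) vs" for x
    by auto
  show "linear (\<lambda>x. if edges (dec_update f v x) = {} then symmetric_product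
      (map (dec (dec_update f v x)) (sorted_list_of_set (verts (dec_update f v x)))) else 0)"
    unfolding dec_update_simps l updated
    by (cases "edges f = {}")
       (simp_all add: linear_zero_fun linear_slot[OF multilinear_symmetric_product linear_self])
next
  fix f g :: "'a forest"
  assume "forest_iso f g"
  then obtain h where h: "iso_map h f g"
    by (auto simp: forest_iso_iff)
  then have inj: "inj_on h (verts f)" and img: "h ` verts f = verts g"
    and dec: "\<And>v. v \<in> verts f \<Longrightarrow> dec g (h v) = dec f v"
    by (auto simp: iso_map_def bij_betw_def)
  have "edges f = {} \<longleftrightarrow> edges g = {}"
  proof
    assume "edges f = {}"
    then show "edges g = {}"
      using iso_map_edge[OF h] by (metis empty_iff subrelI subset_empty)
  next
    assume "edges g = {}"
    then show "edges f = {}"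
      using h edges_in_verts by (fastforce simp: iso_map_def)
  qed
  moreover have "symmetric_product (map (dec f) (sorted_list_of_set (verts f)))
      = symmetric_product (map (dec g) (sorted_list_of_set (verts g)))"
  proof (rule symmetric_product_decorations)
    have "image_mset (dec g) (mset_set (verts g)) = image_mset (dec g) (image_mset h (mset_set (verts f)))"
      by (simp add: image_mset_mset_set[OF inj] img)
    also have "\<dots> = image_mset (dec f) (mset_set (verts f))"
      by (auto simp: dec image_mset.compositionality intro!: image_mset_cong)
    finally show "mset (map (dec g) (sorted_list_of_set (verts g))) = image_mset (dec f) (mset_set (verts f))"
      by (simp only: mset_decorations)
  qed
  ultimately show "(if edges f = {}
        then symmetric_product (map (dec f) (sorted_list_of_set (verts f))) else 0)
      = (if edges g = {}
        then symmetric_product (map (dec g) (sorted_list_of_set (verts g))) else 0)"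
    by simp
qed

lemma linear_antichain_letter: "linear antichain_letter"
  unfolding antichain_letter_def by (rule linear_ext[OF respectful_antichain_letter])

lemma antichain_letter_gen:
  "antichain_letter (gen f) = (if edges f = {}
     then symmetric_product (map (dec f) (sorted_list_of_set (verts f))) else 0)"
  unfolding antichain_letter_def by (rule ext_gen[OF respectful_antichain_letter])

lemma antichain_letter_unit [simp]: "antichain_letter (gen empty_forest) = 0"
  by (simp add: antichain_letter_gen)

lemma antichain_letter_isolated: "antichain_letter (gen (isolated xs)) = symmetric_product xs"
  by (simp add: antichain_letter_gen lessThan_atLeast0 map_nth)

lemma union_edges_empty_iff: "union_edges E E' = {} \<longleftrightarrow> E = {} \<and> E' = {}"
  by (simp add: union_edges_def)

lemma ck_mult_unit_left [simp]: "ck_mult (gen empty_forest) x = x"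
  by (rule linear_eq_on_gen[OF linear_ck_mult_right[OF linear_self] linear_self])
     (simp add: ck_mult_gen gen_disjoint_union_empty_left)

text \<open>An antichain in a disjoint union lies in the first forest, in the second, or meets both.\<close>

lemma antichain_letter_mult:
  "antichain_letter (ck_mult x y) = ck_counit x *\<^sub>R antichain_letter y
     + ck_counit y *\<^sub>R antichain_letter x + antichain_letter x \<odot> antichain_letter y"
proof (rule bilinear_eq_on_gen[of "\<lambda>x y. antichain_letter (ck_mult x y)"
      "\<lambda>x y. ck_counit x *\<^sub>R antichain_letter y + ck_counit y *\<^sub>R antichain_letter x
        + antichain_letter x \<odot> antichain_letter y"])
  show "bilinear (\<lambda>x y. antichain_letter (ck_mult x y))"
    by (intro bilinearI linear_comp[OF linear_antichain_letter] linear_ck_mult_left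
        linear_ck_mult_right linear_self)
  show "bilinear (\<lambda>x y. ck_counit x *\<^sub>R antichain_letter y + ck_counit y *\<^sub>R antichain_letter x
        + antichain_letter x \<odot> antichain_letter y)"
    by (intro bilinearI linear_plus linear_scaled linear_scaled_vec linear_odot_left
        linear_odot_right linear_ck_counit linear_antichain_letter)
  fix f g :: "'a forest"
  show "antichain_letter (ck_mult (gen f) (gen g)) = ck_counit (gen f) *\<^sub>R antichain_letter (gen g)
     + ck_counit (gen g) *\<^sub>R antichain_letter (gen f)
     + antichain_letter (gen f) \<odot> antichain_letter (gen g)"
  proof (cases "verts f = {} \<or> verts g = {}")
    case True
    then show ?thesis
      by (auto simp: gen_empty[of f] gen_empty[of g])
  next
    case False
    have "symmetric_product (map (dec (disjoint_union f g))
          (sorted_list_of_set (verts (disjoint_union f g))))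
        = symmetric_product (map (dec f) (sorted_list_of_set (verts f))
            @ map (dec g) (sorted_list_of_set (verts g)))"
    proof (rule symmetric_product_decorations)
      have "mset_set (union_verts (verts f) (verts g))
          = image_mset ((*) 2) (mset_set (verts f)) + image_mset (\<lambda>n. Suc (2 * n)) (mset_set (verts g))"
      proof -
        have "(*) 2 ` verts f \<inter> (\<lambda>n. Suc (2 * n)) ` verts g = {}"
          by (auto simp: parity_simps)
        then show ?thesis
          by (simp add: union_verts_def mset_set_Union image_mset_mset_set inj_on_def)
      qed
      then show "mset (map (dec f) (sorted_list_of_set (verts f))
            @ map (dec g) (sorted_list_of_set (verts g)))
          = image_mset (dec (disjoint_union f g)) (mset_set (verts (disjoint_union f g)))"
        unfolding mset_append mset_decorations
        by (simp add: disjoint_union_simps image_mset.compositionality o_def)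
    qed
    with False show ?thesis
      by (simp add: ck_mult_gen antichain_letter_gen ck_counit_gen disjoint_union_simps
          union_edges_empty_iff odot_symmetric_product)
  qed
qed

text \<open>As soon as both forests are nonempty, grafting creates an edge, and the letter vanishes.\<close>

lemma antichain_letter_growth:
  "antichain_letter (x \<top>\<^sub>n y)
     = ck_counit x *\<^sub>R antichain_letter y + ck_counit y *\<^sub>R antichain_letter x"
proof (rule bilinear_eq_on_gen[of "\<lambda>x y. antichain_letter (x \<top>\<^sub>n y)"
      "\<lambda>x y. ck_counit x *\<^sub>R antichain_letter y + ck_counit y *\<^sub>R antichain_letter x"])
  show "bilinear (\<lambda>x y. antichain_letter (x \<top>\<^sub>n y))"
    by (intro bilinearI linear_comp[OF linear_antichain_letter] linear_growth_left
        linear_growth_right linear_self)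
  show "bilinear (\<lambda>x y. ck_counit x *\<^sub>R antichain_letter y + ck_counit y *\<^sub>R antichain_letter x)"
    by (intro bilinearI linear_plus linear_scaled linear_scaled_vec linear_ck_counit
        linear_antichain_letter)
  fix f g :: "'a forest"
  show "antichain_letter (gen f \<top>\<^sub>n gen g)
     = ck_counit (gen f) *\<^sub>R antichain_letter (gen g) + ck_counit (gen g) *\<^sub>R antichain_letter (gen f)"
  proof (cases "verts f = {}")
    case True
    then show ?thesis
      by (simp add: gen_empty[of f])
  next
    case False
    then obtain r where "r \<in> verts f" "r \<notin> Domain (edges f)"
      by (rule root_exists)
    then have "edges (graft f v g) \<noteq> {}" if "v \<in> verts g" for v
      using that graft_edges_iff(3)[of r v f v g] by blast
    then have "antichain_letter (graft_sum (gen f) (gen g)) = 0"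
      by (simp add: graft_sum_gen linear_sum[OF linear_antichain_letter] antichain_letter_gen)
    with False show ?thesis
      by (simp add: natural_growth_eq inverse_degree_gen ck_counit_gen
          linear_add[OF linear_antichain_letter] linear_scale[OF linear_antichain_letter]
          linear_scale[OF linear_graft_sum_right[OF linear_self]])
  qed
qed

text \<open>The projection onto primitives subtracts products \<open>x' \<top> \<pi>(x'')\<close> whose factors both
  lie in the kernel of the counit, and these \<open>antichain_letter\<close> annihilates.\<close>

lemma antichain_letter_primitive_part: "antichain_letter (primitive_part x) = antichain_letter x"
proof -
  have "antichain_letter x = convolve (\<lambda>y z. antichain_letter (y \<top>\<^sub>n primitive_part z)) x"
    by (subst growth_expansion[of x, symmetric])
       (simp add: linear_add[OF linear_antichain_letter] linear_scale[OF linear_antichain_letter]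
         convolve_image[OF linear_antichain_letter bilinear_growth_primitive_part])
  also have "\<dots> = convolve (\<lambda>y z. ck_counit y *\<^sub>R antichain_letter (primitive_part z)) x"
    by (simp add: antichain_letter_growth counit_primitive primitive_part_in_primitives)
  also have "\<dots> = antichain_letter (primitive_part x)"
    by (intro convolve_counit_left linear_comp[OF linear_antichain_letter] linear_primitive_part)
  finally show ?thesis
    by simp
qed

abbreviation quasi_arborification :: "'u::real_vector forests \<Rightarrow> 'u quasi_words"
  where "quasi_arborification \<equiv> word_lift antichain_letter"

lemmas linear_quasi_arborification = linear_word_lift[OF linear_antichain_letter antichain_letter_unit]
lemmas quasi_arborification_unit = word_lift_unit[OF linear_antichain_letter antichain_letter_unit]
lemmas quasi_arborification_gen = word_lift_gen[OF linear_antichain_letter antichain_letter_unit]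

lemma add_root_edges_iff [simp]:
  "(Suc a, Suc b) \<in> edges (add_root \<gamma> f) \<longleftrightarrow> (a, b) \<in> edges f"
  "(Suc a, 0) \<in> edges (add_root \<gamma> f) \<longleftrightarrow> a \<in> verts f \<and> a \<notin> Domain (edges f)"
  "(0, b) \<notin> edges (add_root \<gamma> f)"
  by (auto simp: add_root_simps)

text \<open>The root of a tree is comparable to every other vertex, so it can only form a block by itself,
  and this has to be the last one.\<close>

lemma quasi_arborification_add_root:
  "quasi_arborification (gen (add_root \<gamma> f)) = snoc (quasi_arborification (gen f)) (letter \<gamma>)"
proof -
  let ?t = "add_root \<gamma> f"
  define T where "T A = snoc (quasi_arborification (gen (induced ?t A)))
      (antichain_letter (gen (induced ?t (verts ?t - A))))" for A
  have V: "Suc ` verts f \<in> upper_sets ?t"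
    using edges_in_verts[of _ _ f] by (auto simp: upper_sets_def add_root_simps)
  have "T A = 0" if A: "A \<in> upper_sets ?t" and neq: "A \<noteq> Suc ` verts f" for A
  proof -
    have "antichain_letter (gen (induced ?t (verts ?t - A))) = 0"
    proof (cases "edges (induced ?t (verts ?t - A)) = {}")
      case no_edges: True
      \<comment> \<open>Every vertex but the root has a parent. As no edge remains in the lower part, a vertex
        of \<open>f\<close> there would have its parent in \<open>A\<close>, against closure under descendants.\<close>
      have parent: "\<exists>w. (Suc a, w) \<in> edges ?t" if "a \<in> verts f" for a
        using that by (cases "a \<in> Domain (edges f)") (auto simp: add_root_simps)
      have "Suc a \<in> A" if a: "a \<in> verts f" for a
      proof (rule ccontr)
        assume notin: "Suc a \<notin> A"
        obtain w where w: "(Suc a, w) \<in> edges ?t"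
          using parent[OF a] by blast
        with A notin have "w \<notin> A"
          by (auto simp: upper_sets_def)
        with w notin edges_in_verts[OF w] no_edges show False
          by auto
      qed
      then have "A = verts ?t"
        using neq upper_set_subset[OF A] by (auto simp: add_root_simps)
      then show ?thesis
        by simp
    qed (simp add: antichain_letter_gen)
    then show ?thesis
      by (simp add: T_def)
  qed
  then have "(\<Sum>A\<in>upper_sets ?t. T A) = T (Suc ` verts f)"
    using V by (subst sum.mono_neutral_right[of _ "{Suc ` verts f}"]) auto
  moreover have "gen (induced ?t (Suc ` verts f)) = gen f"
  proof (rule gen_iso[symmetric])
    show "forest_iso f (induced ?t (Suc ` verts f))"
      unfolding forest_iso_iff iso_map_def
      by (rule exI[of _ Suc]) (auto simp: bij_betw_def add_root_simps)
  qed
  moreover have "antichain_letter (gen (induced ?t (verts ?t - Suc ` verts f))) = letter \<gamma>"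
  proof -
    have "verts ?t \<inter> (verts ?t - Suc ` verts f) = {0}"
      by (auto simp: add_root_simps)
    moreover have "edges ?t \<inter> {0} \<times> {0} = {}"
      by auto
    moreover have "verts ?t - Suc ` verts f = {0}"
      by (auto simp: add_root_simps)
    ultimately show ?thesis
      by (simp add: antichain_letter_gen letter_eq_symmetric_product add_root_simps(3))
  qed
  moreover have "ck_counit (gen ?t) = 0"
    by (simp add: ck_counit_gen add_root_simps)
  moreover have "quasi_arborification (gen ?t)
      = ck_counit (gen ?t) *\<^sub>R gen [] + (\<Sum>A\<in>upper_sets ?t. T A)"
    unfolding T_def by (rule quasi_arborification_gen)
  ultimately show ?thesis
    by (simp only: T_def) simp
qed

text \<open>The last block of a word in the image of a product of two forests comes from the first
  forest only, from the second only, or from both. These are the three terms in the recursion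
  of the quasi-shuffle product.\<close>

lemma quasi_arborification_mult:
  "quasi_arborification (ck_mult x y) = qsh_mult (quasi_arborification x) (quasi_arborification y)"
proof (rule bilinear_eq_on_gen[of "\<lambda>x y. quasi_arborification (ck_mult x y)"
      "\<lambda>x y. qsh_mult (quasi_arborification x) (quasi_arborification y)"])
  let ?a = "quasi_arborification" and ?\<rho> = "antichain_letter"
  fix f g :: "'a forest"
  show "?a (ck_mult (gen f) (gen g)) = qsh_mult (?a (gen f)) (?a (gen g))"
  proof (induction "card (verts f) + card (verts g)" arbitrary: f g rule: less_induct)
    case less
    show ?case
    proof (cases "verts f = {} \<or> verts g = {}")
      case True
      then show ?thesis
        by (auto simp: gen_empty[of f] gen_empty[of g] quasi_arborification_unit)
    next
      case False
      let ?f = "\<lambda>B. gen (induced f B)" and ?f' = "\<lambda>B. gen (induced f (verts f - B))"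
      let ?g = "\<lambda>C. gen (induced g C)" and ?g' = "\<lambda>C. gen (induced g (verts g - C))"
      let ?q = "\<lambda>B C. qsh_mult (?a (?f B)) (?a (?g C))"
      have a_f: "?a (gen f) = (\<Sum>B\<in>upper_sets f. snoc (?a (?f B)) (?\<rho> (?f' B)))"
        and a_g: "?a (gen g) = (\<Sum>C\<in>upper_sets g. snoc (?a (?g C)) (?\<rho> (?g' C)))"
        using False by (simp_all add: quasi_arborification_gen[of f] quasi_arborification_gen[of g]
            ck_counit_gen)
      note bil = bilinear_snoc_letter[OF linear_antichain_letter linear_quasi_arborification]
      have "?a (ck_mult (gen f) (gen g)) = convolve (\<lambda>y z. snoc (?a y) (?\<rho> z)) (gen (disjoint_union f g))"
        unfolding ck_mult_gen
        by (subst word_lift_eq[OF linear_antichain_letter antichain_letter_unit])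
           (use False in \<open>simp add: ck_counit_gen disjoint_union_simps union_verts_def\<close>)
      also have "\<dots> = (\<Sum>C\<in>upper_sets g. \<Sum>B\<in>upper_sets f.
          snoc (?a (ck_mult (?f B) (?g C))) (?\<rho> (ck_mult (?f' B) (?g' C))))"
        by (simp add: convolve_def ck_comult_disjoint_union linear_sum[OF linear_tensor_ext[OF bil]]
            tensor_ext_gen[OF bil] ck_mult_gen)
      also have "\<dots> = (\<Sum>C\<in>upper_sets g. \<Sum>B\<in>upper_sets f.
          snoc (?q B C) (?\<rho> (ck_mult (?f' B) (?g' C))))"
      proof (intro sum.cong refl)
        fix B C
        assume B: "B \<in> upper_sets f" and C: "C \<in> upper_sets g"
        show "snoc (?a (ck_mult (?f B) (?g C))) (?\<rho> (ck_mult (?f' B) (?g' C)))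
            = snoc (?q B C) (?\<rho> (ck_mult (?f' B) (?g' C)))"
        proof (cases "B = verts f \<and> C = verts g")
          case False
          then have "card (verts (induced f B)) + card (verts (induced g C))
              < card (verts f) + card (verts g)"
            using card_upper_less[OF B] card_upper_less[OF C]
            by (cases "B = verts f"; cases "C = verts g") auto
          then show ?thesis
            by (simp only: less)
        qed simp
      qed
      also have "\<dots> = (\<Sum>C\<in>upper_sets g. \<Sum>B\<in>upper_sets f. ck_counit (?f' B) *\<^sub>R snoc (?q B C) (?\<rho> (?g' C)))
          + (\<Sum>C\<in>upper_sets g. \<Sum>B\<in>upper_sets f. ck_counit (?g' C) *\<^sub>R snoc (?q B C) (?\<rho> (?f' B)))
          + (\<Sum>C\<in>upper_sets g. \<Sum>B\<in>upper_sets f. snoc (?q B C) (?\<rho> (?f' B) \<odot> ?\<rho> (?g' C)))"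
        by (simp add: antichain_letter_mult linear_add[OF linear_snoc_right[OF linear_self]]
            linear_scale[OF linear_snoc_right[OF linear_self]] sum.distrib)
      also have "(\<Sum>C\<in>upper_sets g. \<Sum>B\<in>upper_sets f. ck_counit (?f' B) *\<^sub>R snoc (?q B C) (?\<rho> (?g' C)))
          = (\<Sum>C\<in>upper_sets g. snoc (qsh_mult (?a (gen f)) (?a (?g C))) (?\<rho> (?g' C)))"
        by (intro sum.cong refl sum_counit_lower linear_snoc_left linear_qsh_mult_left
            linear_quasi_arborification)
      also have "\<dots> = (\<Sum>C\<in>upper_sets g. \<Sum>B\<in>upper_sets f.
          snoc (qsh_mult (snoc (?a (?f B)) (?\<rho> (?f' B))) (?a (?g C))) (?\<rho> (?g' C)))"
        by (simp add: a_f linear_sum[OF linear_qsh_mult_left[OF linear_self]]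
            linear_sum[OF linear_snoc_left[OF linear_self]])
      also have "(\<Sum>C\<in>upper_sets g. \<Sum>B\<in>upper_sets f. ck_counit (?g' C) *\<^sub>R snoc (?q B C) (?\<rho> (?f' B)))
          = (\<Sum>B\<in>upper_sets f. \<Sum>C\<in>upper_sets g. ck_counit (?g' C) *\<^sub>R snoc (?q B C) (?\<rho> (?f' B)))"
        by (rule sum.swap)
      also have "\<dots> = (\<Sum>B\<in>upper_sets f. snoc (qsh_mult (?a (?f B)) (?a (gen g))) (?\<rho> (?f' B)))"
        by (intro sum.cong refl sum_counit_lower linear_snoc_left linear_qsh_mult_right
            linear_quasi_arborification)
      also have "\<dots> = (\<Sum>B\<in>upper_sets f. \<Sum>C\<in>upper_sets g.
          snoc (qsh_mult (?a (?f B)) (snoc (?a (?g C)) (?\<rho> (?g' C)))) (?\<rho> (?f' B)))"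
        by (simp add: a_g linear_sum[OF linear_qsh_mult_right[OF linear_self]]
            linear_sum[OF linear_snoc_left[OF linear_self]])
      also have "\<dots> = (\<Sum>C\<in>upper_sets g. \<Sum>B\<in>upper_sets f.
          snoc (qsh_mult (?a (?f B)) (snoc (?a (?g C)) (?\<rho> (?g' C)))) (?\<rho> (?f' B)))"
        by (rule sum.swap)
      finally have "?a (ck_mult (gen f) (gen g)) = (\<Sum>C\<in>upper_sets g. \<Sum>B\<in>upper_sets f.
          qsh_mult (snoc (?a (?f B)) (?\<rho> (?f' B))) (snoc (?a (?g C)) (?\<rho> (?g' C))))"
        by (simp add: qsh_mult_snoc sum.distrib add_ac)
      then show ?thesis
        by (simp add: a_f a_g linear_sum[OF linear_qsh_mult_left[OF linear_self]]
            linear_sum[OF linear_qsh_mult_right[OF linear_self]]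
            sum.swap[of _ "upper_sets f" "upper_sets g"])
    qed
  qed
qed (intro bilinearI linear_comp[OF linear_quasi_arborification] linear_ck_mult_left
    linear_ck_mult_right linear_qsh_mult_left linear_qsh_mult_right linear_quasi_arborification
    linear_self)+

lemma algebra_morphism_quasi_arborification: "algebra_morphism CK QSh quasi_arborification"
  by (simp add: algebra_morphism_def CK_def QSh_def linear_quasi_arborification
      quasi_arborification_unit quasi_arborification_mult)

lemma quasi_arborification_rec: "quasi_arborification_rec quasi_arborification"
  by (simp add: quasi_arborification_rec_def quasi_arborification_add_root)

subsection \<open>Uniqueness\<close>

text \<open>The vertices from which a fixed root is reached by passing to parents form a tree that no
  edge connects to the other vertices. So the trees \<open>[f]\<^sub>\<gamma>\<close> generate the algebra.\<close>

lemma forest_decomposition: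
  fixes f :: "'u::real_vector forest"
  assumes "verts f \<noteq> {}"
  obtains \<gamma> f1 f2 where "gen f = ck_mult (gen (add_root \<gamma> f1)) (gen f2)"
    "card (verts f1) < card (verts f)" "card (verts f2) < card (verts f)"
proof -
  obtain r where r: "r \<in> verts f" and root: "r \<notin> Domain (edges f)"
    using root_exists[OF assms] .
  define D where "D = {v \<in> verts f. (v, r) \<in> (edges f)\<^sup>*}"
  define f1 where "f1 = induced f (D - {r})"
  define f2 where "f2 = induced f (verts f - D)"
  \<comment> \<open>In the encoding of \<open>disjoint_union\<close> and \<open>add_root\<close> the new root is \<open>2 * 0\<close>, the other
    vertices of the first factor are \<open>2 * Suc v\<close>, and those of the second are odd.\<close>
  define h where "h v = (if v = r then 0 else if v \<in> D then 2 * Suc v else Suc (2 * v))" for v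
  have D: "D \<subseteq> verts f" "r \<in> D"
    using r by (auto simp: D_def)
  have edge: "v \<noteq> r \<and> (v \<in> D \<longleftrightarrow> w \<in> D)" if e: "(v, w) \<in> edges f" for v w
  proof
    show "v \<noteq> r"
      using root e by auto
    show "v \<in> D \<longleftrightarrow> w \<in> D"
    proof
      assume "v \<in> D"
      then have "(v, r) \<in> (edges f)\<^sup>*"
        by (simp add: D_def)
      then obtain w' where "(v, w') \<in> edges f" "(w', r) \<in> (edges f)\<^sup>*"
        using \<open>v \<noteq> r\<close> by (meson converse_rtranclE)
      moreover from this(1) have "w' = w"
        using e single_valued_edges[of f] by (auto dest: single_valuedD)
      ultimately show "w \<in> D"
        using edges_in_verts[OF e] by (simp add: D_def)
    next
      assume "w \<in> D"
      then show "v \<in> D"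
        using e edges_in_verts[OF e] by (auto simp: D_def intro: converse_rtrancl_into_rtrancl)
    qed
  qed
  have root_of_f1: "(v, r) \<in> edges f \<longleftrightarrow> v \<in> verts f1 \<and> v \<notin> Domain (edges f1)"
    if v: "v \<in> D" "v \<noteq> r" for v
  proof
    assume "(v, r) \<in> edges f"
    then have "w = r" if "(v, w) \<in> edges f" for w
      using that single_valued_edges[of f] by (auto dest: single_valuedD)
    with v D show "v \<in> verts f1 \<and> v \<notin> Domain (edges f1)"
      by (auto simp: f1_def)
  next
    assume *: "v \<in> verts f1 \<and> v \<notin> Domain (edges f1)"
    have "(v, r) \<in> (edges f)\<^sup>*"
      using v by (simp add: D_def)
    then obtain w where w: "(v, w) \<in> edges f"
      using v by (meson converse_rtranclE)
    have "w = r"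
    proof (rule ccontr)
      assume "w \<noteq> r"
      with w v edge[OF w] have "(v, w) \<in> edges f1"
        by (simp add: f1_def)
      with * show False
        by auto
    qed
    with w show "(v, r) \<in> edges f"
      by simp
  qed
  let ?g = "disjoint_union (add_root (dec f r) f1) f2"
  have "iso_map h f ?g"
    unfolding iso_map_def
  proof (intro conjI ballI)
    have "inj_on h (verts f)"
      by (auto simp: inj_on_def h_def parity_simps split: if_splits; presburger)
    moreover have "h ` verts f = verts ?g"
    proof -
      have "verts f = insert r ((D - {r}) \<union> (verts f - D))"
        using D by auto
      then have "h ` verts f = insert (h r) (h ` (D - {r}) \<union> h ` (verts f - D))"
        by (metis image_Un image_insert)
      also have "h ` (D - {r}) = (\<lambda>v. 2 * Suc v) ` (D - {r})"
        by (rule image_cong) (auto simp: h_def)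
      also have "h ` (verts f - D) = (\<lambda>v. Suc (2 * v)) ` (verts f - D)"
        using D by (intro image_cong) (auto simp: h_def)
      also have "h r = 0"
        by (simp add: h_def)
      also have "insert 0 ((\<lambda>v. 2 * Suc v) ` (D - {r}) \<union> (\<lambda>v. Suc (2 * v)) ` (verts f - D)) = verts ?g"
      proof -
        have "verts f1 = D - {r}" "verts f2 = verts f - D"
          using D by (auto simp: f1_def f2_def)
        then show ?thesis
          by (simp add: disjoint_union_simps add_root_simps union_verts_def image_image)
      qed
      finally show ?thesis .
    qed
    ultimately show "bij_betw h (verts f) (verts ?g)"
      by (simp add: bij_betw_def)
    show "(v, w) \<in> edges f \<longleftrightarrow> (h v, h w) \<in> edges ?g" if vw: "v \<in> verts f" "w \<in> verts f" for v w
    proof -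
      have h_r: "h r = 2 * 0"
        by (simp add: h_def)
      have h_D: "h v = 2 * Suc v" if "v \<in> D - {r}" for v
        using that by (simp add: h_def)
      have h_other: "h v = Suc (2 * v)" if "v \<notin> D" for v
        using that D by (auto simp: h_def)
      consider "v = r" | "v \<in> D - {r}" "w = r" | "v \<in> D - {r}" "w \<in> D - {r}" | "v \<in> D - {r}" "w \<notin> D"
        | "v \<notin> D" "w = r" | "v \<notin> D" "w \<in> D - {r}" | "v \<notin> D" "w \<notin> D"
        by blast
      then show ?thesis
      proof cases
        case 1
        have "(h r, h w) \<notin> edges ?g"
          unfolding h_r disjoint_union_simps
          by (cases "h w" rule: nat_parity_cases) (simp_all only: union_edges_iff add_root_edges_iff not_False_eq_True)
        with 1 edge[of r w] show ?thesis
          by auto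
      next
        case 2
        then show ?thesis
          using root_of_f1[of v] unfolding h_D[OF 2(1)] disjoint_union_simps 2(2) h_r
          by (simp only: union_edges_iff add_root_edges_iff) simp
      next
        case 3
        then show ?thesis
          unfolding h_D[OF 3(1)] h_D[OF 3(2)] disjoint_union_simps union_edges_iff add_root_edges_iff
          by (simp add: f1_def)
      next
        case 4
        then show ?thesis
          using edge[of v w] unfolding h_D[OF 4(1)] h_other[OF 4(2)] disjoint_union_simps
          by (simp only: union_edges_iff) auto
      next
        case 5
        then show ?thesis
          using edge[of v w] D unfolding h_other[OF 5(1)] 5(2) h_r disjoint_union_simps
          by (simp only: union_edges_iff) auto
      next
        case 6
        then show ?thesis
          using edge[of v w] unfolding h_other[OF 6(1)] h_D[OF 6(2)] disjoint_union_simps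
          by (simp only: union_edges_iff) auto
      next
        case 7
        then show ?thesis
          using vw unfolding h_other[OF 7(1)] h_other[OF 7(2)] disjoint_union_simps
          by (simp only: union_edges_iff) (simp add: f2_def)
      qed
    qed
    show "dec ?g (h v) = dec f v" if "v \<in> verts f" for v
      using D by (auto simp: h_def disjoint_union_simps add_root_simps union_dec_def f1_def f2_def
          split: nat.split)
  qed
  then have "gen f = ck_mult (gen (add_root (dec f r) f1)) (gen f2)"
    unfolding ck_mult_gen by (intro gen_iso) (auto simp: forest_iso_iff)
  moreover have "card (verts f1) < card (verts f)" "card (verts f2) < card (verts f)"
    using r D by (auto simp: f1_def f2_def intro!: psubset_card_mono)
  ultimately show ?thesis
    by (rule that)
qed

lemma quasi_arborification_unique:
  assumes alg: "algebra_morphism CK QSh a" and rec: "quasi_arborification_rec a"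
  shows "a = quasi_arborification"
proof
  fix x
  have lin: "linear a" and unit: "a (gen empty_forest) = gen []"
    and mult: "\<And>x y. a (ck_mult x y) = qsh_mult (a x) (a y)"
    using alg by (auto simp: algebra_morphism_def CK_def QSh_def)
  show "a x = quasi_arborification x"
  proof (rule linear_eq_on_gen[OF lin linear_quasi_arborification])
    fix f :: "'a forest"
    show "a (gen f) = quasi_arborification (gen f)"
    proof (induction f rule: forest_induct_card)
      case (1 f)
      show ?case
      proof (cases "verts f = {}")
        case True
        then show ?thesis
          by (simp add: gen_empty[of f] unit quasi_arborification_unit)
      next
        case False
        obtain \<gamma> f1 f2 where f: "gen f = ck_mult (gen (add_root \<gamma> f1)) (gen f2)"
          "card (verts f1) < card (verts f)" "card (verts f2) < card (verts f)"
          using forest_decomposition[OF False] .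
        have "a (gen (add_root \<gamma> f1)) = snoc (a (gen f1)) (letter \<gamma>)"
          using rec by (simp add: quasi_arborification_rec_def)
        then show ?thesis
          by (simp add: f(1) mult quasi_arborification_mult quasi_arborification_add_root
              1[OF f(2)] 1[OF f(3)])
      qed
    qed
  qed
qed

subsection \<open>Antipodes\<close>

text \<open>The antipode equation at a forest \<open>f\<close> determines the antipode of \<open>f\<close> from those of the
  proper upper parts of \<open>f\<close>. Pushed forward to words, it is an equation that both composites
  satisfy, and it determines them by induction.\<close>

lemma quasi_arborification_antipode:
  assumes S: "antipode CK S" and T: "antipode QSh T"
  shows "quasi_arborification \<circ> S = T \<circ> quasi_arborification"
proof
  fix x
  let ?a = quasi_arborification
  have linS: "linear S" and linT: "linear T"
    using S T by (auto simp: antipode_def)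
  have bilS: "bilinear (\<lambda>y z. ck_mult (S y) z)"
    by (intro bilinear_comp[OF bilinear_ck_mult] linS linear_self)
  have bilT: "bilinear (\<lambda>y z. qsh_mult (T y) z)"
    by (intro bilinear_comp[OF bilinear_qsh_mult] linT linear_self)
  have bil1: "bilinear (\<lambda>y z. qsh_mult (?a (S y)) (?a z))"
    by (intro bilinear_comp[OF bilinear_qsh_mult] linear_comp[OF linear_quasi_arborification]
        linear_quasi_arborification linS)
  have bil2: "bilinear (\<lambda>y z. qsh_mult (T (?a y)) (?a z))"
    by (intro bilinear_comp[OF bilinear_qsh_mult] linear_comp[OF linT] linear_quasi_arborification)
  note bil_a = bilinear_word_lift_tensor[OF linear_antichain_letter antichain_letter_unit]
  have eq1: "convolve (\<lambda>y z. qsh_mult (?a (S y)) (?a z)) x = ck_counit x *\<^sub>R gen []" for x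
  proof -
    have "convolve (\<lambda>y z. ck_mult (S y) z) x = ck_counit x *\<^sub>R gen empty_forest"
      using S by (simp add: antipode_def CK_def convolve_def)
    then have "?a (convolve (\<lambda>y z. ck_mult (S y) z) x) = ck_counit x *\<^sub>R gen []"
      by (simp add: linear_scale[OF linear_quasi_arborification] quasi_arborification_unit)
    then show ?thesis
      by (simp add: convolve_image[OF linear_quasi_arborification bilS] quasi_arborification_mult)
  qed
  have eq2: "convolve (\<lambda>y z. qsh_mult (T (?a y)) (?a z)) x = ck_counit x *\<^sub>R gen []" for x
  proof -
    have "lin_ext (\<lambda>(y, z). qsh_mult (T y) z) (deconcatenation (?a x))
        = empty_word_coeff (?a x) *\<^sub>R gen []"
      using T by (simp add: antipode_def QSh_def)
    then show ?thesis
      by (simp add: deconcatenation_word_lift[OF linear_antichain_letter antichain_letter_unit]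
          convolve_image[OF linear_tensor_ext[OF bilT] bil_a] tensor_ext_gen[OF bilT]
          empty_word_coeff_word_lift[OF linear_antichain_letter antichain_letter_unit])
  qed
  have "?a (S x) = T (?a x)"
  proof (rule linear_eq_on_gen[OF linear_comp[OF linear_quasi_arborification linS]
        linear_comp[OF linT linear_quasi_arborification]])
    fix f :: "'a forest"
    show "?a (S (gen f)) = T (?a (gen f))"
    proof (induction f rule: forest_induct_card)
      case (1 f)
      let ?l = "\<lambda>A. gen (induced f A)" and ?r = "\<lambda>A. gen (induced f (verts f - A))"
      have "(\<Sum>A\<in>upper_sets f. qsh_mult (?a (S (?l A))) (?a (?r A)))
          = (\<Sum>A\<in>upper_sets f. qsh_mult (T (?a (?l A))) (?a (?r A)))"
        using eq1[of "gen f"] eq2[of "gen f"] by (simp add: convolve_gen[OF bil1] convolve_gen[OF bil2])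
      moreover have "(\<Sum>A\<in>upper_sets f - {verts f}. qsh_mult (?a (S (?l A))) (?a (?r A)))
          = (\<Sum>A\<in>upper_sets f - {verts f}. qsh_mult (T (?a (?l A))) (?a (?r A)))"
      proof (rule sum.cong[OF refl])
        fix A assume "A \<in> upper_sets f - {verts f}"
        then have "card (verts (induced f A)) < card (verts f)"
          by (intro card_upper_less) auto
        then show "qsh_mult (?a (S (?l A))) (?a (?r A)) = qsh_mult (T (?a (?l A))) (?a (?r A))"
          by (simp only: 1)
      qed
      ultimately show ?case
        by (simp add: sum.remove[of "upper_sets f" "verts f"] quasi_arborification_unit)
    qed
  qed
  then show "(?a \<circ> S) x = (T \<circ> ?a) x"
    by simp
qed

lemma hopf_morphism_quasi_arborification: "hopf_morphism CK QSh quasi_arborification"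
proof -
  have "coalgebra_morphism CK QSh quasi_arborification"
    by (simp add: coalgebra_morphism_def linear_quasi_arborification CK_def QSh_def
        empty_word_coeff_word_lift[OF linear_antichain_letter antichain_letter_unit]
        deconcatenation_word_lift[OF linear_antichain_letter antichain_letter_unit]
        convolve_def tensor_map_def)
  then show ?thesis
    by (simp add: hopf_morphism_def algebra_morphism_quasi_arborification
        quasi_arborification_antipode)
qed

section \<open>The right inverse\<close>

lemma gen_isolated_permute:
  assumes "mset xs = mset ys"
  shows "gen (isolated xs) = gen (isolated ys)"
proof -
  obtain p where p: "p permutes {..<length ys}" "permute_list p ys = xs"
    using mset_eq_permutation[OF assms] .
  have "length xs = length ys"
    using assms by (rule mset_eq_length)
  then have "iso_map p (isolated xs) (isolated ys)"
    using p permute_list_nth[OF p(1)] by (auto simp: iso_map_def permutes_imp_bij)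
  then show ?thesis
    by (intro gen_iso) (auto simp: forest_iso_iff)
qed

lemma linear_gen_isolated: "linear (\<lambda>x. gen (isolated (us @ x # vs)))"
proof -
  have "gen (isolated (us @ x # vs)) = gen (dec_update (isolated (us @ 0 # vs)) (length us) x)"
    for x :: 'a
    by (rule arg_cong[of _ _ gen], rule forest_eqI) (auto simp: nth_append nth_Cons' fun_eq_iff)
  then have eq: "(\<lambda>x :: 'a. gen (isolated (us @ x # vs)))
      = (\<lambda>x. gen (dec_update (isolated (us @ 0 # vs)) (length us) x))"
    by (rule ext)
  show ?thesis
    unfolding eq by (rule linear_gen_dec_update) simp
qed

text \<open>The forest of isolated vertices depends linearly on each decoration, and permuting the
  decorations gives an isomorphic forest.\<close>

lemma respectful_iota_letter:
  "respectful (\<lambda>\<gamma>s. primitive_projection (gen (isolated (Rep_nelist \<gamma>s))))"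
  unfolding respectful_nelist primitive_projection_eq
  by (auto simp: Abs_nelist_inverse intro!: arg_cong[of _ _ primitive_part] gen_isolated_permute
      linear_comp[OF linear_primitive_part] linear_gen_isolated)

lemma linear_iota_letter: "linear iota_letter"
  unfolding iota_letter_def by (rule linear_ext[OF respectful_iota_letter])

lemma iota_letter_gen: "iota_letter (gen \<gamma>s) = primitive_part (gen (isolated (Rep_nelist \<gamma>s)))"
  unfolding iota_letter_def ext_gen[OF respectful_iota_letter] by (rule primitive_projection_eq)

lemma iota_letter_symmetric_product:
  "iota_letter (symmetric_product xs) = primitive_part (gen (isolated xs))"
proof (cases "xs = []")
  case True
  then have "gen (isolated xs) = gen empty_forest"
    by (intro gen_empty) simp
  then have "primitive_part (gen (isolated xs)) = 0"
    by simp
  with True show ?thesis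
    by (simp add: linear_0[OF linear_iota_letter])
next
  case False
  then show ?thesis
    by (simp add: symmetric_product_def iota_letter_gen Abs_nelist_inverse)
qed

lemma iota_letter_in_primitives: "iota_letter s \<in> primitives"
proof -
  obtain A c where "finite A" "s = (\<Sum>\<gamma>s\<in>A. c \<gamma>s *\<^sub>R gen \<gamma>s)"
    by (rule presented_eq_sum_gen)
  then show ?thesis
    by (simp add: linear_sum[OF linear_iota_letter] linear_scale[OF linear_iota_letter]
        iota_letter_gen subspace_sum[OF subspace_primitives] subspace_scale[OF subspace_primitives]
        primitive_part_in_primitives)
qed

lemma antichain_letter_iota_letter: "antichain_letter (iota_letter s) = s"
  by (rule symmetric_linear_eqI[OF linear_comp[OF linear_antichain_letter linear_iota_letter]
        linear_self])
     (simp add: iota_letter_symmetric_product antichain_letter_primitive_part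
       antichain_letter_isolated)

lemma multilinear_iota: "multilinear (\<lambda>w. growth_word (map iota_letter w))"
  by (rule multilinearI) (simp add: linear_slot[OF multilinear_growth_word linear_iota_letter])

lemma linear_iota: "linear iota"
  unfolding iota_def by (rule linear_word_ext[OF multilinear_iota])

lemma iota_gen: "iota (gen w) = growth_word (map iota_letter w)"
  unfolding iota_def by (rule word_ext_gen[OF multilinear_iota])

lemma quasi_arborification_iota: "quasi_arborification (iota x) = x"
proof (rule linear_eq_on_gen[OF linear_comp[OF linear_quasi_arborification linear_iota] linear_self])
  fix w :: "'a symmetric list"
  have "quasi_arborification (growth_word (map iota_letter w))
      = gen (map antichain_letter (map iota_letter w))"
    by (rule word_lift_growth_word[OF linear_antichain_letter antichain_letter_unit])
       (auto simp: antichain_letter_growth counit_primitive iota_letter_in_primitives)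
  then show "quasi_arborification (iota (gen w)) = gen w"
    by (simp add: iota_gen antichain_letter_iota_letter o_def)
qed

lemma coalgebra_morphism_iota: "coalgebra_morphism QSh CK iota"
proof -
  have "ck_counit (iota x) = empty_word_coeff x" for x :: "'a quasi_words"
  proof (rule linear_eq_on_gen[OF linear_comp[OF linear_ck_counit linear_iota]
        linear_empty_word_coeff])
    show "ck_counit (iota (gen w)) = empty_word_coeff (gen w)" for w :: "'a symmetric list"
      by (cases w rule: rev_cases) (simp_all add: iota_gen growth_word_snoc ck_counit_growth
          counit_primitive iota_letter_in_primitives empty_word_coeff_gen)
  qed
  moreover have "ck_comult (iota x) = tensor_map iota iota (deconcatenation x)"
    for x :: "'a quasi_words"
  proof (rule linear_eq_on_gen[OF linear_comp[OF linear_ck_comult linear_iota]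
        linear_comp[OF linear_tensor_map[OF linear_iota linear_iota] linear_deconcatenation]])
    fix w :: "'a symmetric list"
    have "set (map iota_letter w) \<subseteq> primitives"
      by (auto simp: iota_letter_in_primitives)
    then show "ck_comult (iota (gen w)) = tensor_map iota iota (deconcatenation (gen w))"
      by (simp add: iota_gen ck_comult_growth_word deconcatenation_gen take_map drop_map
          linear_sum[OF linear_tensor_map[OF linear_iota linear_iota]]
          tensor_map_tensor[OF linear_iota linear_iota])
  qed
  ultimately show ?thesis
    by (simp add: coalgebra_morphism_def linear_iota CK_def QSh_def)
qed

section \<open>Naturality\<close>

text \<open>Relabelling changes neither the cuts nor the grafts of a forest, hence it commutes with
  everything that is defined from these recursively.\<close>

lemma induced_redecorate: "induced (redecorate \<phi> f) A = redecorate \<phi> (induced f A)"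
  by (rule forest_eqI) auto

lemma graft_redecorate:
  "graft (redecorate \<phi> f) v (redecorate \<phi> g) = redecorate \<phi> (graft f v g)"
  by (rule forest_eqI) (auto simp: graft_simps union_dec_def fun_eq_iff)

lemma upper_sets_redecorate [simp]: "upper_sets (redecorate \<phi> f) = upper_sets f"
  by (simp add: upper_sets_def)

context
  fixes \<phi> :: "'u::real_vector \<Rightarrow> 'v::real_vector"
  assumes \<phi>: "linear \<phi>"
begin

lemma respectful_redecorate: "respectful (\<lambda>f. gen (redecorate \<phi> f))"
  unfolding respectful_forest
proof (intro conjI allI impI)
  fix f :: "'u forest" and v
  assume "v \<in> verts f"
  then have "linear (\<lambda>x. gen (dec_update (redecorate \<phi> f) v (\<phi> x)))"
    by (intro linear_comp[OF linear_gen_dec_update \<phi>]) simp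
  moreover have "redecorate \<phi> (dec_update f v x) = dec_update (redecorate \<phi> f) v (\<phi> x)" for x
    by (rule forest_eqI) (auto simp: fun_eq_iff)
  ultimately show "linear (\<lambda>x. gen (redecorate \<phi> (dec_update f v x)))"
    by simp
next
  fix f g :: "'u forest"
  assume "forest_iso f g"
  then show "gen (redecorate \<phi> f) = gen (redecorate \<phi> g)"
    by (intro gen_iso) (auto simp: forest_iso_def)
qed

lemma linear_relabel: "linear (relabel \<phi>)"
  unfolding relabel_def by (rule linear_ext[OF respectful_redecorate])

lemma relabel_gen: "relabel \<phi> (gen f) = gen (redecorate \<phi> f)"
  unfolding relabel_def by (rule ext_gen[OF respectful_redecorate])

lemma relabel_unit: "relabel \<phi> (gen empty_forest) = gen empty_forest"
  unfolding relabel_gen by (rule gen_empty) simp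

lemma relabel_inverse_degree: "relabel \<phi> (inverse_degree x) = inverse_degree (relabel \<phi> x)"
  by (rule linear_eq_on_gen[OF linear_comp[OF linear_relabel linear_inverse_degree]
        linear_comp[OF linear_inverse_degree linear_relabel]])
     (simp add: relabel_gen inverse_degree_gen linear_scale[OF linear_relabel])

lemma relabel_graft_sum: "relabel \<phi> (graft_sum x y) = graft_sum (relabel \<phi> x) (relabel \<phi> y)"
proof (rule bilinear_eq_on_gen[of "\<lambda>x y. relabel \<phi> (graft_sum x y)"
      "\<lambda>x y. graft_sum (relabel \<phi> x) (relabel \<phi> y)"])
  show "relabel \<phi> (graft_sum (gen f) (gen g)) = graft_sum (relabel \<phi> (gen f)) (relabel \<phi> (gen g))"
    for f g
    by (simp add: graft_sum_gen relabel_gen linear_sum[OF linear_relabel] graft_redecorate)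
qed (intro bilinearI linear_comp[OF linear_relabel] linear_graft_sum_left linear_graft_sum_right
    linear_relabel linear_self)+

lemma counit_relabel: "ck_counit (relabel \<phi> x) = ck_counit x"
  by (rule linear_eq_on_gen[OF linear_comp[OF linear_ck_counit linear_relabel] linear_ck_counit])
     (simp add: relabel_gen ck_counit_gen)

lemma relabel_growth: "relabel \<phi> (x \<top>\<^sub>n y) = relabel \<phi> x \<top>\<^sub>n relabel \<phi> y"
  by (simp add: natural_growth_eq linear_add[OF linear_relabel] linear_scale[OF linear_relabel]
      relabel_graft_sum relabel_inverse_degree counit_relabel)

lemma relabel_primitive_part: "relabel \<phi> (primitive_part x) = primitive_part (relabel \<phi> x)"
proof (rule linear_eq_on_gen[OF linear_comp[OF linear_relabel linear_primitive_part]
      linear_comp[OF linear_primitive_part linear_relabel]])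
  fix f
  show "relabel \<phi> (primitive_part (gen f)) = primitive_part (relabel \<phi> (gen f))"
  proof (induction f rule: forest_induct_card)
    case (1 f)
    let ?\<pi> = "primitive_part" and ?r = "relabel \<phi>"
    let ?u = "\<lambda>A. gen (induced f A)" and ?l = "\<lambda>A. gen (induced f (verts f - A))"
    have e1: "?r (gen f) = ck_counit (gen f) *\<^sub>R gen empty_forest
        + (\<Sum>A\<in>upper_sets f. ?r (?u A) \<top>\<^sub>n ?r (?\<pi> (?l A)))"
      by (subst growth_expansion[of "gen f", symmetric])
         (simp add: convolve_gen[OF bilinear_growth_primitive_part] linear_add[OF linear_relabel]
           linear_scale[OF linear_relabel] linear_sum[OF linear_relabel] relabel_growth relabel_unit)
    have e2: "?r (gen f) = ck_counit (gen f) *\<^sub>R gen empty_forest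
        + (\<Sum>A\<in>upper_sets f. ?r (?u A) \<top>\<^sub>n ?\<pi> (?r (?l A)))"
      using growth_expansion[of "gen (redecorate \<phi> f)"]
      by (simp add: convolve_gen[OF bilinear_growth_primitive_part] relabel_gen
          induced_redecorate ck_counit_gen)
    have "(\<Sum>A\<in>upper_sets f. ?r (?u A) \<top>\<^sub>n ?r (?\<pi> (?l A)))
        = (\<Sum>A\<in>upper_sets f. ?r (?u A) \<top>\<^sub>n ?\<pi> (?r (?l A)))"
      using trans[OF sym[OF e1] e2] by (simp only: add_left_cancel)
    moreover have "(\<Sum>A\<in>upper_sets f - {{}}. ?r (?u A) \<top>\<^sub>n ?r (?\<pi> (?l A)))
        = (\<Sum>A\<in>upper_sets f - {{}}. ?r (?u A) \<top>\<^sub>n ?\<pi> (?r (?l A)))"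
    proof (rule sum.cong[OF refl])
      fix A assume "A \<in> upper_sets f - {{}}"
      then have "card (verts (induced f (verts f - A))) < card (verts f)"
        by (intro card_lower_less) auto
      then show "?r (?u A) \<top>\<^sub>n ?r (?\<pi> (?l A)) = ?r (?u A) \<top>\<^sub>n ?\<pi> (?r (?l A))"
        by (simp only: 1)
    qed
    ultimately show ?case
      by (simp add: sum.remove[of "upper_sets f" "{}"] relabel_unit)
  qed
qed

lemma antichain_letter_relabel:
  "antichain_letter (relabel \<phi> x) = symmetric_map \<phi> (antichain_letter x)"
  by (rule linear_eq_on_gen[OF linear_comp[OF linear_antichain_letter linear_relabel]
        linear_comp[OF linear_symmetric_map[OF \<phi>] linear_antichain_letter]])
     (simp add: relabel_gen antichain_letter_gen symmetric_map_product[OF \<phi>]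
       linear_0[OF linear_symmetric_map[OF \<phi>]])

lemma quasi_arborification_relabel:
  "quasi_arborification (relabel \<phi> x) = quasi_map \<phi> (quasi_arborification x)"
proof (rule linear_eq_on_gen[OF linear_comp[OF linear_quasi_arborification linear_relabel]
      linear_comp[OF linear_quasi_map[OF \<phi>] linear_quasi_arborification]])
  fix f
  show "quasi_arborification (relabel \<phi> (gen f)) = quasi_map \<phi> (quasi_arborification (gen f))"
  proof (induction f rule: forest_induct_card)
    case (1 f)
    let ?u = "\<lambda>A. gen (induced f A)" and ?l = "\<lambda>A. gen (induced f (verts f - A))"
    have "quasi_arborification (relabel \<phi> (gen f)) = ck_counit (gen f) *\<^sub>R gen []
        + (\<Sum>A\<in>upper_sets f. snoc (quasi_arborification (relabel \<phi> (?u A)))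
            (antichain_letter (relabel \<phi> (?l A))))"
      by (simp add: relabel_gen quasi_arborification_gen[of "redecorate \<phi> f"] induced_redecorate
          ck_counit_gen)
    also have "(\<Sum>A\<in>upper_sets f. snoc (quasi_arborification (relabel \<phi> (?u A)))
            (antichain_letter (relabel \<phi> (?l A))))
        = (\<Sum>A\<in>upper_sets f. snoc (quasi_map \<phi> (quasi_arborification (?u A)))
            (antichain_letter (relabel \<phi> (?l A))))"
    proof (intro sum.cong refl)
      fix A assume A: "A \<in> upper_sets f"
      show "snoc (quasi_arborification (relabel \<phi> (?u A))) (antichain_letter (relabel \<phi> (?l A)))
          = snoc (quasi_map \<phi> (quasi_arborification (?u A))) (antichain_letter (relabel \<phi> (?l A)))"
      proof (cases "A = verts f")
        case False
        show ?thesis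
          by (simp only: 1[OF card_upper_less[OF A False]])
      qed (simp add: relabel_unit)
    qed
    also have "ck_counit (gen f) *\<^sub>R gen [] + \<dots> = quasi_map \<phi> (quasi_arborification (gen f))"
      by (simp add: quasi_arborification_gen[of f] linear_add[OF linear_quasi_map[OF \<phi>]]
          linear_scale[OF linear_quasi_map[OF \<phi>]] linear_sum[OF linear_quasi_map[OF \<phi>]]
          quasi_map_snoc[OF \<phi>] quasi_map_gen[OF \<phi>] antichain_letter_relabel)
    finally show ?case .
  qed
qed

lemma relabel_iota_letter: "relabel \<phi> (iota_letter s) = iota_letter (symmetric_map \<phi> s)"
proof (rule symmetric_linear_eqI[OF linear_comp[OF linear_relabel linear_iota_letter]
      linear_comp[OF linear_iota_letter linear_symmetric_map[OF \<phi>]]])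
  fix xs :: "'u list"
  have "gen (redecorate \<phi> (isolated xs)) = gen (isolated (map \<phi> xs))"
    by (rule gen_cong_forest) auto
  then show "relabel \<phi> (iota_letter (symmetric_product xs))
      = iota_letter (symmetric_map \<phi> (symmetric_product xs))"
    by (simp add: iota_letter_symmetric_product relabel_primitive_part symmetric_map_product[OF \<phi>]
        relabel_gen)
qed

lemma relabel_growth_word: "relabel \<phi> (growth_word xs) = growth_word (map (relabel \<phi>) xs)"
  by (induction xs rule: rev_induct) (simp_all add: relabel_unit growth_word_snoc relabel_growth)

lemma relabel_iota: "relabel \<phi> (iota x) = iota (quasi_map \<phi> x)"
  by (rule linear_eq_on_gen[OF linear_comp[OF linear_relabel linear_iota]
        linear_comp[OF linear_iota linear_quasi_map[OF \<phi>]]])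
     (simp add: iota_gen quasi_map_gen[OF \<phi>] relabel_growth_word relabel_iota_letter o_def)

end

section \<open>The intrinsic quasi-arborification theorem\<close>

theorem theorem2p21:
  assumes "\<exists>B :: 'u::real_vector set. finite B \<and> span B = UNIV"
    and "\<exists>B :: 'v::real_vector set. finite B \<and> span B = UNIV"
  shows "\<exists>\<aa> :: 'u forests \<Rightarrow> 'u quasi_words.
    hopf_morphism CK QSh \<aa> \<and> surj \<aa> \<and> quasi_arborification_rec \<aa> \<and>
    (\<forall>\<aa>'. algebra_morphism CK QSh \<aa>' \<and> quasi_arborification_rec \<aa>' \<longrightarrow> \<aa>' = \<aa>) \<and>
    (\<forall>(\<phi> :: 'u \<Rightarrow> 'v) \<bb>.
       linear \<phi> \<and> algebra_morphism CK QSh \<bb> \<and> quasi_arborification_rec \<bb> \<longrightarrow>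
       quasi_map \<phi> \<circ> \<aa> = \<bb> \<circ> relabel \<phi>) \<and>
    \<aa> \<circ> iota = id \<and>
    coalgebra_morphism QSh CK (iota :: 'u quasi_words \<Rightarrow> 'u forests) \<and>
    inj (iota :: 'u quasi_words \<Rightarrow> 'u forests) \<and>
    (\<forall>\<phi> :: 'u \<Rightarrow> 'v. linear \<phi> \<longrightarrow> relabel \<phi> \<circ> iota = iota \<circ> quasi_map \<phi>)"
proof (intro exI[of _ quasi_arborification] conjI allI impI)
  let ?a = "quasi_arborification :: 'u forests \<Rightarrow> 'u quasi_words"
  show "hopf_morphism CK QSh ?a"
    by (rule hopf_morphism_quasi_arborification)
  show "quasi_arborification_rec ?a"
    by (rule quasi_arborification_rec)
  show "surj ?a"
    by (rule surjI) (rule quasi_arborification_iota)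
  show "inj (iota :: 'u quasi_words \<Rightarrow> 'u forests)"
    by (rule inj_on_inverseI) (rule quasi_arborification_iota)
  show "?a \<circ> iota = id"
    by (simp add: fun_eq_iff quasi_arborification_iota)
  show "coalgebra_morphism QSh CK (iota :: 'u quasi_words \<Rightarrow> 'u forests)"
    by (rule coalgebra_morphism_iota)
  show "a' = ?a" if "algebra_morphism CK QSh a' \<and> quasi_arborification_rec a'" for a'
    using that quasi_arborification_unique by blast
  show "quasi_map \<phi> \<circ> ?a = b \<circ> relabel \<phi>"
    if b: "linear \<phi> \<and> algebra_morphism CK QSh b \<and> quasi_arborification_rec b"
    for \<phi> :: "'u \<Rightarrow> 'v" and b
  proof -
    have "b = quasi_arborification"
      using b quasi_arborification_unique by blast
    with b show ?thesis
      by (simp add: fun_eq_iff quasi_arborification_relabel)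
  qed
  show "relabel \<phi> \<circ> iota = iota \<circ> quasi_map \<phi>" if "linear \<phi>" for \<phi> :: "'u \<Rightarrow> 'v"
    using that by (simp add: fun_eq_iff relabel_iota)
qed

end
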